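(* Let $k$ be a field, let $B=kQ/I$ be a bound quiver algebra, let $F$ be a set of new arrows without relative cycles, and let $B_F=kQ_F/\langle I\rangle_{kQ_F}$. Let $Y$ be a finite dimensional $B_F$-bimodule. Then there is an exact sequence $$0\to H_1(B,Y)\to H_1(B_F,Y)\to H_1(B_F|B,Y)\to 0.$$
   Context: A quiver $Q$ has a finite set of vertices $Q_0$, a finite set of arrows $Q_1$, and source and target maps $s,t:Q_1\to Q_0$. A path of length $n>0$ is a sequence of arrows $(a_n,\dots,a_1)$ with $s(a_{i+1})=t(a_i)$; its source is $s(a_1)$ and its target is $t(a_n)$; vertices are the paths of length $0$. $Q_n$ is the set of paths of length $n$. In the path algebra $kQ$ the product $\beta\alpha$ of two paths is their concatenation if $t(\alpha)=s(\beta)$, and $0$ otherwise; vertices are orthogonal idempotents. A bound quiver algebra is $B=kQ/I$ with $I$ a two-sided ideal which is admissible, i.e. $\langle Q_n\rangle\subset I\subset\langle Q_2\rangle$ for some $n\ge 2$. A set of new arrows is a finite set $F$ with two maps $s,t:F\to Q_0$. The quiver $Q_F$ has vertices $Q_0$ and arrows $Q_1\sqcup F$, with the evident source and target maps; $\langle I\rangle_{kQ_F}$ is the two-sided ideal of $kQ_F$ generated by $I$. The algebra $B$ is a subalgebra of $B_F$ via the canonical map. A relative path of length $n>0$ is a sequence $\gamma=(a_n,\dots,a_1)$ of elements of $F$ such that $s(a_{i+1})\,B\,t(a_i)\neq 0$ for $i=1,\dots,n-1$; put $s(\gamma)=s(a_1)$, $t(\gamma)=t(a_n)$. A relative cycle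 is a relative path $\gamma$ with $s(\gamma)\,B\,t(\gamma)\neq 0$. $H_n(A,Y)$ is the Hochschild homology of $A$ with coefficients in the $A$-bimodule $Y$. For an inclusion of $k$-algebras $B\subset A$, $H_n(A|B,Y)$ is the relative Hochschild homology (G. Hochschild's relative Tor for $B\otimes B^{op}\subset A\otimes A^{op}$), i.e. the homology of the complex obtained by applying $-\otimes_{A-A}Y$ to the relative bar resolution $\cdots\to A\otimes_BA\otimes_BA\to A\otimes_BA$ of $A$. *)

theory Defs
  imports "HOL-Algebra.QuotRing" "HOL-Algebra.Module" "HOL-Library.Poly_Mapping"
    "Graph_Theory.Arc_Walk"
begin

section \<open>Vector spaces\<close>

text \<open>
  The field \<open>k\<close> is a type of class \<^class>\<open>field\<close>.  Vector spaces and algebras over it are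
  \<open>module\<close> records of HOL-Algebra; since these extend ring records, the fields \<open>mult\<close> and \<open>one\<close>
  of a record that is only a vector space carry no meaning.
\<close>

definition ground :: "'k::field ring" where
  "ground = \<lparr>carrier = UNIV, mult = (*), one = 1, zero = 0, add = (+)\<rparr>"

definition scale :: "'k::field \<Rightarrow> ('b \<Rightarrow>\<^sub>0 'k) \<Rightarrow> 'b \<Rightarrow>\<^sub>0 'k" where
  "scale c x = Poly_Mapping.map ((*) c) x"

abbreviation basis :: "'b \<Rightarrow> 'b \<Rightarrow>\<^sub>0 'k::field" where
  "basis b \<equiv> Poly_Mapping.single b 1"

definition lin_ext :: "('b \<Rightarrow> 'c \<Rightarrow>\<^sub>0 'k::field) \<Rightarrow> ('b \<Rightarrow>\<^sub>0 'k) \<Rightarrow> 'c \<Rightarrow>\<^sub>0 'k" where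
  "lin_ext f x = (\<Sum>b\<in>Poly_Mapping.keys x. scale (Poly_Mapping.lookup x b) (f b))"

definition free_space :: "'b set \<Rightarrow> ('k::field, 'b \<Rightarrow>\<^sub>0 'k) module" where
  "free_space X = \<lparr>carrier = {x. Poly_Mapping.keys x \<subseteq> X}, mult = undefined, one = undefined,
     zero = 0, add = (+), smult = scale\<rparr>"

definition lin_span :: "('k::field, 'b, 'm) module_scheme \<Rightarrow> 'b set \<Rightarrow> 'b set" where
  "lin_span V R = \<Inter>{W. submodule W ground V \<and> R \<subseteq> W}"

text \<open>
  \<open>quot_map V' W' f\<close> is the map \<open>V/W \<rightarrow> V'/W'\<close> induced by \<open>f : V \<rightarrow> V'\<close> with \<open>f W \<subseteq> W'\<close>; the union
  over representatives follows the style of \<^const>\<open>rcoset_mult\<close>.  It does not depend on \<open>V\<close> and \<open>W\<close>.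
\<close>

definition quot_map ::
  "('b, 'm) ring_scheme \<Rightarrow> 'b set \<Rightarrow> ('a \<Rightarrow> 'b) \<Rightarrow> 'a set \<Rightarrow> 'b set" where
  "quot_map V W f X = (\<Union>x\<in>X. W +>\<^bsub>V\<^esub> f x)"

text \<open>
  The quotient by a subspace, and also the quotient of an algebra by an ideal: it is
  \<^const>\<open>FactRing\<close> together with the induced scalar multiplication.
\<close>

definition quot_space :: "('k::field, 'b, 'm) module_scheme \<Rightarrow> 'b set \<Rightarrow> ('k, 'b set) module" where
  "quot_space V W = \<lparr>carrier = carrier (V Quot W), mult = mult (V Quot W), one = one (V Quot W),
     zero = zero (V Quot W), add = add (V Quot W),
     smult = (\<lambda>c. quot_map V W (smult V c))\<rparr>"

definition presented :: "'b set \<Rightarrow> ('b \<Rightarrow>\<^sub>0 'k::field) set \<Rightarrow> ('k, ('b \<Rightarrow>\<^sub>0 'k) set) module" where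
  "presented X R = quot_space (free_space X) (lin_span (free_space X) R)"

text \<open>The linear map into \<^term>\<open>presented X R\<close> given by \<open>h\<close> on generators.\<close>

definition presented_map ::
  "'c set \<Rightarrow> ('c \<Rightarrow>\<^sub>0 'k::field) set \<Rightarrow> ('b \<Rightarrow> 'c \<Rightarrow>\<^sub>0 'k) \<Rightarrow> ('b \<Rightarrow>\<^sub>0 'k) set \<Rightarrow> ('c \<Rightarrow>\<^sub>0 'k) set" where
  "presented_map X R h = quot_map (free_space X) (lin_span (free_space X) R) (lin_ext h)"

definition lin_map ::
  "('k::field, 'b, 'm) module_scheme \<Rightarrow> ('k, 'c, 'n) module_scheme \<Rightarrow> ('b \<Rightarrow> 'c) \<Rightarrow> bool" where
  "lin_map V W f \<longleftrightarrow> f \<in> hom (add_monoid V) (add_monoid W) \<and>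
     (\<forall>c. \<forall>x\<in>carrier V. f (c \<odot>\<^bsub>V\<^esub> x) = c \<odot>\<^bsub>W\<^esub> f x)"

definition finite_dimensional :: "('k::field, 'b, 'm) module_scheme \<Rightarrow> bool" where
  "finite_dimensional V \<longleftrightarrow> (\<exists>S. finite S \<and> S \<subseteq> carrier V \<and>
     (\<forall>x\<in>carrier V. \<exists>c. x = (\<Oplus>\<^bsub>V\<^esub>s\<in>S. c s \<odot>\<^bsub>V\<^esub> s)))"

text \<open>Exactness of \<open>0 \<rightarrow> U \<rightarrow> V \<rightarrow> W \<rightarrow> 0\<close> with the maps \<open>f\<close> and \<open>g\<close>, over \<open>k\<close>.\<close>

definition short_exact ::
  "('k::field, 'a, 'l) module_scheme \<Rightarrow> ('k, 'b, 'm) module_scheme \<Rightarrow> ('k, 'c, 'n) module_scheme \<Rightarrow>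
   ('a \<Rightarrow> 'b) \<Rightarrow> ('b \<Rightarrow> 'c) \<Rightarrow> bool" where
  "short_exact U V W f g \<longleftrightarrow>
     Module.module ground U \<and> Module.module ground V \<and> Module.module ground W \<and>
     lin_map U V f \<and> lin_map V W g \<and>
     inj_on f (carrier U) \<and> f ` carrier U = a_kernel V W g \<and> g ` carrier V = carrier W"


section \<open>Algebras and bimodules\<close>

locale k_algebra = ring A + Module.module ground A
  for A :: "('k::field, 'a, 'm) module_scheme" (structure) +
  assumes smult_mult_left: "\<lbrakk>x \<in> carrier A; y \<in> carrier A\<rbrakk> \<Longrightarrow> (c \<odot> x) \<otimes> y = c \<odot> (x \<otimes> y)"
    and smult_mult_right: "\<lbrakk>x \<in> carrier A; y \<in> carrier A\<rbrakk> \<Longrightarrow> x \<otimes> (c \<odot> y) = c \<odot> (x \<otimes> y)"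

record ('k, 'y, 'a) bimodule = "('k, 'y) module" +
  lact :: "'a \<Rightarrow> 'y \<Rightarrow> 'y"
  ract :: "'y \<Rightarrow> 'a \<Rightarrow> 'y"

locale bimodule = A?: k_algebra A + M?: Module.module ground M
  for A :: "('k::field, 'a, 'm) module_scheme" (structure)
    and M :: "('k, 'y, 'a, 'n) bimodule_scheme" (structure) +
  assumes lact_closed: "\<lbrakk>a \<in> carrier A; x \<in> carrier M\<rbrakk> \<Longrightarrow> lact M a x \<in> carrier M"
    and ract_closed: "\<lbrakk>a \<in> carrier A; x \<in> carrier M\<rbrakk> \<Longrightarrow> ract M x a \<in> carrier M"
    and lact_add: "\<lbrakk>a \<in> carrier A; x \<in> carrier M; y \<in> carrier M\<rbrakk> \<Longrightarrow>
      lact M a (x \<oplus>\<^bsub>M\<^esub> y) = lact M a x \<oplus>\<^bsub>M\<^esub> lact M a y"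
    and ract_add: "\<lbrakk>a \<in> carrier A; x \<in> carrier M; y \<in> carrier M\<rbrakk> \<Longrightarrow>
      ract M (x \<oplus>\<^bsub>M\<^esub> y) a = ract M x a \<oplus>\<^bsub>M\<^esub> ract M y a"
    and add_lact: "\<lbrakk>a \<in> carrier A; b \<in> carrier A; x \<in> carrier M\<rbrakk> \<Longrightarrow>
      lact M (a \<oplus>\<^bsub>A\<^esub> b) x = lact M a x \<oplus>\<^bsub>M\<^esub> lact M b x"
    and add_ract: "\<lbrakk>a \<in> carrier A; b \<in> carrier A; x \<in> carrier M\<rbrakk> \<Longrightarrow>
      ract M x (a \<oplus>\<^bsub>A\<^esub> b) = ract M x a \<oplus>\<^bsub>M\<^esub> ract M x b"
    and lact_mult: "\<lbrakk>a \<in> carrier A; b \<in> carrier A; x \<in> carrier M\<rbrakk> \<Longrightarrow>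
      lact M (a \<otimes>\<^bsub>A\<^esub> b) x = lact M a (lact M b x)"
    and ract_mult: "\<lbrakk>a \<in> carrier A; b \<in> carrier A; x \<in> carrier M\<rbrakk> \<Longrightarrow>
      ract M x (a \<otimes>\<^bsub>A\<^esub> b) = ract M (ract M x a) b"
    and lact_one: "x \<in> carrier M \<Longrightarrow> lact M \<one>\<^bsub>A\<^esub> x = x"
    and ract_one: "x \<in> carrier M \<Longrightarrow> ract M x \<one>\<^bsub>A\<^esub> = x"
    and lact_ract: "\<lbrakk>a \<in> carrier A; b \<in> carrier A; x \<in> carrier M\<rbrakk> \<Longrightarrow>
      ract M (lact M a x) b = lact M a (ract M x b)"
    and lact_smult: "\<lbrakk>a \<in> carrier A; x \<in> carrier M\<rbrakk> \<Longrightarrow>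
      lact M a (c \<odot>\<^bsub>M\<^esub> x) = c \<odot>\<^bsub>M\<^esub> lact M a x"
    and ract_smult: "\<lbrakk>a \<in> carrier A; x \<in> carrier M\<rbrakk> \<Longrightarrow>
      ract M (c \<odot>\<^bsub>M\<^esub> x) a = c \<odot>\<^bsub>M\<^esub> ract M x a"
    and smult_lact: "\<lbrakk>a \<in> carrier A; x \<in> carrier M\<rbrakk> \<Longrightarrow>
      lact M (c \<odot>\<^bsub>A\<^esub> a) x = c \<odot>\<^bsub>M\<^esub> lact M a x"
    and smult_ract: "\<lbrakk>a \<in> carrier A; x \<in> carrier M\<rbrakk> \<Longrightarrow>
      ract M x (c \<odot>\<^bsub>A\<^esub> a) = c \<odot>\<^bsub>M\<^esub> ract M x a"

definition restrict_bimodule ::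
  "('b \<Rightarrow> 'a) \<Rightarrow> ('k, 'y, 'a, 'n) bimodule_scheme \<Rightarrow> ('k, 'y, 'b) bimodule" where
  "restrict_bimodule \<phi> Y = \<lparr>carrier = carrier Y, mult = mult Y, one = one Y, zero = zero Y,
     add = add Y, smult = smult Y, lact = (\<lambda>b. lact Y (\<phi> b)), ract = (\<lambda>y b. ract Y y (\<phi> b))\<rparr>"


section \<open>Relative Hochschild homology\<close>

text \<open>
  \<open>rel_bar A S n\<close> is the term of degree \<open>n\<close> of the relative bar resolution, the tensor product
  \<open>A \<otimes>\<^sub>S \<dots> \<otimes>\<^sub>S A\<close> of \<open>n + 2\<close> copies of \<open>A\<close> over a subalgebra with carrier \<open>S\<close>.  The
  list \<open>[a\<^sub>0, \<dots>, a]\<close> of \<open>n + 2\<close> elements stands for \<open>a\<^sub>0 \<otimes> \<dots> \<otimes> a\<close>.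
\<close>

definition bar_gens :: "('a, 'm) ring_scheme \<Rightarrow> nat \<Rightarrow> 'a list set" where
  "bar_gens A n = {as. length as = n + 2 \<and> set as \<subseteq> carrier A}"

definition bar_rels ::
  "('k::field, 'a, 'm) module_scheme \<Rightarrow> 'a set \<Rightarrow> nat \<Rightarrow> ('a list \<Rightarrow>\<^sub>0 'k) set" where
  "bar_rels A S n =
     {basis (xs @ (a \<oplus>\<^bsub>A\<^esub> b) # ys) - basis (xs @ a # ys) - basis (xs @ b # ys) | xs a b ys.
        set xs \<union> set ys \<union> {a, b} \<subseteq> carrier A \<and> length xs + length ys = n + 1} \<union>
     {basis (xs @ (c \<odot>\<^bsub>A\<^esub> a) # ys) - scale c (basis (xs @ a # ys)) | xs c a ys.
        set xs \<union> set ys \<union> {a} \<subseteq> carrier A \<and> length xs + length ys = n + 1} \<union>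
     {basis (xs @ (a \<otimes>\<^bsub>A\<^esub> s) # b # ys) - basis (xs @ a # (s \<otimes>\<^bsub>A\<^esub> b) # ys) | xs a s b ys.
        set xs \<union> set ys \<union> {a, b} \<subseteq> carrier A \<and> s \<in> S \<and> length xs + length ys = n}"

definition rel_bar ::
  "('k::field, 'a, 'm) module_scheme \<Rightarrow> 'a set \<Rightarrow> nat \<Rightarrow> ('k, ('a list \<Rightarrow>\<^sub>0 'k) set, 'a) bimodule" where
  "rel_bar A S n = (let P = presented (bar_gens A n) (bar_rels A S n) in
     \<lparr>carrier = carrier P, mult = mult P, one = one P, zero = zero P, add = add P, smult = smult P,
      lact = (\<lambda>a. presented_map (bar_gens A n) (bar_rels A S n)
        (\<lambda>as. basis ((a \<otimes>\<^bsub>A\<^esub> hd as) # tl as))),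
      ract = (\<lambda>x a. presented_map (bar_gens A n) (bar_rels A S n)
        (\<lambda>as. basis (butlast as @ [last as \<otimes>\<^bsub>A\<^esub> a])) x)\<rparr>)"

text \<open>The differential from degree \<open>n + 1\<close> to degree \<open>n\<close>.\<close>

definition bar_diff ::
  "('k::field, 'a, 'm) module_scheme \<Rightarrow> 'a set \<Rightarrow> nat \<Rightarrow> ('a list \<Rightarrow>\<^sub>0 'k) set \<Rightarrow> ('a list \<Rightarrow>\<^sub>0 'k) set" where
  "bar_diff A S n = presented_map (bar_gens A n) (bar_rels A S n)
     (\<lambda>as. \<Sum>i\<le>n + 1. Poly_Mapping.single
        (take i as @ (as ! i \<otimes>\<^bsub>A\<^esub> as ! (i + 1)) # drop (i + 2) as) ((- 1) ^ i))"

text \<open>\<open>bitensor A M Y\<close> is \<open>M \<otimes> Y\<close> over \<open>A \<otimes> A\<^sup>o\<^sup>p\<close>: the last two families of relations balance the actions.\<close>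

definition bitensor_rels ::
  "('a, 'l) ring_scheme \<Rightarrow> ('k::field, 'x, 'a, 'm) bimodule_scheme \<Rightarrow> ('k, 'y, 'a, 'n) bimodule_scheme
   \<Rightarrow> ('x \<times> 'y \<Rightarrow>\<^sub>0 'k) set" where
  "bitensor_rels A M Y =
     {basis (x \<oplus>\<^bsub>M\<^esub> x', y) - basis (x, y) - basis (x', y) | x x' y.
        x \<in> carrier M \<and> x' \<in> carrier M \<and> y \<in> carrier Y} \<union>
     {basis (x, y \<oplus>\<^bsub>Y\<^esub> y') - basis (x, y) - basis (x, y') | x y y'.
        x \<in> carrier M \<and> y \<in> carrier Y \<and> y' \<in> carrier Y} \<union>
     {basis (c \<odot>\<^bsub>M\<^esub> x, y) - scale c (basis (x, y)) | c x y. x \<in> carrier M \<and> y \<in> carrier Y} \<union>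
     {basis (x, c \<odot>\<^bsub>Y\<^esub> y) - scale c (basis (x, y)) | c x y. x \<in> carrier M \<and> y \<in> carrier Y} \<union>
     {basis (ract M x a, y) - basis (x, lact Y a y) | x a y.
        x \<in> carrier M \<and> a \<in> carrier A \<and> y \<in> carrier Y} \<union>
     {basis (lact M a x, y) - basis (x, ract Y y a) | x a y.
        x \<in> carrier M \<and> a \<in> carrier A \<and> y \<in> carrier Y}"

definition bitensor ::
  "('a, 'l) ring_scheme \<Rightarrow> ('k::field, 'x, 'a, 'm) bimodule_scheme \<Rightarrow> ('k, 'y, 'a, 'n) bimodule_scheme
   \<Rightarrow> ('k, ('x \<times> 'y \<Rightarrow>\<^sub>0 'k) set) module" where
  "bitensor A M Y = presented (carrier M \<times> carrier Y) (bitensor_rels A M Y)"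

text \<open>The map \<open>f \<otimes> id\<close> into \<^term>\<open>bitensor A M Y\<close>.\<close>

definition bitensor_map ::
  "('a, 'l) ring_scheme \<Rightarrow> ('k::field, 'x, 'a, 'm) bimodule_scheme \<Rightarrow> ('k, 'y, 'a, 'n) bimodule_scheme
   \<Rightarrow> ('w \<Rightarrow> 'x) \<Rightarrow> ('w \<times> 'y \<Rightarrow>\<^sub>0 'k) set \<Rightarrow> ('x \<times> 'y \<Rightarrow>\<^sub>0 'k) set" where
  "bitensor_map A M Y f = presented_map (carrier M \<times> carrier Y) (bitensor_rels A M Y)
     (\<lambda>(w, y). basis (f w, y))"

definition hoch_chains ::
  "('k::field, 'a, 'm) module_scheme \<Rightarrow> 'a set \<Rightarrow> ('k, 'y, 'a, 'n) bimodule_scheme \<Rightarrow> nat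
   \<Rightarrow> ('k, (('a list \<Rightarrow>\<^sub>0 'k) set \<times> 'y \<Rightarrow>\<^sub>0 'k) set) module" where
  "hoch_chains A S Y n = bitensor A (rel_bar A S n) Y"

definition hoch_diff ::
  "('k::field, 'a, 'm) module_scheme \<Rightarrow> 'a set \<Rightarrow> ('k, 'y, 'a, 'n) bimodule_scheme \<Rightarrow> nat
   \<Rightarrow> (('a list \<Rightarrow>\<^sub>0 'k) set \<times> 'y \<Rightarrow>\<^sub>0 'k) set \<Rightarrow> (('a list \<Rightarrow>\<^sub>0 'k) set \<times> 'y \<Rightarrow>\<^sub>0 'k) set" where
  "hoch_diff A S Y n = bitensor_map A (rel_bar A S n) Y (bar_diff A S n)"

primrec hoch_cycles ::
  "('k::field, 'a, 'm) module_scheme \<Rightarrow> 'a set \<Rightarrow> ('k, 'y, 'a, 'n) bimodule_scheme \<Rightarrow> nat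
   \<Rightarrow> (('a list \<Rightarrow>\<^sub>0 'k) set \<times> 'y \<Rightarrow>\<^sub>0 'k) set set" where
  "hoch_cycles A S Y 0 = carrier (hoch_chains A S Y 0)"
| "hoch_cycles A S Y (Suc n) =
     a_kernel (hoch_chains A S Y (Suc n)) (hoch_chains A S Y n) (hoch_diff A S Y n)"

definition hoch_boundaries ::
  "('k::field, 'a, 'm) module_scheme \<Rightarrow> 'a set \<Rightarrow> ('k, 'y, 'a, 'n) bimodule_scheme \<Rightarrow> nat
   \<Rightarrow> (('a list \<Rightarrow>\<^sub>0 'k) set \<times> 'y \<Rightarrow>\<^sub>0 'k) set set" where
  "hoch_boundaries A S Y n = hoch_diff A S Y n ` carrier (hoch_chains A S Y (Suc n))"

definition rel_hochschild ::
  "('k::field, 'a, 'm) module_scheme \<Rightarrow> 'a set \<Rightarrow> ('k, 'y, 'a, 'n) bimodule_scheme \<Rightarrow> nat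
   \<Rightarrow> ('k, (('a list \<Rightarrow>\<^sub>0 'k) set \<times> 'y \<Rightarrow>\<^sub>0 'k) set set) module" where
  "rel_hochschild A S Y n =
     quot_space (hoch_chains A S Y n\<lparr>carrier := hoch_cycles A S Y n\<rparr>) (hoch_boundaries A S Y n)"

text \<open>
  Ordinary Hochschild homology is the case where the subalgebra consists of the scalars:
  \<open>rel_bar\<close> is then the usual bar resolution, whose tensor products are over \<open>k\<close>.
\<close>

definition scalars :: "('k::field, 'a, 'm) module_scheme \<Rightarrow> 'a set" where
  "scalars A = range (\<lambda>c. c \<odot>\<^bsub>A\<^esub> \<one>\<^bsub>A\<^esub>)"

definition hochschild ::
  "('k::field, 'a, 'm) module_scheme \<Rightarrow> ('k, 'y, 'a, 'n) bimodule_scheme \<Rightarrow> nat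
   \<Rightarrow> ('k, (('a list \<Rightarrow>\<^sub>0 'k) set \<times> 'y \<Rightarrow>\<^sub>0 'k) set set) module" where
  "hochschild A Y n = rel_hochschild A (scalars A) Y n"

text \<open>
  A homomorphism \<open>\<phi> : A \<rightarrow> A'\<close> of algebras with \<open>\<phi> S \<subseteq> S'\<close> induces a map
  \<open>H\<^sub>n(A|S, Y') \<rightarrow> H\<^sub>n(A'|S', Y')\<close> by \<open>(a\<^sub>0 \<otimes> \<dots> \<otimes> a) \<otimes> y \<mapsto> (\<phi> a\<^sub>0 \<otimes> \<dots> \<otimes> \<phi> a) \<otimes> y\<close>,
  where \<open>Y'\<close> is an \<open>A\<close>-bimodule through \<open>\<phi>\<close>.
\<close>

definition hoch_map ::
  "('a \<Rightarrow> 'b) \<Rightarrow> ('k::field, 'b, 'm) module_scheme \<Rightarrow> 'b set \<Rightarrow> ('k, 'y, 'b, 'n) bimodule_scheme \<Rightarrow> nat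
   \<Rightarrow> (('a list \<Rightarrow>\<^sub>0 'k) set \<times> 'y \<Rightarrow>\<^sub>0 'k) set set \<Rightarrow> (('b list \<Rightarrow>\<^sub>0 'k) set \<times> 'y \<Rightarrow>\<^sub>0 'k) set set" where
  "hoch_map \<phi> A' S' Y' n =
     quot_map (hoch_chains A' S' Y' n) (hoch_boundaries A' S' Y' n)
       (bitensor_map A' (rel_bar A' S' n) Y'
         (presented_map (bar_gens A' n) (bar_rels A' S' n) (\<lambda>as. basis (map \<phi> as))))"


section \<open>Path algebras and bound quiver algebras\<close>

text \<open>
  A quiver is a finite directed multigraph \<^locale>\<open>fin_digraph\<close> with \<open>tail\<close> as source and \<open>head\<close>
  as target.  The path \<open>(a\<^sub>n, \<dots>, a\<^sub>1)\<close> from \<open>u\<close> to \<open>v\<close> is the triple \<open>(u, [a\<^sub>1, \<dots>, a\<^sub>n], v)\<close>, so the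
  arrows are listed in the order in which they are traversed, which is the reverse of
  their order in a product.  The vertex \<open>v\<close> is the path \<open>(v, [], v)\<close>.
\<close>

type_synonym ('v, 'e) path = "'v \<times> 'e list \<times> 'v"

definition paths :: "('v, 'e) pre_digraph \<Rightarrow> ('v, 'e) path set" where
  "paths Q = {(u, p, v). pre_digraph.awalk Q u p v}"

definition paths_of_length :: "('v, 'e) pre_digraph \<Rightarrow> nat \<Rightarrow> ('v, 'e) path set" where
  "paths_of_length Q n = {(u, p, v) \<in> paths Q. length p = n}"

text \<open>\<open>path_prod \<beta> \<alpha>\<close> is \<open>\<beta>\<alpha>\<close>: first \<open>\<alpha>\<close>, then \<open>\<beta>\<close>.\<close>

fun path_prod :: "('v, 'e) path \<Rightarrow> ('v, 'e) path \<Rightarrow> (('v, 'e) path \<Rightarrow>\<^sub>0 'k::field)" where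
  "path_prod (u', q, w) (u, p, v) = (if v = u' then basis (u, p @ q, w) else 0)"

definition path_algebra :: "('v, 'e) pre_digraph \<Rightarrow> ('k::field, ('v, 'e) path \<Rightarrow>\<^sub>0 'k) module" where
  "path_algebra Q = (free_space (paths Q))\<lparr>
     mult := (\<lambda>x y. lin_ext (\<lambda>\<beta>. lin_ext (\<lambda>\<alpha>. path_prod \<beta> \<alpha>) y) x),
     one := (\<Sum>v\<in>verts Q. basis (v, [], v))\<rparr>"

definition admissible :: "('v, 'e) pre_digraph \<Rightarrow> (('v, 'e) path \<Rightarrow>\<^sub>0 'k::field) set \<Rightarrow> bool" where
  "admissible Q I \<longleftrightarrow> ideal I (path_algebra Q) \<and>
     (\<exists>n\<ge>2. genideal (path_algebra Q) (basis ` paths_of_length Q n) \<subseteq> I \<and>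
            I \<subseteq> genideal (path_algebra Q) (basis ` paths_of_length Q 2))"

definition bound_algebra ::
  "('v, 'e) pre_digraph \<Rightarrow> (('v, 'e) path \<Rightarrow>\<^sub>0 'k::field) set \<Rightarrow> ('k, (('v, 'e) path \<Rightarrow>\<^sub>0 'k) set) module" where
  "bound_algebra Q I = quot_space (path_algebra Q) I"


section \<open>Adding arrows\<close>

definition new_arrows ::
  "('v, 'e) pre_digraph \<Rightarrow> 'f set \<Rightarrow> ('f \<Rightarrow> 'v) \<Rightarrow> ('f \<Rightarrow> 'v) \<Rightarrow> bool" where
  "new_arrows Q F s t \<longleftrightarrow> finite F \<and> s ` F \<subseteq> verts Q \<and> t ` F \<subseteq> verts Q"

definition add_arrows ::
  "('v, 'e) pre_digraph \<Rightarrow> 'f set \<Rightarrow> ('f \<Rightarrow> 'v) \<Rightarrow> ('f \<Rightarrow> 'v) \<Rightarrow> ('v, 'e + 'f) pre_digraph" where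
  "add_arrows Q F s t = \<lparr>verts = verts Q, arcs = Inl ` arcs Q \<union> Inr ` F,
     tail = case_sum (tail Q) s, head = case_sum (head Q) t\<rparr>"

definition path_inclusion ::
  "(('v, 'e) path \<Rightarrow>\<^sub>0 'k::field) \<Rightarrow> (('v, 'e + 'f) path \<Rightarrow>\<^sub>0 'k)" where
  "path_inclusion = lin_ext (\<lambda>(u, p, v). basis (u, map Inl p, v))"

definition extended_ideal ::
  "('v, 'e) pre_digraph \<Rightarrow> (('v, 'e) path \<Rightarrow>\<^sub>0 'k::field) set \<Rightarrow> 'f set \<Rightarrow> ('f \<Rightarrow> 'v) \<Rightarrow> ('f \<Rightarrow> 'v)
   \<Rightarrow> (('v, 'e + 'f) path \<Rightarrow>\<^sub>0 'k) set" where
  "extended_ideal Q I F s t = genideal (path_algebra (add_arrows Q F s t)) (path_inclusion ` I)"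

definition extended_algebra ::
  "('v, 'e) pre_digraph \<Rightarrow> (('v, 'e) path \<Rightarrow>\<^sub>0 'k::field) set \<Rightarrow> 'f set \<Rightarrow> ('f \<Rightarrow> 'v) \<Rightarrow> ('f \<Rightarrow> 'v)
   \<Rightarrow> ('k, (('v, 'e + 'f) path \<Rightarrow>\<^sub>0 'k) set) module" where
  "extended_algebra Q I F s t =
     bound_algebra (add_arrows Q F s t) (extended_ideal Q I F s t)"

definition canonical_map ::
  "('v, 'e) pre_digraph \<Rightarrow> (('v, 'e) path \<Rightarrow>\<^sub>0 'k::field) set \<Rightarrow> 'f set \<Rightarrow> ('f \<Rightarrow> 'v) \<Rightarrow> ('f \<Rightarrow> 'v)
   \<Rightarrow> (('v, 'e) path \<Rightarrow>\<^sub>0 'k) set \<Rightarrow> (('v, 'e + 'f) path \<Rightarrow>\<^sub>0 'k) set" where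
  "canonical_map Q I F s t =
     quot_map (path_algebra (add_arrows Q F s t)) (extended_ideal Q I F s t) path_inclusion"

text \<open>\<open>x B y \<noteq> 0\<close>, for vertices \<open>x\<close> and \<open>y\<close>.\<close>

definition corner_nonzero ::
  "('v, 'e) pre_digraph \<Rightarrow> (('v, 'e) path \<Rightarrow>\<^sub>0 'k::field) set \<Rightarrow> 'v \<Rightarrow> 'v \<Rightarrow> bool" where
  "corner_nonzero Q I x y \<longleftrightarrow> (let B = bound_algebra Q I;
       e = (\<lambda>v. I +>\<^bsub>path_algebra Q\<^esub> basis (v, [], v)) in
     \<exists>b\<in>carrier B. e x \<otimes>\<^bsub>B\<^esub> b \<otimes>\<^bsub>B\<^esub> e y \<noteq> \<zero>\<^bsub>B\<^esub>)"

text \<open>As for paths, the relative path \<open>(a\<^sub>n, \<dots>, a\<^sub>1)\<close> is the list \<open>[a\<^sub>1, \<dots>, a\<^sub>n]\<close>.\<close>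

definition relative_path ::
  "('v, 'e) pre_digraph \<Rightarrow> (('v, 'e) path \<Rightarrow>\<^sub>0 'k::field) set \<Rightarrow> 'f set \<Rightarrow> ('f \<Rightarrow> 'v) \<Rightarrow> ('f \<Rightarrow> 'v)
   \<Rightarrow> 'f list \<Rightarrow> bool" where
  "relative_path Q I F s t \<gamma> \<longleftrightarrow> \<gamma> \<noteq> [] \<and> set \<gamma> \<subseteq> F \<and>
     (\<forall>i. i + 1 < length \<gamma> \<longrightarrow> corner_nonzero Q I (s (\<gamma> ! (i + 1))) (t (\<gamma> ! i)))"

definition relative_cycle ::
  "('v, 'e) pre_digraph \<Rightarrow> (('v, 'e) path \<Rightarrow>\<^sub>0 'k::field) set \<Rightarrow> 'f set \<Rightarrow> ('f \<Rightarrow> 'v) \<Rightarrow> ('f \<Rightarrow> 'v)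
   \<Rightarrow> 'f list \<Rightarrow> bool" where
  "relative_cycle Q I F s t \<gamma> \<longleftrightarrow> relative_path Q I F s t \<gamma> \<and>
     corner_nonzero Q I (s (hd \<gamma>)) (t (last \<gamma>))"


section \<open>Well-formedness\<close>

text \<open>
  Free spaces are vector spaces and path algebras are algebras, so the generated subspaces and
  ideals above are intersections of nonempty families.
\<close>

lemma ground_cring: "cring (ground :: 'k::field ring)"
proof (rule cringI)
  show "abelian_group (ground :: 'k::field ring)"
  proof (rule abelian_groupI)
    fix x :: 'k
    show "\<exists>y\<in>carrier ground. y \<oplus>\<^bsub>ground\<^esub> x = \<zero>\<^bsub>ground\<^esub>"
      by (rule bexI[of _ "-x"]) (simp_all add: ground_def)
  qed (simp_all add: ground_def algebra_simps)
  show "Group.comm_monoid (ground :: 'k::field ring)"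
    by (rule comm_monoidI) (simp_all add: ground_def algebra_simps)
qed (simp_all add: ground_def algebra_simps)

lemma ground_sel [simp]:
  "carrier ground = UNIV" "add ground = (+)" "mult ground = (*)" "one ground = 1" "zero ground = 0"
  by (simp_all add: ground_def)

lemma lookup_scale [simp]: "Poly_Mapping.lookup (scale c x) p = c * Poly_Mapping.lookup x p"
  unfolding scale_def by (auto simp: Poly_Mapping.map.rep_eq when_def)

lemma scale_simps:
  "scale c (x + y) = scale c x + scale c y" "scale (c + d) x = scale c x + scale d x"
  "scale c (scale d x) = scale (c * d) x" "scale 1 x = x" "scale 0 x = 0" "scale c 0 = 0"
  by (auto intro!: poly_mapping_eqI simp: lookup_add algebra_simps)

lemma scale_sum: "scale c (sum f S) = (\<Sum>x\<in>S. scale c (f x))"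
  by (rule poly_mapping_eqI) (simp add: lookup_sum sum_distrib_left)

lemma free_space_sel [simp]:
  "carrier (free_space X) = {x. Poly_Mapping.keys x \<subseteq> X}" "add (free_space X) = (+)"
  "zero (free_space X) = 0" "smult (free_space X) = scale"
  by (simp_all add: free_space_def)

lemma keys_scale: "Poly_Mapping.keys (scale c x) \<subseteq> Poly_Mapping.keys x"
  by (auto simp: in_keys_iff)

lemma free_space_abelian_group: "abelian_group (free_space X :: ('b::field, 'a \<Rightarrow>\<^sub>0 'b) module)"
proof (rule abelian_groupI)
  fix x assume "x \<in> carrier (free_space X)"
  then show "\<exists>y\<in>carrier (free_space X). y \<oplus>\<^bsub>free_space X\<^esub> x = \<zero>\<^bsub>free_space X\<^esub>"
    by (intro bexI[of _ "-x"]) (auto simp: in_keys_iff)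
next
  fix x y :: "'a \<Rightarrow>\<^sub>0 'b" assume "x \<in> carrier (free_space X)" "y \<in> carrier (free_space X)"
  then show "x \<oplus>\<^bsub>free_space X\<^esub> y \<in> carrier (free_space X)"
    using Poly_Mapping.keys_add[of x y] by auto
qed (simp_all add: algebra_simps)

lemma free_space_module: "Module.module ground (free_space X)"
proof (rule moduleI)
  show "c \<odot>\<^bsub>free_space X\<^esub> x \<in> carrier (free_space X)" if "x \<in> carrier (free_space X)" for c x
    using that keys_scale[of c x] by auto
qed (simp_all add: scale_simps ground_cring free_space_abelian_group)

lemma lin_ext_superset:
  assumes "finite S" "Poly_Mapping.keys x \<subseteq> S"
  shows "lin_ext f x = (\<Sum>b\<in>S. scale (Poly_Mapping.lookup x b) (f b))"
  unfolding lin_ext_def using assms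
  by (intro sum.mono_neutral_left) (auto simp: in_keys_iff scale_simps)

lemma lin_ext_add: "lin_ext f (x + y) = lin_ext f x + lin_ext f y"
proof -
  let ?S = "Poly_Mapping.keys x \<union> Poly_Mapping.keys y"
  have "lin_ext f (x+y) = (\<Sum>b\<in>?S. scale (Poly_Mapping.lookup (x+y) b) (f b))"
    using Poly_Mapping.keys_add[of x y] by (intro lin_ext_superset) auto
  then show ?thesis
    using lin_ext_superset[of ?S x f] lin_ext_superset[of ?S y f]
    by (simp add: lookup_add scale_simps sum.distrib)
qed

lemma lin_ext_scale: "lin_ext f (scale c x) = scale c (lin_ext f x)"
  using lin_ext_superset[OF _ keys_scale, of x f c]
  by (simp add: lin_ext_def scale_sum scale_simps)

lemma lin_ext_0 [simp]: "lin_ext f 0 = 0" by (simp add: lin_ext_def)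
lemma lin_ext_sum: "lin_ext f (sum g S) = (\<Sum>x\<in>S. lin_ext f (g x))"
  by (induction S rule: infinite_finite_induct) (auto simp: lin_ext_add)
lemma lin_ext_basis [simp]: "lin_ext f (basis b) = f b"
  by (simp add: lin_ext_def scale_simps)
lemma lin_ext_comp: "lin_ext f (lin_ext g x) = lin_ext (\<lambda>b. lin_ext f (g b)) x"
  unfolding lin_ext_def[of g x] lin_ext_def[of "\<lambda>b. lin_ext f (g b)" x]
  by (simp only: lin_ext_sum lin_ext_scale)
lemma lin_ext_fadd: "lin_ext (\<lambda>b. f b + g b) x = lin_ext f x + lin_ext g x"
  by (simp add: lin_ext_def scale_simps sum.distrib)
lemma lin_ext_fscale: "lin_ext (\<lambda>b. scale c (f b)) x = scale c (lin_ext f x)"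
  by (simp add: lin_ext_def scale_simps scale_sum mult.commute)
lemma lin_ext_f0: "lin_ext (\<lambda>b. 0) x = 0"
  by (simp add: lin_ext_def scale_simps)
lemma lin_ext_id: "lin_ext basis x = x"
proof (rule poly_mapping_eqI)
  fix p
  show "Poly_Mapping.lookup (lin_ext basis x) p = Poly_Mapping.lookup x p"
    by (simp add: lin_ext_def lookup_sum lookup_single when_def sum.delta' if_distrib cong: if_cong)
       (auto simp: in_keys_iff)
qed
lemma lin_ext_cong: "(\<And>b. b \<in> Poly_Mapping.keys x \<Longrightarrow> f b = g b) \<Longrightarrow> lin_ext f x = lin_ext g x"
  by (simp add: lin_ext_def)
lemma lin_ext_keys: "Poly_Mapping.keys x \<subseteq> X \<Longrightarrow> (\<And>b. b \<in> X \<Longrightarrow> Poly_Mapping.keys (f b) \<subseteq> Y)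
   \<Longrightarrow> Poly_Mapping.keys (lin_ext f x) \<subseteq> Y"
  unfolding lin_ext_def by (rule order.trans[OF Poly_Mapping.keys_sum]) (use keys_scale in fastforce)

lemma path_algebra_sel [simp]:
  "carrier (path_algebra X) = {x. Poly_Mapping.keys x \<subseteq> paths X}" "add (path_algebra X) = (+)"
  "zero (path_algebra X) = 0" "smult (path_algebra X) = scale"
  "mult (path_algebra X) = (\<lambda>x y. lin_ext (\<lambda>\<beta>. lin_ext (\<lambda>\<alpha>. path_prod \<beta> \<alpha>) y) x)"
  "one (path_algebra X) = (\<Sum>v\<in>verts X. basis (v, [], v))"
  by (simp_all add: path_algebra_def)

lemma path_prod_assoc: fixes z :: "_ \<Rightarrow>\<^sub>0 'b::field" shows "lin_ext (\<lambda>\<gamma>. lin_ext (path_prod \<gamma>) z) (path_prod \<beta> \<alpha>)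
   = lin_ext (\<lambda>\<delta>. lin_ext (path_prod \<beta>) (path_prod \<alpha> \<delta>)) z"
proof -
  obtain u p v where b: "\<beta> = (u,p,v)" by (cases \<beta>)
  obtain u' p' v' where a: "\<alpha> = (u',p',v')" by (cases \<alpha>)
  show ?thesis
  proof (cases "v' = u")
    case True
    have "path_prod (u',p'@p,v) \<delta> = lin_ext (path_prod \<beta>) (path_prod \<alpha> \<delta>)" for \<delta>
      using True by (cases \<delta>) (auto simp: a b)
    then show ?thesis using True by (auto simp: a b intro!: lin_ext_cong)
  next
    case False
    have "lin_ext (path_prod \<beta>) (path_prod \<alpha> \<delta>) = (0 :: _ \<Rightarrow>\<^sub>0 'b)" for \<delta>
      using False by (cases \<delta>) (auto simp: a b)
    then have "lin_ext (\<lambda>\<delta>. lin_ext (path_prod \<beta>) (path_prod \<alpha> \<delta>)) z = 0"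
      by (simp add: lin_ext_f0)
    with False show ?thesis by (simp add: a b)
  qed
qed

context fin_digraph begin

lemma path_algebra_abelian_group: "abelian_group (path_algebra G :: ('k::field, _) module)"
proof -
  have "add_monoid (path_algebra G :: ('k,_) module) = add_monoid (free_space (paths G))"
    by simp
  then show ?thesis using free_space_abelian_group[of "paths G", where 'b='k]
    unfolding abelian_group_def abelian_group_axioms_def abelian_monoid_def by simp
qed

lemma path_ends_in_verts: "(u,p,v) \<in> paths G \<Longrightarrow> u \<in> verts G \<and> v \<in> verts G"
  unfolding paths_def by (auto dest: awalkI_apath awalk_last_in_verts awalk_hd_in_verts)

lemma path_algebra_k_algebra: "k_algebra (path_algebra G :: ('k::field, ('a,'b) path \<Rightarrow>\<^sub>0 'k) module)" (is "k_algebra ?A")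
proof -
  have closed: "x \<otimes>\<^bsub>?A\<^esub> y \<in> carrier ?A" if "x \<in> carrier ?A" "y \<in> carrier ?A" for x y
  proof -
    have "Poly_Mapping.keys (path_prod b a :: _ \<Rightarrow>\<^sub>0 'k) \<subseteq> paths G" if "b \<in> paths G" "a \<in> paths G" for a b
    proof -
      obtain u p v u' p' v' where ab: "a = (u,p,v)" "b = (u',p',v')" by (cases a; cases b) 
      show ?thesis
      proof (cases "v = u'")
        case True
        with that ab have "awalk u p v" "awalk v p' v'" by (auto simp: paths_def)
        then have "awalk u (p @ p') v'" by (rule awalk_appendI)
        with True show ?thesis by (simp add: ab paths_def)
      qed (simp add: ab)
    qed
    then have 1: "Poly_Mapping.keys (lin_ext (path_prod b) y :: _ \<Rightarrow>\<^sub>0 'k) \<subseteq> paths G" if "b \<in> paths G" for b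
      using \<open>y \<in> carrier ?A\<close> that by (intro lin_ext_keys[of y "paths G"]) simp_all
    show ?thesis using \<open>x \<in> carrier ?A\<close> lin_ext_keys[of x "paths G" "\<lambda>\<beta>. lin_ext (path_prod \<beta>) y" "paths G", OF _ 1] by simp
  qed
  have one: "\<one>\<^bsub>?A\<^esub> \<in> carrier ?A"
    by simp (rule order.trans[OF Poly_Mapping.keys_sum], auto simp: paths_def awalk_Nil_iff)
  have l: "lin_ext (\<lambda>\<alpha>. lin_ext (\<lambda>\<beta>. path_prod \<beta> \<alpha>) \<one>\<^bsub>?A\<^esub>) x = x" if "x \<in> carrier ?A" for x
  proof -
    have "lin_ext (\<lambda>\<beta>. path_prod \<beta> \<alpha>) \<one>\<^bsub>?A\<^esub> = basis \<alpha>" if "\<alpha> \<in> paths G" for \<alpha>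
      using path_ends_in_verts that by (cases \<alpha>) (simp add: lin_ext_sum sum.delta')
    with that show ?thesis by (subst (3) lin_ext_id[symmetric]) (auto intro!: lin_ext_cong)
  qed
  have swap: "lin_ext (\<lambda>\<beta>. lin_ext (path_prod \<beta>) y) x = lin_ext (\<lambda>\<alpha>. lin_ext (\<lambda>\<beta>. path_prod \<beta> \<alpha>) x) y"
    for x y :: "('a,'b) path \<Rightarrow>\<^sub>0 'k"
    unfolding lin_ext_def scale_sum by (subst sum.swap) (simp add: scale_simps mult.commute)
  have r: "lin_ext (\<lambda>\<beta>. lin_ext (path_prod \<beta>) \<one>\<^bsub>?A\<^esub>) x = x" if "x \<in> carrier ?A" for x
  proof -
    have "lin_ext (path_prod \<beta>) \<one>\<^bsub>?A\<^esub> = basis \<beta>" if "\<beta> \<in> paths G" for \<beta>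
      using path_ends_in_verts that by (cases \<beta>) (simp add: lin_ext_sum sum.delta)
    with that show ?thesis by (subst (3) lin_ext_id[symmetric]) (auto intro!: lin_ext_cong)
  qed
  have ring: "ring ?A"
  proof (rule ringI[OF path_algebra_abelian_group monoidI])
    fix x y z assume "x \<in> carrier ?A" "y \<in> carrier ?A" "z \<in> carrier ?A"
    show "x \<otimes>\<^bsub>?A\<^esub> y \<otimes>\<^bsub>?A\<^esub> z = x \<otimes>\<^bsub>?A\<^esub> (y \<otimes>\<^bsub>?A\<^esub> z)"
      by (simp add: lin_ext_comp path_prod_assoc)
  qed (use closed one l r swap in \<open>auto simp: lin_ext_add lin_ext_fadd\<close>)
  have mod: "Module.module ground ?A"
  proof (rule moduleI)
    show "c \<odot>\<^bsub>?A\<^esub> x \<in> carrier ?A" if "x \<in> carrier ?A" for c x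
      using that keys_scale[of c x] by auto
  qed (simp_all add: scale_simps ground_cring path_algebra_abelian_group)
  show ?thesis
    by (intro k_algebra.intro k_algebra_axioms.intro ring mod)
       (simp_all add: lin_ext_scale lin_ext_fscale)
qed
end

lemma add_arrows_fin_digraph: "fin_digraph Q \<Longrightarrow> new_arrows Q F s t \<Longrightarrow> fin_digraph (add_arrows Q F s t)"
  unfolding new_arrows_def add_arrows_def fin_digraph_def fin_digraph_axioms_def wf_digraph_def by auto

end

theory Submission
  imports Defs
begin

text \<open>
  Write \<open>A\<close> for the algebra obtained from \<open>B\<close> by adding the arrows \<open>F\<close>. A linear form on the chains
  \<open>A \<otimes> Y\<close> of degree one that kills the boundaries is the same thing as a derivation of \<open>A\<close> with values
  in the dual bimodule of \<open>Y\<close> (\<open>boundary_form_leibniz\<close>, \<open>leibniz_form_boundaries\<close>). Over a field, linear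
  forms separate a subspace from the elements outside it (\<open>separating_form\<close>), so statements about first homology
  become statements about derivations, which are much easier to construct than maps out of
  iterated quotients.

  Exactness at the middle and at the right end holds for every homomorphism \<open>B \<rightarrow> A\<close>. The relative complex is the
  quotient of the absolute one that moves elements of \<open>B\<close> across tensor signs. Up to boundaries, this
  kills exactly the chains \<open>b \<otimes> y\<close> with \<open>b\<close> in the image of \<open>B\<close> (\<open>kernel_degree1\<close>,
  \<open>base_chains_bound\<close>), and in degree zero it kills exactly their boundaries (\<open>kernel_degree0\<close>). A diagram
  chase then gives exactness, since \<open>B\<close> and \<open>A\<close> have the same chains of degree zero, namely \<open>Y\<close>
  (\<open>f_inj_degree0\<close>).

  Injectivity at the left end is dual to the surjectivity of restriction on first cohomology: it holds as
  soon as every derivation of \<open>B\<close> into the dual of \<open>Y\<close> becomes the restriction of a derivation of \<open>A\<close>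
  after an inner derivation is added to it (\<open>boundary_reflection\<close>). This is where the shape of \<open>A\<close> enters. The vertices are
  orthogonal idempotents with sum \<open>1\<close>, so an inner derivation makes the given derivation vanish on them. A
  derivation of a path algebra that vanishes on the vertices is determined by its values on the arrows, and
  these may be prescribed up to compatibility with the end vertices (\<open>derivation_form_paths\<close>); here they are kept on the old arrows and put to zero on
  the new ones. The resulting derivation of the path algebra of the larger quiver extends the
  given one, so it kills the relations in \<open>I\<close>, hence the ideal that they generate
  (\<open>derivation_kills_ideal\<close>), and it descends to \<open>A\<close> (\<open>derivation_descends\<close>, \<open>derivation_extends\<close>).
\<close>

section \<open>Quotients and presentations of vector spaces\<close>

locale quotient_space = Module.module ground V
  for V :: "('k::field, 'b, 'm) module_scheme" (structure) +
  fixes W :: "'b set"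
  assumes subspace: "submodule W ground V"
begin

sublocale abelian_subgroup W V
proof (rule abelian_subgroupI3)
  show "additive_subgroup W V"
    using subspace by (auto intro!: additive_subgroupI dest: submodule.axioms)
qed (rule abelian_group_axioms)

lemma quot_space_sel:
  "carrier (quot_space V W) = (\<lambda>x. W +> x) ` carrier V"
  "zero (quot_space V W) = W"
  "add (quot_space V W) = set_add V"
  by (auto simp: quot_space_def FactRing_simps)

lemma coset_eq_self_iff: "x \<in> carrier V \<Longrightarrow> W +> x = W \<longleftrightarrow> x \<in> W"
  by (metis a_coset_join1 a_rcos_const a_subset add.one_closed additive_subgroup_axioms
      additive_subgroup.a_subgroup)

lemma smult_mem: "x \<in> W \<Longrightarrow> c \<odot> x \<in> W"
  using subspace by (simp add: submodule.smult_closed)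

lemma coset_add:
  assumes "x \<in> carrier V" "y \<in> carrier V"
  shows "(W +> x) \<oplus>\<^bsub>quot_space V W\<^esub> (W +> y) = W +> (x \<oplus> y)"
  using a_rcos_sum[OF assms] by (simp add: quot_space_sel)

text \<open>
  The union in \<^const>\<open>quot_map\<close> runs over all representatives. They all contribute the same coset,
  because two of them differ by an element of \<open>W\<close>, so any one of them computes the value.
\<close>

lemma quot_map_coset:
  assumes V': "quotient_space V' W'"
    and closed: "\<And>x. x \<in> carrier V \<Longrightarrow> f x \<in> carrier V'"
    and add: "\<And>x y. x \<in> carrier V \<Longrightarrow> y \<in> carrier V \<Longrightarrow> f (x \<oplus> y) = f x \<oplus>\<^bsub>V'\<^esub> f y"
    and W: "\<And>x. x \<in> W \<Longrightarrow> f x \<in> W'"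
    and x: "x \<in> carrier V"
  shows "quot_map V' W' f (W +> x) = W' +>\<^bsub>V'\<^esub> f x"
proof -
  interpret V': quotient_space V' W' by fact
  have "\<forall>z\<in>W +> x. W' +>\<^bsub>V'\<^esub> f z = W' +>\<^bsub>V'\<^esub> f x"
  proof
    fix z assume "z \<in> W +> x"
    then obtain w where w: "w \<in> W" "z = w \<oplus> x" by (auto simp: a_r_coset_def')
    then have "f z = f w \<oplus>\<^bsub>V'\<^esub> f x" using x by (simp add: add)
    moreover have "f w \<in> W'" using w W by simp
    ultimately have "f z \<in> W' +>\<^bsub>V'\<^esub> f x" by (auto simp: a_r_coset_def')
    then show "W' +>\<^bsub>V'\<^esub> f z = W' +>\<^bsub>V'\<^esub> f x"
      using V'.a_repr_independence' closed x by metis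
  qed
  then show ?thesis unfolding quot_map_def by (rule UN_constant_eq[OF a_rcos_self[OF x]])
qed

lemma coset_smult:
  assumes "x \<in> carrier V"
  shows "c \<odot>\<^bsub>quot_space V W\<^esub> (W +> x) = W +> (c \<odot> x)"
  using quot_map_coset[OF quotient_space_axioms, of "smult V c" x] assms
  by (simp add: quot_space_def smult_r_distr smult_mem)

lemma quot_space_module: "Module.module ground (quot_space V W)"
proof (rule moduleI)
  show "cring (ground :: 'k ring)" by (rule ground_cring)
  show "abelian_group (quot_space V W)"
  proof (rule abelian_groupI)
    fix X assume "X \<in> carrier (quot_space V W)"
    then obtain x where x: "x \<in> carrier V" "X = W +> x" by (auto simp: quot_space_sel)
    then show "\<exists>Z\<in>carrier (quot_space V W). Z \<oplus>\<^bsub>quot_space V W\<^esub> X = \<zero>\<^bsub>quot_space V W\<^esub>"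
      by (intro bexI[of _ "W +> (\<ominus> x)"])
        (simp_all add: coset_add l_neg coset_eq_self_iff, auto simp: quot_space_sel coset_eq_self_iff)
  next
    have "W = W +> \<zero>" using coset_eq_self_iff[OF M.zero_closed] by simp
    then show "\<zero>\<^bsub>quot_space V W\<^esub> \<in> carrier (quot_space V W)" by (auto simp: quot_space_sel)
    fix X assume "X \<in> carrier (quot_space V W)"
    then obtain x where x: "x \<in> carrier V" "X = W +> x" by (auto simp: quot_space_sel)
    then show "\<zero>\<^bsub>quot_space V W\<^esub> \<oplus>\<^bsub>quot_space V W\<^esub> X = X"
      using coset_add[of \<zero> x] \<open>W = W +> \<zero>\<close> by (simp add: quot_space_sel(2))
  next
    fix X Z assume "X \<in> carrier (quot_space V W)" "Z \<in> carrier (quot_space V W)"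
    then show "X \<oplus>\<^bsub>quot_space V W\<^esub> Z = Z \<oplus>\<^bsub>quot_space V W\<^esub> X"
      by (auto simp only: quot_space_sel(1) coset_add a_comm)
  qed (auto simp: quot_space_sel(1) coset_add a_assoc)
next
  fix c d :: 'k and X assume "X \<in> carrier (quot_space V W)"
  then obtain x where x: "x \<in> carrier V" "X = W +> x" by (auto simp: quot_space_sel)
  show "c \<odot>\<^bsub>quot_space V W\<^esub> X \<in> carrier (quot_space V W)"
    using x by (simp add: quot_space_sel(1) coset_smult)
  show "(c \<oplus>\<^bsub>ground\<^esub> d) \<odot>\<^bsub>quot_space V W\<^esub> X =
      c \<odot>\<^bsub>quot_space V W\<^esub> X \<oplus>\<^bsub>quot_space V W\<^esub> d \<odot>\<^bsub>quot_space V W\<^esub> X"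
    using x smult_l_distr[of c d x] by (simp add: coset_smult coset_add)
  show "(c \<otimes>\<^bsub>ground\<^esub> d) \<odot>\<^bsub>quot_space V W\<^esub> X =
      c \<odot>\<^bsub>quot_space V W\<^esub> (d \<odot>\<^bsub>quot_space V W\<^esub> X)"
    using x smult_assoc1[of c d x] by (simp add: coset_smult)
  show "\<one>\<^bsub>ground\<^esub> \<odot>\<^bsub>quot_space V W\<^esub> X = X"
    using x smult_one[of x] by (simp add: coset_smult)
  fix Z assume "Z \<in> carrier (quot_space V W)"
  then obtain z where z: "z \<in> carrier V" "Z = W +> z" by (auto simp: quot_space_sel)
  show "c \<odot>\<^bsub>quot_space V W\<^esub> (X \<oplus>\<^bsub>quot_space V W\<^esub> Z) =
      c \<odot>\<^bsub>quot_space V W\<^esub> X \<oplus>\<^bsub>quot_space V W\<^esub> c \<odot>\<^bsub>quot_space V W\<^esub> Z"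
    using x z by (simp add: coset_smult coset_add smult_r_distr)
qed

end

text \<open>
  Forms take values in the type of scalars, and not in the module \<^const>\<open>ground\<close>, so that their values
  can be computed with by ordinary arithmetic.
\<close>

definition linear_form :: "('k::field, 'b, 'm) module_scheme \<Rightarrow> ('b \<Rightarrow> 'k) \<Rightarrow> bool" where
  "linear_form V l \<longleftrightarrow> (\<forall>x\<in>carrier V. \<forall>y\<in>carrier V. l (x \<oplus>\<^bsub>V\<^esub> y) = l x + l y) \<and>
     (\<forall>c. \<forall>x\<in>carrier V. l (c \<odot>\<^bsub>V\<^esub> x) = c * l x)"

lemma linear_form_zero:
  assumes "Module.module ground V" "linear_form V l"
  shows "l \<zero>\<^bsub>V\<^esub> = 0"
proof -
  interpret Module.module ground V by fact
  have "l (\<zero>\<^bsub>V\<^esub> \<oplus>\<^bsub>V\<^esub> \<zero>\<^bsub>V\<^esub>) = l \<zero>\<^bsub>V\<^esub> + l \<zero>\<^bsub>V\<^esub>"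
    using assms(2) M.zero_closed unfolding linear_form_def by blast
  then show ?thesis using M.l_zero[OF M.zero_closed] by (metis add_cancel_right_right)
qed

lemma linear_form_minus:
  assumes "Module.module ground V" "linear_form V l" "x \<in> carrier V" "y \<in> carrier V"
  shows "l (x \<ominus>\<^bsub>V\<^esub> y) = l x - l y"
proof -
  interpret Module.module ground V by fact
  have "l ((x \<ominus>\<^bsub>V\<^esub> y) \<oplus>\<^bsub>V\<^esub> y) = l (x \<ominus>\<^bsub>V\<^esub> y) + l y"
    using assms unfolding linear_form_def by simp
  moreover have "(x \<ominus>\<^bsub>V\<^esub> y) \<oplus>\<^bsub>V\<^esub> y = x"
    using assms(3,4) by (simp add: a_minus_def a_assoc l_neg)
  ultimately show ?thesis by simp
qed

lemma lin_mapI: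
  assumes "\<And>x. x \<in> carrier V \<Longrightarrow> f x \<in> carrier W"
    and "\<And>x y. x \<in> carrier V \<Longrightarrow> y \<in> carrier V \<Longrightarrow> f (x \<oplus>\<^bsub>V\<^esub> y) = f x \<oplus>\<^bsub>W\<^esub> f y"
    and "\<And>c x. x \<in> carrier V \<Longrightarrow> f (c \<odot>\<^bsub>V\<^esub> x) = c \<odot>\<^bsub>W\<^esub> f x"
  shows "lin_map V W f"
  using assms by (auto simp: lin_map_def hom_def)

lemma lin_mapD:
  assumes "lin_map V W f"
  shows "x \<in> carrier V \<Longrightarrow> f x \<in> carrier W"
    and "x \<in> carrier V \<Longrightarrow> y \<in> carrier V \<Longrightarrow> f (x \<oplus>\<^bsub>V\<^esub> y) = f x \<oplus>\<^bsub>W\<^esub> f y"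
    and "x \<in> carrier V \<Longrightarrow> f (c \<odot>\<^bsub>V\<^esub> x) = c \<odot>\<^bsub>W\<^esub> f x"
  using assms by (auto simp: lin_map_def hom_def)

lemma lin_map_zero:
  assumes "Module.module ground V" "Module.module ground W" "lin_map V W f"
  shows "f \<zero>\<^bsub>V\<^esub> = \<zero>\<^bsub>W\<^esub>"
proof -
  interpret V: Module.module ground V by fact
  interpret W: Module.module ground W by fact
  have "f (0 \<odot>\<^bsub>V\<^esub> \<zero>\<^bsub>V\<^esub>) = 0 \<odot>\<^bsub>W\<^esub> f \<zero>\<^bsub>V\<^esub>"
    by (rule lin_mapD(3)[OF assms(3) V.M.zero_closed])
  then show ?thesis
    using V.smult_l_null[OF V.M.zero_closed] W.smult_l_null[OF lin_mapD(1)[OF assms(3) V.M.zero_closed]]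
    by simp
qed

lemma lin_map_minus:
  assumes "Module.module ground V" "Module.module ground W" "lin_map V W f"
    and "x \<in> carrier V" "y \<in> carrier V"
  shows "f (x \<ominus>\<^bsub>V\<^esub> y) = f x \<ominus>\<^bsub>W\<^esub> f y"
proof -
  interpret V: Module.module ground V by fact
  interpret W: Module.module ground W by fact
  have "f ((x \<ominus>\<^bsub>V\<^esub> y) \<oplus>\<^bsub>V\<^esub> y) = f (x \<ominus>\<^bsub>V\<^esub> y) \<oplus>\<^bsub>W\<^esub> f y"
    using assms by (simp add: lin_mapD)
  moreover have "(x \<ominus>\<^bsub>V\<^esub> y) \<oplus>\<^bsub>V\<^esub> y = x"
    using assms(4,5) by (simp add: a_minus_def V.a_assoc V.l_neg)
  ultimately have "f x = f (x \<ominus>\<^bsub>V\<^esub> y) \<oplus>\<^bsub>W\<^esub> f y" by simp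
  then show ?thesis
    using assms(4,5) lin_mapD(1)[OF assms(3)] by (simp add: a_minus_def W.a_assoc W.r_neg)
qed

lemma lin_map_comp: "lin_map U V f \<Longrightarrow> lin_map V W g \<Longrightarrow> lin_map U W (\<lambda>x. g (f x))"
  by (intro lin_mapI) (simp_all add: lin_mapD)

lemma linear_form_comp: "lin_map U V f \<Longrightarrow> linear_form V l \<Longrightarrow> linear_form U (\<lambda>x. l (f x))"
  by (simp add: linear_form_def lin_mapD)

lemma smult_minus_one:
  assumes "Module.module ground V" "x \<in> carrier V"
  shows "(- 1) \<odot>\<^bsub>V\<^esub> x = \<ominus>\<^bsub>V\<^esub> x"
proof -
  interpret Module.module ground V by fact
  have "(-1) \<odot>\<^bsub>V\<^esub> x \<oplus>\<^bsub>V\<^esub> x = ((-1) \<oplus>\<^bsub>ground\<^esub> 1) \<odot>\<^bsub>V\<^esub> x"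
    using assms(2) smult_l_distr[of "-1" 1 x] smult_one[of x] by simp
  then have "(-1) \<odot>\<^bsub>V\<^esub> x \<oplus>\<^bsub>V\<^esub> x = \<zero>\<^bsub>V\<^esub>"
    using smult_l_null[OF assms(2)] by simp
  then show ?thesis
    using assms(2) minus_equality[of "(-1) \<odot>\<^bsub>V\<^esub> x" x] by (auto intro: smult_closed)
qed

lemma k_submoduleI:
  assumes "Module.module ground V" "W \<subseteq> carrier V" "\<zero>\<^bsub>V\<^esub> \<in> W"
    and "\<And>x y. x \<in> W \<Longrightarrow> y \<in> W \<Longrightarrow> x \<oplus>\<^bsub>V\<^esub> y \<in> W" and "\<And>c x. x \<in> W \<Longrightarrow> c \<odot>\<^bsub>V\<^esub> x \<in> W"
  shows "submodule W ground V"
proof -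
  interpret Module.module ground V by fact
  show ?thesis
  proof (intro submodule.intro submodule_axioms.intro add.subgroupI)
    fix x assume "x \<in> W"
    then have x: "x \<in> carrier V" using assms(2) by blast
    show "\<ominus>\<^bsub>V\<^esub> x \<in> W"
      using assms(5)[OF \<open>x \<in> W\<close>, of "- 1"] smult_minus_one[OF assms(1) x] by simp
  qed (use assms in auto)
qed

lemma k_submoduleD:
  assumes "submodule W ground V"
  shows "W \<subseteq> carrier V" "\<zero>\<^bsub>V\<^esub> \<in> W" "x \<in> W \<Longrightarrow> y \<in> W \<Longrightarrow> x \<oplus>\<^bsub>V\<^esub> y \<in> W" "x \<in> W \<Longrightarrow> c \<odot>\<^bsub>V\<^esub> x \<in> W"
  using submodule.axioms(1)[OF assms] submodule.smult_closed[OF assms]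
  using subgroup.subset[OF submodule.axioms(1)[OF assms]] subgroup.one_closed[OF submodule.axioms(1)[OF assms]]
    subgroup.m_closed[OF submodule.axioms(1)[OF assms]]
  by auto

lemma submodule_image:
  assumes "Module.module ground V" "Module.module ground W" "lin_map V W f" "submodule U ground V"
  shows "submodule (f ` U) ground W"
proof (rule k_submoduleI[OF assms(2)])
  note U = k_submoduleD[OF assms(4)]
  show "f ` U \<subseteq> carrier W" using lin_mapD(1)[OF assms(3)] U(1) by auto
  show "\<zero>\<^bsub>W\<^esub> \<in> f ` U"
    using lin_map_zero[OF assms(1-3)] U(2) by (metis imageI)
  fix c x assume "x \<in> f ` U"
  then obtain u where u: "u \<in> U" "x = f u" by auto
  then have uV: "u \<in> carrier V" using U(1) by blast
  show "c \<odot>\<^bsub>W\<^esub> x \<in> f ` U"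
    using lin_mapD(3)[OF assms(3) uV, of c] U(4)[OF u(1), of c] u(2) by (metis imageI)
  fix y assume "y \<in> f ` U"
  then obtain v where v: "v \<in> U" "y = f v" by auto
  then have vV: "v \<in> carrier V" using U(1) by blast
  show "x \<oplus>\<^bsub>W\<^esub> y \<in> f ` U"
    using lin_mapD(2)[OF assms(3) uV vV] U(3)[OF u(1) v(1)] u(2) v(2) by (metis imageI)
qed

lemma submodule_carrier: "Module.module ground V \<Longrightarrow> submodule (carrier V) ground V"
  by (rule module.carrier_is_submodule)

abbreviation supp :: "('b \<Rightarrow>\<^sub>0 'k::zero) \<Rightarrow> 'b set" where
  "supp \<equiv> Poly_Mapping.keys"

lemma lin_ext_minus: "lin_ext f (x - y) = lin_ext f x - lin_ext f y"
  using lin_ext_add[of f "x - y" y] by (simp add: algebra_simps)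

lemma keys_diff_subset: "supp x \<subseteq> X \<Longrightarrow> supp y \<subseteq> X \<Longrightarrow> supp (x - y) \<subseteq> X"
  using Poly_Mapping.keys_diff[of x y] by blast

lemma keys_add_subset: "supp x \<subseteq> X \<Longrightarrow> supp y \<subseteq> X \<Longrightarrow> supp (x + y) \<subseteq> X"
  using Poly_Mapping.keys_add[of x y] by blast

lemma keys_scale_subset: "supp x \<subseteq> X \<Longrightarrow> supp (scale c x) \<subseteq> X"
  using keys_scale[of c x] by blast

lemma keys_basis_subset: "b \<in> X \<Longrightarrow> supp (basis b) \<subseteq> X"
  by simp

lemmas keys_subset = keys_diff_subset keys_add_subset keys_scale_subset keys_basis_subset

lemma free_induct [consumes 1, case_names zero gen add scale]:
  assumes x: "supp (x :: 'b \<Rightarrow>\<^sub>0 'k::field) \<subseteq> X"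
    and "P 0" and "\<And>b. b \<in> X \<Longrightarrow> P (basis b)"
    and "\<And>x y. supp x \<subseteq> X \<Longrightarrow> supp y \<subseteq> X \<Longrightarrow> P x \<Longrightarrow> P y \<Longrightarrow> P (x + y)"
    and "\<And>c x. supp x \<subseteq> X \<Longrightarrow> P x \<Longrightarrow> P (scale c x)"
  shows "P x"
proof -
  have "P (\<Sum>b\<in>B. scale (c b) (basis b)) \<and>
      supp (\<Sum>b\<in>B. scale (c b) (basis b :: _ \<Rightarrow>\<^sub>0 'k)) \<subseteq> X" if "finite B" "B \<subseteq> X" for B c
    using that
  proof (induction B)
    case (insert b B)
    then have "P (scale (c b) (basis b))" using assms(3)[of b] by (intro assms(5)) simp_all
    then show ?case using insert assms(4) by (simp add: keys_scale_subset keys_add_subset)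
  qed (simp add: assms(2))
  from this[of "supp x" "Poly_Mapping.lookup x"] show ?thesis
    using x lin_ext_id[of x] by (simp add: lin_ext_def)
qed

text \<open>The counterpart of \<^const>\<open>lin_ext\<close> for values that are scalars.\<close>

definition eval_form :: "('b \<Rightarrow> 'k) \<Rightarrow> ('b \<Rightarrow>\<^sub>0 'k::field) \<Rightarrow> 'k" where
  "eval_form l x = (\<Sum>b\<in>supp x. Poly_Mapping.lookup x b * l b)"

lemma eval_form_alt: "eval_form l x = Poly_Mapping.lookup (lin_ext (\<lambda>b. Poly_Mapping.single () (l b)) x) ()"
  by (simp add: eval_form_def lin_ext_def lookup_sum)

lemma eval_form_simps:
  "eval_form l (x + y) = eval_form l x + eval_form l y"
  "eval_form l (x - y) = eval_form l x - eval_form l y"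
  "eval_form l (scale c x) = c * eval_form l x"
  "eval_form l (basis b) = l b"
  "eval_form l 0 = 0"
  by (simp_all add: eval_form_alt lin_ext_add lin_ext_minus lin_ext_scale lookup_add lookup_minus)

lemma eval_form_sum: "eval_form l (sum g S) = (\<Sum>x\<in>S. eval_form l (g x))"
  by (induction S rule: infinite_finite_induct) (auto simp: eval_form_simps)

lemma eval_form_lin_ext: "eval_form l (lin_ext f x) = eval_form (\<lambda>b. eval_form l (f b)) x"
  by (simp add: lin_ext_def eval_form_sum eval_form_simps) (simp add: eval_form_def)

lemma eval_form_cong: "(\<And>b. b \<in> supp x \<Longrightarrow> l b = l' b) \<Longrightarrow> eval_form l x = eval_form l' x"
  by (simp add: eval_form_def)

lemma eval_form_fadd: "eval_form (\<lambda>b. l b + l' b) x = eval_form l x + eval_form l' x"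
  by (simp add: eval_form_def sum.distrib algebra_simps)

lemma eval_form_fscale: "eval_form (\<lambda>b. c * l b) x = c * eval_form l x"
  by (simp add: eval_form_def sum_distrib_left algebra_simps)

lemma lin_span_submodule:
  assumes "Module.module ground V" "R \<subseteq> carrier V"
  shows "submodule (lin_span V R) ground V"
proof (rule k_submoduleI[OF assms(1)])
  show "lin_span V R \<subseteq> carrier V"
    using assms submodule_carrier[OF assms(1)] by (auto simp: lin_span_def)
qed (auto simp: lin_span_def intro: k_submoduleD)

lemma lin_span_superset: "R \<subseteq> lin_span V R"
  by (auto simp: lin_span_def)

lemma lin_span_least: "submodule W ground V \<Longrightarrow> R \<subseteq> W \<Longrightarrow> lin_span V R \<subseteq> W"
  by (auto simp: lin_span_def)

definition cls :: "'b set \<Rightarrow> ('b \<Rightarrow>\<^sub>0 'k::field) set \<Rightarrow> ('b \<Rightarrow>\<^sub>0 'k) \<Rightarrow> ('b \<Rightarrow>\<^sub>0 'k) set" where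
  "cls X R x = lin_span (free_space X) R +>\<^bsub>free_space X\<^esub> x"

text \<open>
  The choice is harmless: a form that kills the relations takes the same value at all
  representatives of a class.
\<close>

definition presented_form :: "('b \<Rightarrow> 'k) \<Rightarrow> ('b \<Rightarrow>\<^sub>0 'k::field) set \<Rightarrow> 'k" where
  "presented_form l C = eval_form l (SOME x. x \<in> C)"

locale presentation =
  fixes X :: "'b set" and R :: "('b \<Rightarrow>\<^sub>0 'k::field) set"
  assumes relations_keys: "r \<in> R \<Longrightarrow> supp r \<subseteq> X"
begin

abbreviation "relspan \<equiv> lin_span (free_space X) R"

lemma relspan_submodule: "submodule relspan ground (free_space X)"
  by (rule lin_span_submodule[OF free_space_module]) (use relations_keys in auto)

lemma quotient_space_presented: "quotient_space (free_space X) relspan"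
  by (simp add: quotient_space_def quotient_space_axioms_def free_space_module relspan_submodule)

interpretation Q: quotient_space "free_space X" relspan
  by (rule quotient_space_presented)

lemma relspan_rel: "r \<in> R \<Longrightarrow> r \<in> relspan"
  by (rule subsetD[OF lin_span_superset])

lemma relspan_0: "0 \<in> relspan"
  using k_submoduleD(2)[OF relspan_submodule] by simp

lemma relspan_add: "x \<in> relspan \<Longrightarrow> y \<in> relspan \<Longrightarrow> x + y \<in> relspan"
  using k_submoduleD(3)[OF relspan_submodule] by simp

lemma relspan_scale: "x \<in> relspan \<Longrightarrow> scale c x \<in> relspan"
  using k_submoduleD(4)[OF relspan_submodule] by simp

lemma relspan_sum: "(\<And>i. i \<in> A \<Longrightarrow> g i \<in> relspan) \<Longrightarrow> sum g A \<in> relspan"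
  by (induction A rule: infinite_finite_induct) (auto intro: relspan_0 relspan_add)

lemma presented_module: "Module.module ground (presented X R)"
  unfolding presented_def by (rule Q.quot_space_module)

lemma carrier_presented: "carrier (presented X R) = cls X R ` {x. supp x \<subseteq> X}"
  by (simp add: presented_def Q.quot_space_sel cls_def[abs_def])

lemma cls_closed: "supp x \<subseteq> X \<Longrightarrow> cls X R x \<in> carrier (presented X R)"
  by (simp add: carrier_presented)

lemma cls_basis_closed: "b \<in> X \<Longrightarrow> cls X R (basis b) \<in> carrier (presented X R)"
  by (rule cls_closed) simp

lemma cls_add:
  assumes "supp x \<subseteq> X" "supp y \<subseteq> X"
  shows "cls X R (x + y) = cls X R x \<oplus>\<^bsub>presented X R\<^esub> cls X R y"
  using assms Q.coset_add[of x y] by (simp add: presented_def cls_def)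

lemma cls_scale:
  assumes "supp x \<subseteq> X"
  shows "cls X R (scale c x) = c \<odot>\<^bsub>presented X R\<^esub> cls X R x"
  using assms Q.coset_smult[of x c] by (simp add: presented_def cls_def)

lemma cls_0: "cls X R 0 = \<zero>\<^bsub>presented X R\<^esub>"
  using Q.coset_eq_self_iff[of 0] relspan_0 by (simp add: presented_def cls_def Q.quot_space_sel)

lemma cls_eqI:
  assumes "supp x \<subseteq> X" "supp y \<subseteq> X" "x - y \<in> relspan"
  shows "cls X R x = cls X R y"
proof -
  have "x = (x - y) + y" by simp
  then have "x \<in> relspan +>\<^bsub>free_space X\<^esub> y"
    using assms(3) by (auto simp: a_r_coset_def' intro!: bexI[of _ "x - y"])
  then show ?thesis
    unfolding cls_def using Q.a_repr_independence'[of x y] assms by simp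
qed

lemma cls_eq_0_iff: "supp x \<subseteq> X \<Longrightarrow> cls X R x = \<zero>\<^bsub>presented X R\<^esub> \<longleftrightarrow> x \<in> relspan"
  using Q.coset_eq_self_iff[of x] by (simp add: presented_def cls_def Q.quot_space_sel)

lemma cls_rep: "x \<in> cls X R x" if "supp x \<subseteq> X"
  using Q.a_rcos_self[of x] that by (simp add: cls_def)

lemma presented_induct [consumes 1, case_names zero gen add smult]:
  assumes z: "z \<in> carrier (presented X R)"
    and "P \<zero>\<^bsub>presented X R\<^esub>"
    and "\<And>b. b \<in> X \<Longrightarrow> P (cls X R (basis b))"
    and "\<And>x y. x \<in> carrier (presented X R) \<Longrightarrow> y \<in> carrier (presented X R) \<Longrightarrow> P x \<Longrightarrow> P y \<Longrightarrow>
      P (x \<oplus>\<^bsub>presented X R\<^esub> y)"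
    and "\<And>c x. x \<in> carrier (presented X R) \<Longrightarrow> P x \<Longrightarrow> P (c \<odot>\<^bsub>presented X R\<^esub> x)"
  shows "P z"
proof -
  obtain x where x: "supp x \<subseteq> X" "z = cls X R x"
    using z by (auto simp: carrier_presented)
  from x(1) have "P (cls X R x)"
    by (induction x rule: free_induct)
      (simp_all add: assms(2,3) cls_0 cls_add cls_scale assms(4,5) cls_closed)
  then show ?thesis by (simp only: x(2))
qed

lemma
  assumes X': "presentation X' R'"
    and h: "\<And>b. b \<in> X \<Longrightarrow> supp (h b) \<subseteq> X'"
    and R: "\<And>r. r \<in> R \<Longrightarrow> lin_ext h r \<in> lin_span (free_space X') R'"
  shows presented_map_cls:
      "supp x \<subseteq> X \<Longrightarrow> presented_map X' R' h (cls X R x) = cls X' R' (lin_ext h x)"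
    and presented_map_linear: "lin_map (presented X R) (presented X' R') (presented_map X' R' h)"
proof -
  interpret P': presentation X' R' by fact
  have span: "lin_ext h x \<in> P'.relspan" if "x \<in> relspan" for x
  proof -
    have "submodule {x. supp x \<subseteq> X \<and> lin_ext h x \<in> P'.relspan} ground (free_space X)"
      by (rule k_submoduleI[OF free_space_module])
        (auto simp: lin_ext_add lin_ext_scale keys_subset P'.relspan_0 P'.relspan_add P'.relspan_scale)
    from lin_span_least[OF this, of R] that show ?thesis using R relations_keys by auto
  qed
  have closed: "supp (lin_ext h x) \<subseteq> X'" if "supp x \<subseteq> X" for x
    using that h by (rule lin_ext_keys)
  show map: "presented_map X' R' h (cls X R x) = cls X' R' (lin_ext h x)"
    if "supp x \<subseteq> X" for x
    unfolding presented_map_def cls_def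
    by (rule Q.quot_map_coset[OF P'.quotient_space_presented])
      (use that span closed in \<open>auto simp: lin_ext_add\<close>)
  show "lin_map (presented X R) (presented X' R') (presented_map X' R' h)"
    by (rule lin_mapI)
      (auto simp: carrier_presented P'.carrier_presented map closed simp flip: cls_add cls_scale,
       auto simp: map keys_subset lin_ext_add lin_ext_scale P'.cls_add P'.cls_scale closed)
qed

lemma
  assumes R: "\<And>r. r \<in> R \<Longrightarrow> eval_form l r = 0"
  shows presented_form_cls: "supp x \<subseteq> X \<Longrightarrow> presented_form l (cls X R x) = eval_form l x"
    and presented_form_linear: "linear_form (presented X R) (presented_form l)"
proof -
  have span: "eval_form l x = 0" if "x \<in> relspan" for x
  proof -
    have "submodule {x. supp x \<subseteq> X \<and> eval_form l x = 0} ground (free_space X)"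
      by (rule k_submoduleI[OF free_space_module]) (auto simp: eval_form_simps keys_subset)
    from lin_span_least[OF this, of R] that show ?thesis using R relations_keys by auto
  qed
  show map: "presented_form l (cls X R x) = eval_form l x" if x: "supp x \<subseteq> X" for x
  proof -
    have "(SOME z. z \<in> cls X R x) \<in> cls X R x" using cls_rep[OF x] by (rule someI)
    then obtain w where "w \<in> relspan" "(SOME z. z \<in> cls X R x) = w + x"
      by (auto simp: cls_def a_r_coset_def')
    then show ?thesis by (simp add: presented_form_def eval_form_simps span)
  qed
  show "linear_form (presented X R) (presented_form l)"
    unfolding linear_form_def
    by (auto simp: carrier_presented simp flip: cls_add cls_scale)
      (simp_all add: map keys_subset eval_form_simps)
qed

text \<open>
  Extend a basis of the preimage of \<open>W\<close> by a representative of \<open>z\<close> and take the corresponding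
  coordinate. The kernels of the chain maps below are computed by applying this lemma and then
  constructing a form with prescribed values.
\<close>

lemma separating_form:
  assumes W: "submodule W ground (presented X R)" and z: "z \<in> carrier (presented X R)" "z \<notin> W"
  obtains l where "linear_form (presented X R) l" "\<And>w. w \<in> W \<Longrightarrow> l w = 0" "l z = 1"
proof -
  interpret vs: vector_space "scale :: 'k \<Rightarrow> ('b \<Rightarrow>\<^sub>0 'k) \<Rightarrow> _"
    by unfold_locales (simp_all add: scale_simps)
  interpret vk: vector_space "(*) :: 'k \<Rightarrow> 'k \<Rightarrow> 'k"
    by unfold_locales (simp_all add: algebra_simps)
  interpret vp: vector_space_pair "scale :: 'k \<Rightarrow> ('b \<Rightarrow>\<^sub>0 'k) \<Rightarrow> _" "(*) :: 'k \<Rightarrow> 'k \<Rightarrow> 'k" ..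
  define W0 where "W0 = {x. supp x \<subseteq> X \<and> cls X R x \<in> W}"
  note Wsub = k_submoduleD[OF W]
  have W0: "vs.subspace W0"
    using Wsub cls_0 unfolding vs.subspace_def W0_def by (auto simp: keys_subset cls_add cls_scale)
  obtain x where x: "supp x \<subseteq> X" "z = cls X R x"
    using z by (auto simp: carrier_presented)
  with z have "x \<notin> W0" by (simp add: W0_def)
  obtain B where B: "B \<subseteq> W0" "vs.independent B" "W0 \<subseteq> vs.span B"
    by (rule vs.maximal_independent_subset)
  have span: "vs.span B = W0" using B W0 vs.span_minimal by blast
  then have "vs.independent (insert x B)"
    using \<open>x \<notin> W0\<close> B(2) by (simp add: vs.independent_insertI)
  then obtain g where g: "Vector_Spaces.linear scale (*) g" "\<forall>b\<in>insert x B. g b = (if b = x then 1 else 0)"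
    using vp.linear_independent_extend[of "insert x B" "\<lambda>b. if b = x then 1 else 0"] by blast
  interpret g: Vector_Spaces.linear scale "(*)" g by fact
  have "x \<notin> B" using \<open>x \<notin> W0\<close> B by blast
  then have "\<forall>b\<in>B. g b = 0" using g(2) by auto
  then have gW: "g w = 0" if "w \<in> W0" for w
    using g.eq_0_on_span[of B w] that span by auto
  have ev: "eval_form (\<lambda>b. g (basis b)) y = g y" for y
  proof -
    have "g y = g (lin_ext basis y)" by (simp add: lin_ext_id)
    also have "\<dots> = eval_form (\<lambda>b. g (basis b)) y"
      by (simp add: lin_ext_def g.sum g.scale eval_form_def)
    finally show ?thesis by simp
  qed
  have rel: "eval_form (\<lambda>b. g (basis b)) r = 0" if "r \<in> R" for r
  proof -
    have "cls X R r = \<zero>\<^bsub>presented X R\<^esub>"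
      using that by (simp add: cls_eq_0_iff relations_keys relspan_rel)
    then have "r \<in> W0" using Wsub that by (simp add: W0_def relations_keys)
    then show ?thesis by (simp add: ev gW)
  qed
  show thesis
  proof (rule that[of "presented_form (\<lambda>b. g (basis b))"])
    show "linear_form (presented X R) (presented_form (\<lambda>b. g (basis b)))"
      using rel by (rule presented_form_linear)
    show "presented_form (\<lambda>b. g (basis b)) w = 0" if w: "w \<in> W" for w
    proof -
      obtain y where "supp y \<subseteq> X" "w = cls X R y"
        using w Wsub(1) unfolding carrier_presented by blast
      then show ?thesis using presented_form_cls[OF rel, of y] w gW[of y] by (simp add: ev W0_def)
    qed
    show "presented_form (\<lambda>b. g (basis b)) z = 1"
      using presented_form_cls[OF rel x(1)] x(2) g(2) by (simp add: ev)
  qed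
qed

end

lemma (in presentation) lin_map_eqI:
  assumes V: "Module.module ground V" and f: "lin_map (presented X R) V f" "lin_map (presented X R) V g"
    and gen: "\<And>b. b \<in> X \<Longrightarrow> f (cls X R (basis b)) = g (cls X R (basis b))"
    and z: "z \<in> carrier (presented X R)"
  shows "f z = g z"
  using z
proof (induction z rule: presented_induct)
  case zero
  then show ?case by (simp add: lin_map_zero[OF presented_module V] f)
qed (simp_all add: gen lin_mapD[OF f(1)] lin_mapD[OF f(2)])

section \<open>The relative bar resolution\<close>

text \<open>
  The same space occurs in several records, for instance with and without the actions of a
  bimodule; these lemmas pass between them.
\<close>

lemma abelian_group_transfer:
  assumes "abelian_group V" "carrier W = carrier V" "zero W = zero V" "add W = add V"
  shows "abelian_group W"
proof -
  interpret abelian_group V by fact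
  show ?thesis
  proof (rule abelian_groupI)
    show "\<exists>y\<in>carrier W. y \<oplus>\<^bsub>W\<^esub> x = \<zero>\<^bsub>W\<^esub>" if "x \<in> carrier W" for x
      using that assms(2-4) l_neg[of x] a_inv_closed[of x] by auto
  qed (simp_all add: assms(2-4) a_ac)
qed

lemma module_transfer:
  assumes "Module.module ground V"
    and "carrier W = carrier V" "zero W = zero V" "add W = add V" "smult W = smult V"
  shows "Module.module ground W"
proof -
  interpret Module.module ground V by fact
  have "abelian_group W" by (rule abelian_group_transfer[OF abelian_group_axioms assms(2-4)])
  then show ?thesis
    using assms(2-5) by (intro moduleI)
      (auto simp: ground_cring smult_l_distr[simplified] smult_r_distr smult_assoc1[simplified]
        smult_one[simplified])
qed

lemma ring_transfer:
  assumes "ring R" "carrier R' = carrier R" "mult R' = mult R" "one R' = one R" "zero R' = zero R"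
    "add R' = add R"
  shows "ring R'"
proof -
  interpret ring R by fact
  have "abelian_group R'" by (rule abelian_group_transfer[OF is_abelian_group assms(2,5,6)])
  then show ?thesis
    by (rule ringI[OF _ monoidI]) (simp_all add: assms m_assoc l_distr r_distr)
qed

lemma lin_map_transfer:
  assumes "lin_map V W f" "carrier V' = carrier V" "add V' = add V" "smult V' = smult V"
    "carrier W' = carrier W" "add W' = add W" "smult W' = smult W"
  shows "lin_map V' W' f"
  by (rule lin_mapI) (use assms lin_mapD[OF assms(1)] in auto)

lemma single_eq_scale: "Poly_Mapping.single x c = scale c (basis x)"
  by (rule poly_mapping_eqI) (simp add: lookup_single when_def)

text \<open>
  The face maps of the bar resolution. The recursion allows inductions that follow the
  position at which two neighbours are multiplied.
\<close>

fun bar_merge :: "('a, 'm) ring_scheme \<Rightarrow> nat \<Rightarrow> 'a list \<Rightarrow> 'a list" where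
  "bar_merge A 0 (a # b # as) = (a \<otimes>\<^bsub>A\<^esub> b) # as"
| "bar_merge A (Suc i) (a # as) = a # bar_merge A i as"
| "bar_merge A _ as = as"

lemma bar_merge_eq:
  "Suc i < length as \<Longrightarrow>
    take i as @ (as ! i \<otimes>\<^bsub>A\<^esub> as ! (i + 1)) # drop (i + 2) as = bar_merge A i as"
proof (induction A i as rule: bar_merge.induct)
  case (1 A a b as)
  then show ?case by simp
next
  case (2 A i a as)
  then show ?case by simp
qed auto

lemma bar_merge_closed:
  "ring A \<Longrightarrow> Suc i < length as \<Longrightarrow> set as \<subseteq> carrier A \<Longrightarrow>
    length (bar_merge A i as) = length as - 1 \<and> set (bar_merge A i as) \<subseteq> carrier A"
proof (induction A i as rule: bar_merge.induct)
  case (2 A i a as)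
  then show ?case by auto
qed (auto intro: monoid.m_closed[OF ring.axioms(2)])

locale relative_algebra = k_algebra A
  for A :: "('k::field, 'a, 'm) module_scheme" (structure) +
  fixes S :: "'a set"
  assumes subalgebra_subset: "S \<subseteq> carrier A"
begin

lemma ring_A: "ring A"
  by (rule k_algebra.axioms(1)[OF k_algebra_axioms])

lemmas ring_rules = ring.ring_simprules(11,13,23)[OF ring_A]

abbreviation "bar_space n \<equiv> presented (bar_gens A n) (bar_rels A S n)"

abbreviation "barcls n \<equiv> cls (bar_gens A n) (bar_rels A S n)"

abbreviation tensor :: "nat \<Rightarrow> 'a list \<Rightarrow> ('a list \<Rightarrow>\<^sub>0 'k) set" where
  "tensor n as \<equiv> barcls n (basis as)"

lemma bar_rels_cases:
  assumes "r \<in> bar_rels A S n"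
  obtains (add) xs a b ys where "r = basis (xs @ (a \<oplus> b) # ys) - basis (xs @ a # ys) - basis (xs @ b # ys)"
      "set xs \<subseteq> carrier A" "set ys \<subseteq> carrier A" "a \<in> carrier A" "b \<in> carrier A"
      "length xs + length ys = n + 1"
  | (smult) xs c a ys where "r = basis (xs @ (c \<odot> a) # ys) - scale c (basis (xs @ a # ys))"
      "set xs \<subseteq> carrier A" "set ys \<subseteq> carrier A" "a \<in> carrier A" "length xs + length ys = n + 1"
  | (bal) xs a s b ys where "r = basis (xs @ (a \<otimes> s) # b # ys) - basis (xs @ a # (s \<otimes> b) # ys)"
      "set xs \<subseteq> carrier A" "set ys \<subseteq> carrier A" "a \<in> carrier A" "b \<in> carrier A" "s \<in> S"
      "length xs + length ys = n"
  using assms unfolding bar_rels_def by (elim UnE CollectE exE conjE) auto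

lemma bar_presentation: "presentation (bar_gens A n) (bar_rels A S n)"
proof
  fix r assume "r \<in> bar_rels A S n"
  then show "supp r \<subseteq> bar_gens A n"
  proof (cases rule: bar_rels_cases)
    case add
    then show ?thesis unfolding add(1) by (intro keys_subset) (auto simp: bar_gens_def)
  next
    case smult
    then show ?thesis unfolding smult(1) by (intro keys_subset) (auto simp: bar_gens_def)
  next
    case (bal xs a s b ys)
    with subalgebra_subset have "s \<in> carrier A" by blast
    with bal show ?thesis unfolding bal(1) by (intro keys_subset) (auto simp: bar_gens_def)
  qed
qed

sublocale bar: presentation "bar_gens A n" "bar_rels A S n" for n
  by (rule bar_presentation)

abbreviation span :: "nat \<Rightarrow> ('a list \<Rightarrow>\<^sub>0 'k) set" where
  "span n \<equiv> lin_span (free_space (bar_gens A n)) (bar_rels A S n)"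

lemma bar_rels_add:
  assumes "set xs \<subseteq> carrier A" "set ys \<subseteq> carrier A" "a \<in> carrier A" "b \<in> carrier A"
    "length xs + length ys = n + 1"
  shows "basis (xs @ (a \<oplus> b) # ys) - basis (xs @ a # ys) - basis (xs @ b # ys) \<in> bar_rels A S n"
  unfolding bar_rels_def using assms by blast

lemma bar_rels_smult:
  assumes "set xs \<subseteq> carrier A" "set ys \<subseteq> carrier A" "a \<in> carrier A" "length xs + length ys = n + 1"
  shows "basis (xs @ (c \<odot> a) # ys) - scale c (basis (xs @ a # ys)) \<in> bar_rels A S n"
  unfolding bar_rels_def using assms by blast

lemma bar_rels_bal:
  assumes "set xs \<subseteq> carrier A" "set ys \<subseteq> carrier A" "a \<in> carrier A" "b \<in> carrier A" "s \<in> S"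
    "length xs + length ys = n"
  shows "basis (xs @ (a \<otimes> s) # b # ys) - basis (xs @ a # (s \<otimes> b) # ys) \<in> bar_rels A S n"
  unfolding bar_rels_def using assms by blast

text \<open>
  The faces and the two outer actions treat an entry of a tensor in one of three ways: they leave it
  alone, multiply it by a fixed element on one side, or multiply it with its neighbour. In the first two cases a
  relation in that entry becomes a relation. Of two adjacent entries, the left one is only
  multiplied from the left and the right one only from the right, so balancing between them
  survives; if they are multiplied with each other, both sides of the balancing relation become equal.
  The following predicates record this shape, so that the faces and
  the actions are well defined by \<open>entrywise_rels\<close>.
\<close>

definition left_mults :: "('a \<Rightarrow> 'a) set" where
  "left_mults = insert (\<lambda>x. x) ((\<lambda>p x. p \<otimes> x) ` carrier A)"

definition right_mults :: "('a \<Rightarrow> 'a) set" where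
  "right_mults = insert (\<lambda>x. x) ((\<lambda>q x. x \<otimes> q) ` carrier A)"

lemma mults_intros:
  "(\<lambda>x. x) \<in> left_mults" "(\<lambda>x. x) \<in> right_mults"
  "p \<in> carrier A \<Longrightarrow> (\<lambda>x. p \<otimes> x) \<in> left_mults" "p \<in> carrier A \<Longrightarrow> (\<lambda>x. x \<otimes> p) \<in> right_mults"
  by (auto simp: left_mults_def right_mults_def)

lemma mults_linear:
  assumes "g \<in> left_mults \<union> right_mults" "a \<in> carrier A" "b \<in> carrier A"
  shows "g a \<in> carrier A" "g (a \<oplus> b) = g a \<oplus> g b" "g (c \<odot> a) = c \<odot> g a"
  using assms
  by (auto simp: left_mults_def right_mults_def ring_rules smult_mult_left smult_mult_right)

definition keeps_entry :: "('a list \<Rightarrow> 'a list) \<Rightarrow> nat \<Rightarrow> 'a list \<Rightarrow> 'a list \<Rightarrow> bool" where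
  "keeps_entry f n xs ys \<longleftrightarrow> (\<exists>xs' ys' g. set xs' \<subseteq> carrier A \<and> set ys' \<subseteq> carrier A \<and>
     length xs' + length ys' = n \<and> g \<in> left_mults \<union> right_mults \<and>
     (\<forall>x. f (xs @ x # ys) = xs' @ g x # ys'))"

definition keeps_entries :: "('a list \<Rightarrow> 'a list) \<Rightarrow> nat \<Rightarrow> 'a list \<Rightarrow> 'a list \<Rightarrow> bool" where
  "keeps_entries f n xs ys \<longleftrightarrow> (\<exists>xs' ys' g h. set xs' \<subseteq> carrier A \<and> set ys' \<subseteq> carrier A \<and>
     length xs' + length ys' = n \<and> g \<in> left_mults \<and> h \<in> right_mults \<and>
     (\<forall>x z. f (xs @ x # z # ys) = xs' @ g x # h z # ys'))"

definition joins_entries :: "('a list \<Rightarrow> 'a list) \<Rightarrow> 'a list \<Rightarrow> 'a list \<Rightarrow> bool" where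
  "joins_entries f xs ys \<longleftrightarrow> (\<exists>xs' ys'. \<forall>x z. f (xs @ x # z # ys) = xs' @ (x \<otimes> z) # ys')"

lemma keeps_entryI:
  assumes "set xs' \<subseteq> carrier A" "set ys' \<subseteq> carrier A" "length xs' + length ys' = n"
    "g \<in> left_mults \<union> right_mults" "\<And>x. f (xs @ x # ys) = xs' @ g x # ys'"
  shows "keeps_entry f n xs ys"
  unfolding keeps_entry_def using assms by (intro exI conjI allI)

lemma keeps_entriesI:
  assumes "set xs' \<subseteq> carrier A" "set ys' \<subseteq> carrier A" "length xs' + length ys' = n"
    "g \<in> left_mults" "h \<in> right_mults" "\<And>x z. f (xs @ x # z # ys) = xs' @ g x # h z # ys'"
  shows "keeps_entries f n xs ys"
  unfolding keeps_entries_def using assms by (intro exI conjI allI)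

lemma entrywise_rels:
  assumes entry: "\<And>xs ys. set xs \<subseteq> carrier A \<Longrightarrow> set ys \<subseteq> carrier A \<Longrightarrow> length xs + length ys = m + 1 \<Longrightarrow>
      keeps_entry f (n + 1) xs ys"
    and entries: "\<And>xs ys. set xs \<subseteq> carrier A \<Longrightarrow> set ys \<subseteq> carrier A \<Longrightarrow> length xs + length ys = m \<Longrightarrow>
      keeps_entries f n xs ys \<or> joins_entries f xs ys"
    and r: "r \<in> bar_rels A S m"
  shows "lin_ext (\<lambda>as. basis (f as)) r \<in> span n"
  using r
proof (cases rule: bar_rels_cases)
  case (add xs a b ys)
  from entry[OF add(2,3,6)] obtain xs' ys' g where *: "set xs' \<subseteq> carrier A" "set ys' \<subseteq> carrier A"
      "length xs' + length ys' = n + 1" "g \<in> left_mults \<union> right_mults"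
      "\<forall>x. f (xs @ x # ys) = xs' @ g x # ys'"
    unfolding keeps_entry_def by (elim exE conjE) (rule that)
  note g = mults_linear[OF *(4)]
  have "basis (xs' @ (g a \<oplus> g b) # ys') - basis (xs' @ g a # ys') - basis (xs' @ g b # ys') \<in> span n"
    using add(4,5) by (intro bar.relspan_rel bar_rels_add * g)
  then show ?thesis using add(1) *(5) g(2)[OF add(4,5)] by (simp add: lin_ext_minus)
next
  case (smult xs c a ys)
  from entry[OF smult(2,3,5)] obtain xs' ys' g where *: "set xs' \<subseteq> carrier A" "set ys' \<subseteq> carrier A"
      "length xs' + length ys' = n + 1" "g \<in> left_mults \<union> right_mults"
      "\<forall>x. f (xs @ x # ys) = xs' @ g x # ys'"
    unfolding keeps_entry_def by (elim exE conjE) (rule that)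
  note g = mults_linear[OF *(4)]
  have "basis (xs' @ (c \<odot> g a) # ys') - scale c (basis (xs' @ g a # ys')) \<in> span n"
    using smult(4) by (intro bar.relspan_rel bar_rels_smult * g)
  then show ?thesis
    using smult(1) *(5) g(3)[OF smult(4) smult(4)] by (simp add: lin_ext_minus lin_ext_scale)
next
  case (bal xs a s b ys)
  then have s: "s \<in> carrier A" using subalgebra_subset by blast
  from entries[OF bal(2,3,7)] show ?thesis
  proof
    assume "keeps_entries f n xs ys"
    then obtain xs' ys' g h where *: "set xs' \<subseteq> carrier A" "set ys' \<subseteq> carrier A"
      "length xs' + length ys' = n" "g \<in> left_mults" "h \<in> right_mults"
      "\<forall>x z. f (xs @ x # z # ys) = xs' @ g x # h z # ys'"
      unfolding keeps_entries_def by (elim exE conjE) (rule that)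
    have g: "g (a \<otimes> s) = g a \<otimes> s" "g a \<in> carrier A"
      using *(4) bal(4) s by (auto simp: left_mults_def ring_rules)
    have h: "h (s \<otimes> b) = s \<otimes> h b" "h b \<in> carrier A"
      using *(5) bal(5) s by (auto simp: right_mults_def ring_rules)
    have "basis (xs' @ (g a \<otimes> s) # h b # ys') - basis (xs' @ g a # (s \<otimes> h b) # ys') \<in> span n"
      by (intro bar.relspan_rel bar_rels_bal * g h bal(6))
    then show ?thesis using bal(1) *(6) g(1) h(1) by (simp add: lin_ext_minus)
  next
    assume "joins_entries f xs ys"
    then show ?thesis
      using bal s by (auto simp: joins_entries_def lin_ext_minus ring_rules bar.relspan_0)
  qed
qed

lemma bar_merge_keeps_entry:
  "set xs \<subseteq> carrier A \<Longrightarrow> set ys \<subseteq> carrier A \<Longrightarrow> i < length xs + length ys \<Longrightarrow>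
    keeps_entry (bar_merge A i) (length xs + length ys - 1) xs ys"
proof (induction xs arbitrary: i)
  case Nil
  show ?case
  proof (cases i)
    case 0
    with Nil obtain q zs where "ys = q # zs" by (cases ys) auto
    with 0 Nil show ?thesis
      by (intro keeps_entryI[of "[]" zs _ "\<lambda>x. x \<otimes> q"]) (auto simp: mults_intros)
  next
    case (Suc j)
    with Nil bar_merge_closed[OF ring_A, of j ys] show ?thesis
      by (intro keeps_entryI[of "[]" "bar_merge A j ys" _ "\<lambda>x. x"]) (auto simp: mults_intros)
  qed
next
  case (Cons p xs)
  show ?case
  proof (cases i)
    case 0
    show ?thesis
    proof (cases xs)
      case Nil
      with Cons.prems 0 show ?thesis
        by (intro keeps_entryI[of "[]" ys _ "\<lambda>x. p \<otimes> x"]) (auto simp: mults_intros)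
    next
      case (Cons p' zs)
      with Cons.prems 0 show ?thesis
        by (intro keeps_entryI[of "(p \<otimes> p') # zs" ys _ "\<lambda>x. x"]) (auto simp: mults_intros)
    qed
  next
    case (Suc j)
    with Cons.prems have "set xs \<subseteq> carrier A" "set ys \<subseteq> carrier A" "j < length xs + length ys" by auto
    from Cons.IH[OF this] obtain xs' ys' g where *: "set xs' \<subseteq> carrier A" "set ys' \<subseteq> carrier A"
        "length xs' + length ys' = length xs + length ys - 1" "g \<in> left_mults \<union> right_mults"
        "\<forall>x. bar_merge A j (xs @ x # ys) = xs' @ g x # ys'"
      unfolding keeps_entry_def by (elim exE conjE) (rule that)
    show ?thesis
      by (rule keeps_entryI[of "p # xs'" ys' _ g]) (use * Cons.prems Suc in simp_all)
  qed
qed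

lemma bar_merge_keeps_entries:
  "set xs \<subseteq> carrier A \<Longrightarrow> set ys \<subseteq> carrier A \<Longrightarrow> i \<le> length xs + length ys \<Longrightarrow>
    keeps_entries (bar_merge A i) (length xs + length ys - 1) xs ys \<or> joins_entries (bar_merge A i) xs ys"
proof (induction xs arbitrary: i)
  case Nil
  consider "i = 0" | "i = 1" | j where "i = Suc (Suc j)" by (metis One_nat_def not0_implies_Suc)
  then show ?case
  proof cases
    case 1
    then show ?thesis by (auto simp: joins_entries_def intro: exI[of _ "[]"])
  next
    case 2
    with Nil obtain q zs where "ys = q # zs" by (cases ys) auto
    with 2 Nil show ?thesis
      by (intro disjI1 keeps_entriesI[of "[]" zs _ "\<lambda>x. x" "\<lambda>x. x \<otimes> q"]) (auto simp: mults_intros)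
  next
    case 3
    with Nil bar_merge_closed[OF ring_A, of j ys] show ?thesis
      by (intro disjI1 keeps_entriesI[of "[]" "bar_merge A j ys" _ "\<lambda>x. x" "\<lambda>x. x"])
        (auto simp: mults_intros)
  qed
next
  case (Cons p xs)
  show ?case
  proof (cases i)
    case 0
    show ?thesis
    proof (cases xs)
      case Nil
      with Cons.prems 0 show ?thesis
        by (intro disjI1 keeps_entriesI[of "[]" ys _ "\<lambda>x. p \<otimes> x" "\<lambda>x. x"]) (auto simp: mults_intros)
    next
      case (Cons p' zs)
      with Cons.prems 0 show ?thesis
        by (intro disjI1 keeps_entriesI[of "(p \<otimes> p') # zs" ys _ "\<lambda>x. x" "\<lambda>x. x"])
          (auto simp: mults_intros)
    qed
  next
    case (Suc j)
    with Cons.prems have le: "set xs \<subseteq> carrier A" "set ys \<subseteq> carrier A" "j \<le> length xs + length ys" by auto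
    from Cons.IH[OF this] show ?thesis
    proof
      assume "keeps_entries (bar_merge A j) (length xs + length ys - 1) xs ys"
      then obtain xs' ys' g h where *: "set xs' \<subseteq> carrier A" "set ys' \<subseteq> carrier A"
        "length xs' + length ys' = length xs + length ys - 1" "g \<in> left_mults" "h \<in> right_mults"
        "\<forall>x z. bar_merge A j (xs @ x # z # ys) = xs' @ g x # h z # ys'"
        unfolding keeps_entries_def by (elim exE conjE) (rule that)
      show ?thesis
      proof (cases "xs = [] \<and> ys = []")
        case True
        with le(3) Suc show ?thesis by (auto simp: joins_entries_def intro: exI[of _ "[p]"])
      next
        case False
        then show ?thesis
          by (intro disjI1 keeps_entriesI[of "p # xs'" ys' _ g h])
            (use * Cons.prems Suc in \<open>auto simp: Suc_le_eq\<close>)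
      qed
    next
      assume "joins_entries (bar_merge A j) xs ys"
      then obtain xs' ys' where "\<forall>x z. bar_merge A j (xs @ x # z # ys) = xs' @ (x \<otimes> z) # ys'"
        unfolding joins_entries_def by (elim exE) (rule that)
      then have "joins_entries (bar_merge A i) (p # xs) ys"
        unfolding joins_entries_def using Suc by (intro exI[of _ "p # xs'"] exI[of _ ys']) simp
      then show ?thesis ..
    qed
  qed
qed

lemma bar_merge_rels:
  assumes "r \<in> bar_rels A S (Suc n)" "i \<le> n + 1"
  shows "lin_ext (\<lambda>as. basis (bar_merge A i as)) r \<in> span n"
proof (rule entrywise_rels[OF _ _ assms(1)])
  fix xs ys assume *: "set xs \<subseteq> carrier A" "set ys \<subseteq> carrier A"
  show "keeps_entry (bar_merge A i) (n + 1) xs ys" if "length xs + length ys = Suc n + 1"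
    using bar_merge_keeps_entry[OF *, of i] that assms(2) by simp
  show "keeps_entries (bar_merge A i) n xs ys \<or> joins_entries (bar_merge A i) xs ys"
    if "length xs + length ys = Suc n"
    using bar_merge_keeps_entries[OF *, of i] that assms(2) by simp
qed

definition bar_boundary :: "nat \<Rightarrow> 'a list \<Rightarrow> 'a list \<Rightarrow>\<^sub>0 'k" where
  "bar_boundary n as = (\<Sum>i\<le>n + 1. scale ((- 1) ^ i) (basis (bar_merge A i as)))"

lemma bar_boundary_keys:
  "as \<in> bar_gens A (Suc n) \<Longrightarrow> supp (bar_boundary n as) \<subseteq> bar_gens A n"
proof -
  assume as: "as \<in> bar_gens A (Suc n)"
  have "supp (scale ((- 1) ^ i :: 'k) (basis (bar_merge A i as))) \<subseteq> bar_gens A n"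
    if "i \<in> {..n + 1}" for i
    using that as bar_merge_closed[OF ring_A, of i as]
    by (intro keys_subset) (auto simp: bar_gens_def)
  then show ?thesis
    unfolding bar_boundary_def by (intro order.trans[OF Poly_Mapping.keys_sum]) blast
qed

lemma bar_diff_eq:
  "bar_diff A S n = presented_map (bar_gens A n) (bar_rels A S n)
    (\<lambda>as. \<Sum>i\<le>n + 1. scale ((- 1) ^ i)
      (basis (take i as @ (as ! i \<otimes> as ! (i + 1)) # drop (i + 2) as)))"
proof -
  have "Poly_Mapping.single x ((- 1) ^ i) = scale ((- 1) ^ i :: 'k) (basis x)" for x :: "'a list" and i
    by (rule single_eq_scale)
  then show ?thesis by (simp only: bar_diff_def)
qed

lemma
  shows bar_diff_linear:
      "lin_map (bar_space (Suc n))
        (bar_space n) (bar_diff A S n)"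
    and bar_diff_tensor: "as \<in> bar_gens A (Suc n) \<Longrightarrow>
      bar_diff A S n (tensor (Suc n) as) = barcls n (bar_boundary n as)"
proof -
  let ?h = "\<lambda>as. \<Sum>i\<le>n + 1. scale ((- 1) ^ i :: 'k)
      (basis (take i as @ (as ! i \<otimes> as ! (i + 1)) # drop (i + 2) as))"
  have h: "?h as = bar_boundary n as" if "as \<in> bar_gens A (Suc n)" for as
    unfolding bar_boundary_def
    by (rule sum.cong[OF refl]) (use that in \<open>simp add: bar_gens_def bar_merge_eq[simplified]\<close>)
  have keys: "supp (?h as) \<subseteq> bar_gens A n" if "as \<in> bar_gens A (Suc n)" for as
    unfolding h[OF that] by (rule bar_boundary_keys[OF that])
  have rels: "lin_ext ?h r \<in> span n" if "r \<in> bar_rels A S (Suc n)" for r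
  proof -
    have "lin_ext ?h r = lin_ext (bar_boundary n) r"
      by (rule lin_ext_cong) (use h bar.relations_keys[OF that] in blast)
    also have "\<dots> = (\<Sum>i\<le>n + 1. scale ((- 1) ^ i) (lin_ext (\<lambda>as. basis (bar_merge A i as)) r))"
      unfolding bar_boundary_def[abs_def] lin_ext_def scale_sum
      by (subst sum.swap) (simp add: scale_simps mult.commute)
    also have "\<dots> \<in> span n"
      using that by (intro bar.relspan_sum bar.relspan_scale bar_merge_rels) auto
    finally show ?thesis .
  qed
  show "lin_map (bar_space (Suc n))
        (bar_space n) (bar_diff A S n)"
    unfolding bar_diff_eq by (rule bar.presented_map_linear[OF bar_presentation keys rels])
  show "bar_diff A S n (tensor (Suc n) as) = barcls n (bar_boundary n as)"
    if "as \<in> bar_gens A (Suc n)"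
    unfolding bar_diff_eq
    using bar.presented_map_cls[OF bar_presentation keys rels, where x="basis as"] that h by simp
qed

end

section \<open>Tensor products of bimodules over the enveloping algebra\<close>

locale bitensor_product =
  fixes A :: "('a, 'l) ring_scheme"
    and M :: "('k::field, 'x, 'a, 'm) bimodule_scheme"
    and Y :: "('k, 'y, 'a, 'n) bimodule_scheme"
  assumes left_module: "Module.module ground M"
    and right_module: "Module.module ground Y"
    and left_closed: "a \<in> carrier A \<Longrightarrow> x \<in> carrier M \<Longrightarrow> lact M a x \<in> carrier M"
      "a \<in> carrier A \<Longrightarrow> x \<in> carrier M \<Longrightarrow> ract M x a \<in> carrier M"
    and right_closed: "a \<in> carrier A \<Longrightarrow> y \<in> carrier Y \<Longrightarrow> lact Y a y \<in> carrier Y"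
      "a \<in> carrier A \<Longrightarrow> y \<in> carrier Y \<Longrightarrow> ract Y y a \<in> carrier Y"
begin

interpretation M: Module.module ground M by (rule left_module)
interpretation Y: Module.module ground Y by (rule right_module)

lemma bitensor_rels_cases:
  assumes "r \<in> bitensor_rels A M Y"
  obtains (addl) x x' y where "r = basis (x \<oplus>\<^bsub>M\<^esub> x', y) - basis (x, y) - basis (x', y)"
      "x \<in> carrier M" "x' \<in> carrier M" "y \<in> carrier Y"
  | (addr) x y y' where "r = basis (x, y \<oplus>\<^bsub>Y\<^esub> y') - basis (x, y) - basis (x, y')"
      "x \<in> carrier M" "y \<in> carrier Y" "y' \<in> carrier Y"
  | (smultl) c x y where "r = basis (c \<odot>\<^bsub>M\<^esub> x, y) - scale c (basis (x, y))"
      "x \<in> carrier M" "y \<in> carrier Y"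
  | (smultr) c x y where "r = basis (x, c \<odot>\<^bsub>Y\<^esub> y) - scale c (basis (x, y))"
      "x \<in> carrier M" "y \<in> carrier Y"
  | (ball) x a y where "r = basis (ract M x a, y) - basis (x, lact Y a y)"
      "x \<in> carrier M" "a \<in> carrier A" "y \<in> carrier Y"
  | (balr) x a y where "r = basis (lact M a x, y) - basis (x, ract Y y a)"
      "x \<in> carrier M" "a \<in> carrier A" "y \<in> carrier Y"
  using assms unfolding bitensor_rels_def by (elim UnE CollectE exE conjE) (rule that; assumption)+

lemma bitensor_relsI:
  assumes "x \<in> carrier M" "y \<in> carrier Y"
  shows "x' \<in> carrier M \<Longrightarrow>
      basis (x \<oplus>\<^bsub>M\<^esub> x', y) - basis (x, y) - basis (x', y) \<in> bitensor_rels A M Y"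
    and "y' \<in> carrier Y \<Longrightarrow>
      basis (x, y \<oplus>\<^bsub>Y\<^esub> y') - basis (x, y) - basis (x, y') \<in> bitensor_rels A M Y"
    and "basis (c \<odot>\<^bsub>M\<^esub> x, y) - scale c (basis (x, y)) \<in> bitensor_rels A M Y"
    and "basis (x, c \<odot>\<^bsub>Y\<^esub> y) - scale c (basis (x, y)) \<in> bitensor_rels A M Y"
    and "a \<in> carrier A \<Longrightarrow> basis (ract M x a, y) - basis (x, lact Y a y) \<in> bitensor_rels A M Y"
    and "a \<in> carrier A \<Longrightarrow> basis (lact M a x, y) - basis (x, ract Y y a) \<in> bitensor_rels A M Y"
  unfolding bitensor_rels_def Un_iff mem_Collect_eq using assms by blast+

lemma bitensor_presentation: "presentation (carrier M \<times> carrier Y) (bitensor_rels A M Y)"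
proof
  fix r assume "r \<in> bitensor_rels A M Y"
  then show "supp r \<subseteq> carrier M \<times> carrier Y"
    by (cases rule: bitensor_rels_cases)
      (simp_all only:, (intro keys_subset; simp add: left_closed right_closed)+)
qed

sublocale bt: presentation "carrier M \<times> carrier Y" "bitensor_rels A M Y"
  by (rule bitensor_presentation)

definition pure :: "'x \<Rightarrow> 'y \<Rightarrow> ('x \<times> 'y \<Rightarrow>\<^sub>0 'k) set" where
  "pure x y = cls (carrier M \<times> carrier Y) (bitensor_rels A M Y) (basis (x, y))"

lemma bitensor_module: "Module.module ground (bitensor A M Y)"
  unfolding bitensor_def by (rule bt.presented_module)

lemma pure_closed: "x \<in> carrier M \<Longrightarrow> y \<in> carrier Y \<Longrightarrow> pure x y \<in> carrier (bitensor A M Y)"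
  unfolding bitensor_def pure_def by (rule bt.cls_basis_closed) simp

lemma
  assumes "x \<in> carrier M" "y \<in> carrier Y"
  shows pure_add_left: "x' \<in> carrier M \<Longrightarrow> pure (x \<oplus>\<^bsub>M\<^esub> x') y = pure x y \<oplus>\<^bsub>bitensor A M Y\<^esub> pure x' y"
    and pure_add_right: "y' \<in> carrier Y \<Longrightarrow> pure x (y \<oplus>\<^bsub>Y\<^esub> y') = pure x y \<oplus>\<^bsub>bitensor A M Y\<^esub> pure x y'"
    and pure_smult_left: "pure (c \<odot>\<^bsub>M\<^esub> x) y = c \<odot>\<^bsub>bitensor A M Y\<^esub> pure x y"
    and pure_smult_right: "pure x (c \<odot>\<^bsub>Y\<^esub> y) = c \<odot>\<^bsub>bitensor A M Y\<^esub> pure x y"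
    and pure_ract: "a \<in> carrier A \<Longrightarrow> pure (ract M x a) y = pure x (lact Y a y)"
    and pure_lact: "a \<in> carrier A \<Longrightarrow> pure (lact M a x) y = pure x (ract Y y a)"
  unfolding bitensor_def pure_def
  using assms
  by (simp_all flip: bt.cls_add bt.cls_scale)
    (rule bt.cls_eqI; simp add: keys_subset bt.relspan_rel bitensor_relsI left_closed right_closed
      flip: diff_diff_add)+

lemma bitensor_induct [consumes 1, case_names zero gen add smult]:
  assumes "z \<in> carrier (bitensor A M Y)"
    and "P \<zero>\<^bsub>bitensor A M Y\<^esub>"
    and "\<And>x y. x \<in> carrier M \<Longrightarrow> y \<in> carrier Y \<Longrightarrow> P (pure x y)"
    and "\<And>x y. x \<in> carrier (bitensor A M Y) \<Longrightarrow> y \<in> carrier (bitensor A M Y) \<Longrightarrow> P x \<Longrightarrow> P y \<Longrightarrow>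
      P (x \<oplus>\<^bsub>bitensor A M Y\<^esub> y)"
    and "\<And>c x. x \<in> carrier (bitensor A M Y) \<Longrightarrow> P x \<Longrightarrow> P (c \<odot>\<^bsub>bitensor A M Y\<^esub> x)"
  shows "P z"
  using assms unfolding bitensor_def pure_def
  by (induction z rule: bt.presented_induct) auto

lemma bitensor_form:
  fixes f :: "'x \<Rightarrow> 'y \<Rightarrow> 'k"
  assumes "\<And>y. y \<in> carrier Y \<Longrightarrow> linear_form M (\<lambda>x. f x y)"
    and "\<And>x. x \<in> carrier M \<Longrightarrow> linear_form Y (f x)"
    and "\<And>x y a. x \<in> carrier M \<Longrightarrow> y \<in> carrier Y \<Longrightarrow> a \<in> carrier A \<Longrightarrow> f (ract M x a) y = f x (lact Y a y)"
    and "\<And>x y a. x \<in> carrier M \<Longrightarrow> y \<in> carrier Y \<Longrightarrow> a \<in> carrier A \<Longrightarrow> f (lact M a x) y = f x (ract Y y a)"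
  shows "\<exists>l. linear_form (bitensor A M Y) l \<and>
    (\<forall>x\<in>carrier M. \<forall>y\<in>carrier Y. l (pure x y) = f x y)"
proof -
  have r: "eval_form (\<lambda>(x, y). f x y) r = 0" if "r \<in> bitensor_rels A M Y" for r
    using that
    by (cases rule: bitensor_rels_cases)
      (use assms in \<open>auto simp: eval_form_simps linear_form_def\<close>)
  show ?thesis
  proof (intro exI conjI ballI)
    show "linear_form (bitensor A M Y) (presented_form (\<lambda>(x, y). f x y))"
      unfolding bitensor_def using r by (rule bt.presented_form_linear)
    show "presented_form (\<lambda>(x, y). f x y) (pure x y) = f x y" if "x \<in> carrier M" "y \<in> carrier Y" for x y
      unfolding pure_def using bt.presented_form_cls[OF r, of "basis (x, y)"] that
      by (simp add: eval_form_simps)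
  qed
qed

end

lemma restrict_bimodule_sel [simp]:
  "carrier (restrict_bimodule \<phi> Y) = carrier Y" "zero (restrict_bimodule \<phi> Y) = zero Y"
  "add (restrict_bimodule \<phi> Y) = add Y" "smult (restrict_bimodule \<phi> Y) = smult Y"
  "lact (restrict_bimodule \<phi> Y) b = lact Y (\<phi> b)" "ract (restrict_bimodule \<phi> Y) y b = ract Y y (\<phi> b)"
  by (simp_all add: restrict_bimodule_def)

lemma restrict_bimodule_id: "restrict_bimodule id Y = (Y :: ('k, 'y, 'a) bimodule)"
  by (simp add: restrict_bimodule_def)

lemma
  fixes Y :: "('k::field, 'y, 'b, 'n) bimodule_scheme"
  assumes "bitensor_product A M (restrict_bimodule \<phi> Y)" and "bitensor_product A' M' Y"
    and f: "lin_map M M' f"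
    and lact: "\<And>a x. a \<in> carrier A \<Longrightarrow> x \<in> carrier M \<Longrightarrow> f (lact M a x) = lact M' (\<phi> a) (f x)"
    and ract: "\<And>a x. a \<in> carrier A \<Longrightarrow> x \<in> carrier M \<Longrightarrow> f (ract M x a) = ract M' (f x) (\<phi> a)"
    and \<phi>: "\<And>a. a \<in> carrier A \<Longrightarrow> \<phi> a \<in> carrier A'"
  shows bitensor_map_linear:
      "lin_map (bitensor A M (restrict_bimodule \<phi> Y)) (bitensor A' M' Y) (bitensor_map A' M' Y f)"
    and bitensor_map_pure: "x \<in> carrier M \<Longrightarrow> y \<in> carrier Y \<Longrightarrow>
      bitensor_map A' M' Y f (bitensor_product.pure A M (restrict_bimodule \<phi> Y) x y) =
      bitensor_product.pure A' M' Y (f x) y"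
proof -
  interpret s: bitensor_product A M "restrict_bimodule \<phi> Y" by fact
  interpret t: bitensor_product A' M' Y by fact
  let ?h = "\<lambda>(x, y). basis (f x, y) :: _ \<Rightarrow>\<^sub>0 'k"
  have keys: "supp (?h b) \<subseteq> carrier M' \<times> carrier Y"
    if "b \<in> carrier M \<times> carrier (restrict_bimodule \<phi> Y)" for b
    using that lin_mapD(1)[OF f] by auto
  have rels: "lin_ext ?h r \<in> t.bt.relspan" if "r \<in> bitensor_rels A M (restrict_bimodule \<phi> Y)" for r
    using that
    by (cases rule: s.bitensor_rels_cases)
      (auto simp: lin_ext_minus lin_ext_scale lin_mapD[OF f] lact ract
        intro!: t.bt.relspan_rel t.bitensor_relsI \<phi>)
  show "lin_map (bitensor A M (restrict_bimodule \<phi> Y)) (bitensor A' M' Y) (bitensor_map A' M' Y f)"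
    unfolding bitensor_def bitensor_map_def
    by (rule s.bt.presented_map_linear[OF t.bitensor_presentation keys rels])
  show "bitensor_map A' M' Y f (s.pure x y) = t.pure (f x) y" if "x \<in> carrier M" "y \<in> carrier Y"
    unfolding s.pure_def t.pure_def bitensor_map_def
    using s.bt.presented_map_cls[OF t.bitensor_presentation keys rels, of "basis (x, y)"] that by simp
qed

section \<open>The relative Hochschild complex\<close>

lemma rel_bar_sel [simp]:
  "carrier (rel_bar A S n) = carrier (presented (bar_gens A n) (bar_rels A S n))"
  "zero (rel_bar A S n) = zero (presented (bar_gens A n) (bar_rels A S n))"
  "add (rel_bar A S n) = add (presented (bar_gens A n) (bar_rels A S n))"
  "smult (rel_bar A S n) = smult (presented (bar_gens A n) (bar_rels A S n))"
  by (simp_all add: rel_bar_def Let_def)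

lemma bar_merge_map:
  "(\<And>x y. x \<in> carrier A \<Longrightarrow> y \<in> carrier A \<Longrightarrow> \<phi> (x \<otimes>\<^bsub>A\<^esub> y) = \<phi> x \<otimes>\<^bsub>A'\<^esub> \<phi> y) \<Longrightarrow>
    set as \<subseteq> carrier A \<Longrightarrow> map \<phi> (bar_merge A i as) = bar_merge A' i (map \<phi> as)"
  by (induction A i as rule: bar_merge.induct) auto

context relative_algebra
begin

lemma bar_merge_lact:
  assumes "a \<in> carrier A" "set as \<subseteq> carrier A" "Suc i < length as"
  shows "bar_merge A i ((a \<otimes> hd as) # tl as) = (a \<otimes> hd (bar_merge A i as)) # tl (bar_merge A i as)"
  using assms by (cases "(A, i, as)" rule: bar_merge.cases) (auto simp: ring_rules)

lemma bar_merge_ract: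
  assumes "a \<in> carrier A"
  shows "set as \<subseteq> carrier A \<Longrightarrow> Suc i < length as \<Longrightarrow>
    bar_merge A i (butlast as @ [last as \<otimes> a]) = butlast (bar_merge A i as) @ [last (bar_merge A i as) \<otimes> a]"
proof (induction i arbitrary: as)
  case 0
  then obtain x y zs where "as = x # y # zs" by (cases as; cases "tl as") auto
  with 0 assms show ?case by (cases zs rule: rev_cases) (auto simp: ring_rules butlast_append)
next
  case (Suc i)
  then obtain x zs where as: "as = x # zs" by (cases as) auto
  with Suc.prems have zs: "Suc i < length zs" "set zs \<subseteq> carrier A" by auto
  then have "bar_merge A i zs \<noteq> []" "zs \<noteq> []"
    using bar_merge_closed[OF ring_A zs] by auto
  then show ?case using Suc.IH[of zs] zs as by simp
qed

lemma lact_gens: "a \<in> carrier A \<Longrightarrow> as \<in> bar_gens A n \<Longrightarrow> (a \<otimes> hd as) # tl as \<in> bar_gens A n"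
  by (cases as) (auto simp: bar_gens_def)

lemma ract_gens: "a \<in> carrier A \<Longrightarrow> as \<in> bar_gens A n \<Longrightarrow> butlast as @ [last as \<otimes> a] \<in> bar_gens A n"
  by (cases as rule: rev_cases) (auto simp: bar_gens_def)

lemma lact_rels:
  assumes a: "a \<in> carrier A" and r: "r \<in> bar_rels A S n"
  shows "lin_ext (\<lambda>as. basis ((a \<otimes> hd as) # tl as)) r \<in> span n"
proof (rule entrywise_rels[OF _ _ r])
  let ?f = "\<lambda>as. (a \<otimes> hd as) # tl as"
  fix xs ys assume *: "set xs \<subseteq> carrier A" "set ys \<subseteq> carrier A"
  show "keeps_entry ?f (n + 1) xs ys" if "length xs + length ys = n + 1"
    using that * a
    by (cases xs; intro keeps_entryI[of "case xs of [] \<Rightarrow> [] | p # zs \<Rightarrow> (a \<otimes> p) # zs" ys _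
          "if xs = [] then (\<lambda>x. a \<otimes> x) else (\<lambda>x. x)"]) (auto simp: mults_intros)
  have "keeps_entries ?f n xs ys" if "length xs + length ys = n"
    using that * a
    by (cases xs; intro keeps_entriesI[of "case xs of [] \<Rightarrow> [] | p # zs \<Rightarrow> (a \<otimes> p) # zs" ys _
          "if xs = [] then (\<lambda>x. a \<otimes> x) else (\<lambda>x. x)" "\<lambda>x. x"]) (auto simp: mults_intros)
  then show "keeps_entries ?f n xs ys \<or> joins_entries ?f xs ys" if "length xs + length ys = n"
    using that by blast
qed

lemma ract_rels:
  assumes a: "a \<in> carrier A" and r: "r \<in> bar_rels A S n"
  shows "lin_ext (\<lambda>as. basis (butlast as @ [last as \<otimes> a])) r \<in> span n"
proof (rule entrywise_rels[OF _ _ r])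
  let ?f = "\<lambda>as. butlast as @ [last as \<otimes> a]"
  fix xs ys assume *: "set xs \<subseteq> carrier A" "set ys \<subseteq> carrier A"
  let ?ys = "if ys = [] then [] else butlast ys @ [last ys \<otimes> a]"
    and ?h = "if ys = [] then (\<lambda>x. x \<otimes> a) else (\<lambda>x. x)"
  show "keeps_entry ?f (n + 1) xs ys" if "length xs + length ys = n + 1"
    using that * a
    by (cases ys rule: rev_cases; intro keeps_entryI[of xs ?ys _ ?h]) (auto simp: mults_intros butlast_append)
  have "keeps_entries ?f n xs ys" if "length xs + length ys = n"
    using that * a
    by (cases ys rule: rev_cases; intro keeps_entriesI[of xs ?ys _ "\<lambda>x. x" ?h])
      (auto simp: mults_intros butlast_append)
  then show "keeps_entries ?f n xs ys \<or> joins_entries ?f xs ys" if "length xs + length ys = n"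
    using that by blast
qed

lemma rel_bar_module: "Module.module ground (rel_bar A S n)"
  by (rule module_transfer[OF bar.presented_module]) simp_all

lemma tensor_closed: "as \<in> bar_gens A n \<Longrightarrow> tensor n as \<in> carrier (rel_bar A S n)"
  by (simp add: bar.cls_basis_closed)

lemma
  assumes a: "a \<in> carrier A"
  shows rel_bar_lact_linear: "lin_map (rel_bar A S n) (rel_bar A S n) (lact (rel_bar A S n) a)"
    and rel_bar_ract_linear: "lin_map (rel_bar A S n) (rel_bar A S n) (\<lambda>x. ract (rel_bar A S n) x a)"
    and rel_bar_lact_cls: "supp x \<subseteq> bar_gens A n \<Longrightarrow>
      lact (rel_bar A S n) a (barcls n x) =
      barcls n (lin_ext (\<lambda>as. basis ((a \<otimes> hd as) # tl as)) x)"
    and rel_bar_ract_cls: "supp x \<subseteq> bar_gens A n \<Longrightarrow>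
      ract (rel_bar A S n) (barcls n x) a =
      barcls n (lin_ext (\<lambda>as. basis (butlast as @ [last as \<otimes> a])) x)"
proof -
  have keys: "supp (basis ((a \<otimes> hd as) # tl as) :: _ \<Rightarrow>\<^sub>0 'k) \<subseteq> bar_gens A n"
    "supp (basis (butlast as @ [last as \<otimes> a]) :: _ \<Rightarrow>\<^sub>0 'k) \<subseteq> bar_gens A n"
    if "as \<in> bar_gens A n" for as
    using lact_gens[OF a that] ract_gens[OF a that] by simp_all
  have act: "lact (rel_bar A S n) a = presented_map (bar_gens A n) (bar_rels A S n)
      (\<lambda>as. basis ((a \<otimes> hd as) # tl as))"
    "(\<lambda>x. ract (rel_bar A S n) x a) = presented_map (bar_gens A n) (bar_rels A S n)
      (\<lambda>as. basis (butlast as @ [last as \<otimes> a]))"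
    by (simp_all add: rel_bar_def Let_def)
  show "lin_map (rel_bar A S n) (rel_bar A S n) (lact (rel_bar A S n) a)"
    unfolding act
  proof (rule lin_map_transfer)
    show "lin_map (bar_space n) (bar_space n)
        (presented_map (bar_gens A n) (bar_rels A S n) (\<lambda>as. basis ((a \<otimes> hd as) # tl as)))"
      by (rule bar.presented_map_linear[OF bar_presentation keys(1) lact_rels[OF a]])
  qed simp_all
  show "lin_map (rel_bar A S n) (rel_bar A S n) (\<lambda>x. ract (rel_bar A S n) x a)"
    unfolding act
  proof (rule lin_map_transfer)
    show "lin_map (bar_space n) (bar_space n)
        (presented_map (bar_gens A n) (bar_rels A S n) (\<lambda>as. basis (butlast as @ [last as \<otimes> a])))"
      by (rule bar.presented_map_linear[OF bar_presentation keys(2) ract_rels[OF a]])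
  qed simp_all
  assume x: "supp x \<subseteq> bar_gens A n"
  show "lact (rel_bar A S n) a (barcls n x) =
      barcls n (lin_ext (\<lambda>as. basis ((a \<otimes> hd as) # tl as)) x)"
    using bar.presented_map_cls[where n=n, OF bar_presentation keys(1) lact_rels[OF a] x]
    by (simp add: rel_bar_def Let_def)
  show "ract (rel_bar A S n) (barcls n x) a =
      barcls n (lin_ext (\<lambda>as. basis (butlast as @ [last as \<otimes> a])) x)"
    using bar.presented_map_cls[where n=n, OF bar_presentation keys(2) ract_rels[OF a] x]
    by (simp add: rel_bar_def Let_def)
qed

lemma
  assumes "a \<in> carrier A" "as \<in> bar_gens A n"
  shows lact_tensor: "lact (rel_bar A S n) a (tensor n as) = tensor n ((a \<otimes> hd as) # tl as)"
    and ract_tensor: "ract (rel_bar A S n) (tensor n as) a = tensor n (butlast as @ [last as \<otimes> a])"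
  using rel_bar_lact_cls[OF assms(1), of "basis as"] rel_bar_ract_cls[OF assms(1), of "basis as"] assms
  by simp_all

lemma bar_diff_linear': "lin_map (rel_bar A S (Suc n)) (rel_bar A S n) (bar_diff A S n)"
  using bar_diff_linear by (rule lin_map_transfer) simp_all

lemma rel_bar_eqI:
  assumes V: "Module.module ground V" and f: "lin_map (rel_bar A S n) V f" "lin_map (rel_bar A S n) V g"
    and gen: "\<And>as. as \<in> bar_gens A n \<Longrightarrow> f (tensor n as) = g (tensor n as)"
    and x: "x \<in> carrier (rel_bar A S n)"
  shows "f x = g x"
proof -
  have x': "x \<in> carrier (bar_space n)" using x by simp
  have f': "lin_map (bar_space n) V f" "lin_map (bar_space n) V g"
    by (auto intro: lin_map_transfer[OF f(1)] lin_map_transfer[OF f(2)])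
  show ?thesis using gen x' by (rule bar.lin_map_eqI[OF V f'])
qed

text \<open>
  Left multiplication commutes with every face because it only changes the first entry, and associativity
  covers the face that multiplies this entry; dually on the right.
\<close>

lemma bar_diff_action:
  assumes a: "a \<in> carrier A" and x: "x \<in> carrier (rel_bar A S (Suc n))"
  shows "bar_diff A S n (lact (rel_bar A S (Suc n)) a x) = lact (rel_bar A S n) a (bar_diff A S n x)"
    and "bar_diff A S n (ract (rel_bar A S (Suc n)) x a) = ract (rel_bar A S n) (bar_diff A S n x) a"
proof -
  show "bar_diff A S n (lact (rel_bar A S (Suc n)) a x) = lact (rel_bar A S n) a (bar_diff A S n x)"
  proof (rule rel_bar_eqI[OF rel_bar_module _ _ _ x])
    show "lin_map (rel_bar A S (Suc n)) (rel_bar A S n)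
        (\<lambda>x. bar_diff A S n (lact (rel_bar A S (Suc n)) a x))"
      by (intro lin_map_comp[OF rel_bar_lact_linear[OF a] bar_diff_linear'])
    show "lin_map (rel_bar A S (Suc n)) (rel_bar A S n)
        (\<lambda>x. lact (rel_bar A S n) a (bar_diff A S n x))"
      by (intro lin_map_comp[OF bar_diff_linear' rel_bar_lact_linear[OF a]])
    fix as assume as: "as \<in> bar_gens A (Suc n)"
    have "bar_boundary n ((a \<otimes> hd as) # tl as) =
        lin_ext (\<lambda>as. basis ((a \<otimes> hd as) # tl as)) (bar_boundary n as)"
      unfolding bar_boundary_def
      by (simp only: lin_ext_sum lin_ext_scale lin_ext_basis, rule sum.cong[OF refl])
        (use as a in \<open>simp add: bar_merge_lact bar_gens_def\<close>)
    then show "bar_diff A S n (lact (rel_bar A S (Suc n)) a (tensor (Suc n) as)) =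
        lact (rel_bar A S n) a (bar_diff A S n (tensor (Suc n) as))"
      using a as by (simp only: lact_tensor bar_diff_tensor lact_gens rel_bar_lact_cls bar_boundary_keys)
  qed
  show "bar_diff A S n (ract (rel_bar A S (Suc n)) x a) = ract (rel_bar A S n) (bar_diff A S n x) a"
  proof (rule rel_bar_eqI[OF rel_bar_module _ _ _ x])
    show "lin_map (rel_bar A S (Suc n)) (rel_bar A S n)
        (\<lambda>x. bar_diff A S n (ract (rel_bar A S (Suc n)) x a))"
      by (intro lin_map_comp[OF rel_bar_ract_linear[OF a] bar_diff_linear'])
    show "lin_map (rel_bar A S (Suc n)) (rel_bar A S n)
        (\<lambda>x. ract (rel_bar A S n) (bar_diff A S n x) a)"
      by (intro lin_map_comp[OF bar_diff_linear' rel_bar_ract_linear[OF a]])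
    fix as assume as: "as \<in> bar_gens A (Suc n)"
    have "bar_boundary n (butlast as @ [last as \<otimes> a]) =
        lin_ext (\<lambda>as. basis (butlast as @ [last as \<otimes> a])) (bar_boundary n as)"
      unfolding bar_boundary_def
      by (simp only: lin_ext_sum lin_ext_scale lin_ext_basis, rule sum.cong[OF refl])
        (use as a in \<open>simp add: bar_merge_ract bar_gens_def\<close>)
    then show "bar_diff A S n (ract (rel_bar A S (Suc n)) (tensor (Suc n) as) a) =
        ract (rel_bar A S n) (bar_diff A S n (tensor (Suc n) as)) a"
      using a as by (simp only: ract_tensor bar_diff_tensor ract_gens rel_bar_ract_cls bar_boundary_keys)
  qed
qed

lemma tensor_add:
  assumes "set xs \<subseteq> carrier A" "set ys \<subseteq> carrier A" "a \<in> carrier A" "b \<in> carrier A"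
    "length xs + length ys = n + 1"
  shows "tensor n (xs @ (a \<oplus> b) # ys) = tensor n (xs @ a # ys) \<oplus>\<^bsub>rel_bar A S n\<^esub> tensor n (xs @ b # ys)"
proof -
  have g: "xs @ c # ys \<in> bar_gens A n" if "c \<in> carrier A" for c
    using assms that by (auto simp: bar_gens_def)
  have "tensor n (xs @ (a \<oplus> b) # ys) = barcls n (basis (xs @ a # ys) + basis (xs @ b # ys))"
    using bar_rels_add[OF assms] g assms(3,4)
    by (intro bar.cls_eqI) (simp_all add: keys_subset bar.relspan_rel flip: diff_diff_add)
  then show ?thesis using g assms(3,4) by (simp add: bar.cls_add)
qed

lemma tensor_smult:
  assumes "set xs \<subseteq> carrier A" "set ys \<subseteq> carrier A" "a \<in> carrier A" "length xs + length ys = n + 1"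
  shows "tensor n (xs @ (c \<odot> a) # ys) = c \<odot>\<^bsub>rel_bar A S n\<^esub> tensor n (xs @ a # ys)"
proof -
  have g: "xs @ b # ys \<in> bar_gens A n" if "b \<in> carrier A" for b
    using assms that by (auto simp: bar_gens_def)
  have "tensor n (xs @ (c \<odot> a) # ys) = barcls n (scale c (basis (xs @ a # ys)))"
    using bar_rels_smult[OF assms] g assms(3)
    by (intro bar.cls_eqI) (simp_all add: keys_subset bar.relspan_rel)
  then show ?thesis using g assms(3) by (simp add: bar.cls_scale)
qed

lemma tensor_bal:
  assumes "set xs \<subseteq> carrier A" "set ys \<subseteq> carrier A" "a \<in> carrier A" "b \<in> carrier A" "s \<in> S"
    "length xs + length ys = n"
  shows "tensor n (xs @ (a \<otimes> s) # b # ys) = tensor n (xs @ a # (s \<otimes> b) # ys)"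
proof -
  have g: "xs @ a # b # ys \<in> bar_gens A n" if "a \<in> carrier A" "b \<in> carrier A" for a b
    using assms that by (auto simp: bar_gens_def)
  have "s \<in> carrier A" using assms(5) subalgebra_subset by blast
  then show ?thesis
    using bar_rels_bal[OF assms] g assms(3,4)
    by (intro bar.cls_eqI) (simp_all add: bar.relspan_rel)
qed

end

lemma linear_form_transfer:
  "linear_form V l \<Longrightarrow> carrier V' = carrier V \<Longrightarrow> add V' = add V \<Longrightarrow> smult V' = smult V \<Longrightarrow> linear_form V' l"
  by (simp add: linear_form_def)

locale relative_hochschild = bimodule A Y
  for A :: "('k::field, 'a, 'm) module_scheme" (structure) and Y :: "('k, 'y, 'a) bimodule" +
  fixes S :: "'a set"
  assumes base_subset: "S \<subseteq> carrier A"
begin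

lemma k_algebra_A: "k_algebra A" and module_Y: "Module.module ground Y"
  by (rule bimodule.axioms(1)[OF bimodule_axioms], rule bimodule.axioms(2)[OF bimodule_axioms])

sublocale rel: relative_algebra A S
  by (intro relative_algebra.intro relative_algebra_axioms.intro k_algebra_A base_subset)

lemma bitensor_product_chains: "bitensor_product A (rel_bar A S n) Y"
  by (rule bitensor_product.intro)
    (simp_all only: rel.rel_bar_module module_Y lact_closed ract_closed
      lin_mapD(1)[OF rel.rel_bar_lact_linear] lin_mapD(1)[OF rel.rel_bar_ract_linear])

sublocale ch: bitensor_product A "rel_bar A S n" Y for n
  by (rule bitensor_product_chains)

abbreviation "C n \<equiv> hoch_chains A S Y n"
abbreviation "C1 \<equiv> C (Suc 0)"

definition chain :: "nat \<Rightarrow> 'a list \<Rightarrow> 'y \<Rightarrow> (('a list \<Rightarrow>\<^sub>0 'k) set \<times> 'y \<Rightarrow>\<^sub>0 'k) set" where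
  "chain n as y = ch.pure n (rel.tensor n as) y"

lemma C_module: "Module.module ground (C n)"
  unfolding hoch_chains_def by (rule ch.bitensor_module)

lemma chain_closed: "as \<in> bar_gens A n \<Longrightarrow> y \<in> carrier Y \<Longrightarrow> chain n as y \<in> carrier (C n)"
  unfolding hoch_chains_def chain_def by (intro ch.pure_closed rel.tensor_closed)

lemma one_closed_A: "\<one> \<in> carrier A"
  by (rule monoid.one_closed[OF ring.axioms(2)[OF rel.ring_A]])

lemma l_one_A: "a \<in> carrier A \<Longrightarrow> \<one> \<otimes> a = a"
  and r_one_A: "a \<in> carrier A \<Longrightarrow> a \<otimes> \<one> = a"
  by (simp_all add: monoid.l_one[OF ring.axioms(2)[OF rel.ring_A]] monoid.r_one[OF ring.axioms(2)[OF rel.ring_A]])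

text \<open>
  Over the enveloping algebra the outer two entries move into the coefficient. Hence the chains of degree
  \<open>n\<close> are generated by those whose outer entries are \<open>1\<close>.
\<close>

lemma chain_collapse:
  assumes "a \<in> carrier A" "b \<in> carrier A" "set as \<subseteq> carrier A" "length as = n" "y \<in> carrier Y"
  shows "chain n (a # as @ [b]) y = chain n (\<one> # as @ [\<one>]) (lact Y b (ract Y y a))"
proof -
  have g: "\<one> # as @ [\<one>] \<in> bar_gens A n" "\<one> # as @ [b] \<in> bar_gens A n"
    using assms one_closed_A by (auto simp: bar_gens_def)
  let ?M = "rel_bar A S n"
  have "rel.tensor n (a # as @ [b]) = lact ?M a (ract ?M (rel.tensor n (\<one> # as @ [\<one>])) b)"
    using assms g rel.ract_tensor[OF assms(2) g(1)] rel.lact_tensor[OF assms(1) g(2)]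
    by (simp add: l_one_A r_one_A butlast_append del: rel_bar_sel)
  then show ?thesis
    using assms g rel.tensor_closed[OF g(1)]
    by (simp add: chain_def ch.pure_lact ch.pure_ract ch.left_closed ract_closed del: rel_bar_sel)
qed

lemma chain_induct [consumes 1, case_names zero gen add smult]:
  assumes z: "z \<in> carrier (C n)"
    and zero: "P \<zero>\<^bsub>C n\<^esub>"
    and gen: "\<And>as y. set as \<subseteq> carrier A \<Longrightarrow> length as = n \<Longrightarrow> y \<in> carrier Y \<Longrightarrow>
      P (chain n (\<one> # as @ [\<one>]) y)"
    and add: "\<And>x y. x \<in> carrier (C n) \<Longrightarrow> y \<in> carrier (C n) \<Longrightarrow> P x \<Longrightarrow> P y \<Longrightarrow> P (x \<oplus>\<^bsub>C n\<^esub> y)"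
    and smult: "\<And>c x. x \<in> carrier (C n) \<Longrightarrow> P x \<Longrightarrow> P (c \<odot>\<^bsub>C n\<^esub> x)"
  shows "P z"
proof -
  have pure: "P (ch.pure n x y)" if x: "x \<in> carrier (rel_bar A S n)" and y: "y \<in> carrier Y" for x y
  proof -
    have "x \<in> carrier (rel.bar_space n)" using x by simp
    then show ?thesis
    proof (induction x rule: rel.bar.presented_induct)
      case zero
      interpret M: Module.module ground "rel_bar A S n" by (rule rel.rel_bar_module)
      interpret C: Module.module ground "C n" by (rule C_module)
      have "ch.pure n (0 \<odot>\<^bsub>rel_bar A S n\<^esub> \<zero>\<^bsub>rel_bar A S n\<^esub>) y = 0 \<odot>\<^bsub>C n\<^esub> ch.pure n \<zero>\<^bsub>rel_bar A S n\<^esub> y"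
        unfolding hoch_chains_def using y by (intro ch.pure_smult_left) (auto simp del: rel_bar_sel)
      moreover have "ch.pure n \<zero>\<^bsub>rel_bar A S n\<^esub> y \<in> carrier (C n)"
        unfolding hoch_chains_def using y by (intro ch.pure_closed) (auto simp del: rel_bar_sel)
      ultimately have "ch.pure n \<zero>\<^bsub>rel_bar A S n\<^esub> y = \<zero>\<^bsub>C n\<^esub>"
        using M.smult_l_null[of "\<zero>\<^bsub>rel_bar A S n\<^esub>"] C.smult_l_null[of "ch.pure n \<zero>\<^bsub>rel_bar A S n\<^esub> y"]
        by (simp del: rel_bar_sel)
      then show ?case using \<open>P \<zero>\<^bsub>C n\<^esub>\<close> by simp
    next
      case (gen as)
      then have as: "length as = n + 2" "set as \<subseteq> carrier A" by (auto simp: bar_gens_def)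
      then obtain a bs where "as = a # bs" by (cases as) auto
      with as obtain cs b where "as = a # cs @ [b]" by (cases bs rule: rev_cases) auto
      with as have "set cs \<subseteq> carrier A" "length cs = n" "a \<in> carrier A" "b \<in> carrier A" by auto
      then show ?case
        using assms(3)[of cs "lact Y b (ract Y y a)"] chain_collapse[of a b cs n y] y \<open>as = a # cs @ [b]\<close>
        by (simp add: chain_def lact_closed ract_closed)
    next
      case (add u v)
      then have "ch.pure n (u \<oplus>\<^bsub>rel_bar A S n\<^esub> v) y = ch.pure n u y \<oplus>\<^bsub>C n\<^esub> ch.pure n v y"
        unfolding hoch_chains_def using y by (intro ch.pure_add_left) auto
      moreover have "ch.pure n u y \<in> carrier (C n)" "ch.pure n v y \<in> carrier (C n)"
        unfolding hoch_chains_def using y add by (auto intro!: ch.pure_closed)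
      ultimately show ?case using assms(4) add by simp
    next
      case (smult c u)
      then have "ch.pure n (c \<odot>\<^bsub>rel_bar A S n\<^esub> u) y = c \<odot>\<^bsub>C n\<^esub> ch.pure n u y"
        unfolding hoch_chains_def using y by (intro ch.pure_smult_left) auto
      moreover have "ch.pure n u y \<in> carrier (C n)"
        unfolding hoch_chains_def using y smult by (auto intro!: ch.pure_closed)
      ultimately show ?case using assms(5) smult by simp
    qed
  qed
  show ?thesis
    using z zero add smult unfolding hoch_chains_def
    by (induction z rule: ch.bitensor_induct) (auto simp: pure)
qed

lemma chain_lin_map_eqI:
  assumes "Module.module ground V" and f: "lin_map (C n) V f" and g: "lin_map (C n) V g"
    and "\<And>as y. set as \<subseteq> carrier A \<Longrightarrow> length as = n \<Longrightarrow> y \<in> carrier Y \<Longrightarrow>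
      f (chain n (\<one> # as @ [\<one>]) y) = g (chain n (\<one> # as @ [\<one>]) y)"
    and "z \<in> carrier (C n)"
  shows "f z = g z"
  using assms(5)
proof (induction z rule: chain_induct)
  case zero
  then show ?case using lin_map_zero[OF C_module assms(1) f] lin_map_zero[OF C_module assms(1) g] by simp
qed (simp_all add: assms(4) lin_mapD[OF f] lin_mapD[OF g])

lemma chain_form_eqI:
  assumes f: "linear_form (C n) f" and g: "linear_form (C n) g"
    and "\<And>as y. set as \<subseteq> carrier A \<Longrightarrow> length as = n \<Longrightarrow> y \<in> carrier Y \<Longrightarrow>
      f (chain n (\<one> # as @ [\<one>]) y) = g (chain n (\<one> # as @ [\<one>]) y)"
    and "z \<in> carrier (C n)"
  shows "f z = g z"
  using assms(4)
proof (induction z rule: chain_induct)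
  case zero
  then show ?case using linear_form_zero[OF C_module f] linear_form_zero[OF C_module g] by simp
qed (use f g in \<open>simp_all add: assms(3) linear_form_def\<close>)

lemma chain_submodule:
  assumes W: "submodule W ground (C n)"
    and "\<And>as y. set as \<subseteq> carrier A \<Longrightarrow> length as = n \<Longrightarrow> y \<in> carrier Y \<Longrightarrow>
      chain n (\<one> # as @ [\<one>]) y \<in> W"
    and "z \<in> carrier (C n)"
  shows "z \<in> W"
  using assms(3) by (induction z rule: chain_induct) (simp_all add: assms(2) k_submoduleD[OF W])

text \<open>
  The universal property of the two nested quotients: a form on \<open>C n\<close> amounts to a family of forms on the bar
  resolution, one for each coefficient, under which the outer actions pass to the coefficient.
\<close>

lemma chain_form:
  fixes h :: "'y \<Rightarrow> 'a list \<Rightarrow> 'k"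
  assumes rels: "\<And>y r. y \<in> carrier Y \<Longrightarrow> r \<in> bar_rels A S n \<Longrightarrow> eval_form (h y) r = 0"
    and lin: "\<And>as. as \<in> bar_gens A n \<Longrightarrow> linear_form Y (\<lambda>y. h y as)"
    and ract: "\<And>a y as. a \<in> carrier A \<Longrightarrow> y \<in> carrier Y \<Longrightarrow> as \<in> bar_gens A n \<Longrightarrow>
      h y (butlast as @ [last as \<otimes> a]) = h (lact Y a y) as"
    and lact: "\<And>a y as. a \<in> carrier A \<Longrightarrow> y \<in> carrier Y \<Longrightarrow> as \<in> bar_gens A n \<Longrightarrow>
      h y ((a \<otimes> hd as) # tl as) = h (ract Y y a) as"
  shows "\<exists>l. linear_form (C n) l \<and> (\<forall>as\<in>bar_gens A n. \<forall>y\<in>carrier Y. l (chain n as y) = h y as)"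
proof -
  let ?M = "rel_bar A S n" and ?f = "\<lambda>x y. presented_form (h y) x"
  have cls: "?f (rel.barcls n u) y = eval_form (h y) u"
    if "supp u \<subseteq> bar_gens A n" "y \<in> carrier Y" for u y
    using rel.bar.presented_form_cls[OF rels[OF that(2)] that(1)] by simp
  have rep: "\<exists>u. supp u \<subseteq> bar_gens A n \<and> x = rel.barcls n u"
    if "x \<in> carrier ?M" for x
    using that by (auto simp: rel.bar.carrier_presented)
  have form_M: "linear_form ?M (\<lambda>x. ?f x y)" if "y \<in> carrier Y" for y
    by (rule linear_form_transfer[OF rel.bar.presented_form_linear[OF rels[OF that]]]) simp_all
  have form_Y: "linear_form Y (?f x)" if "x \<in> carrier ?M" for x
  proof -
    from rep[OF that] obtain u where u: "supp u \<subseteq> bar_gens A n"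
      "x = rel.barcls n u" by blast
    have "eval_form (h (y \<oplus>\<^bsub>Y\<^esub> y')) u = eval_form (h y) u + eval_form (h y') u"
      if "y \<in> carrier Y" "y' \<in> carrier Y" for y y'
      unfolding eval_form_fadd[symmetric]
      by (rule eval_form_cong) (use that u lin in \<open>auto simp: linear_form_def subset_iff\<close>)
    moreover have "eval_form (h (c \<odot>\<^bsub>Y\<^esub> y)) u = c * eval_form (h y) u" if "y \<in> carrier Y" for y c
      unfolding eval_form_fscale[symmetric]
      by (rule eval_form_cong) (use that u lin in \<open>auto simp: linear_form_def subset_iff\<close>)
    ultimately show ?thesis unfolding linear_form_def u(2) by (simp add: cls u(1) module.smult_closed[OF module_Y])
  qed
  have act: "?f (ract ?M x a) y = ?f x (lact Y a y)" "?f (lact ?M a x) y = ?f x (ract Y y a)"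
    if "x \<in> carrier ?M" "y \<in> carrier Y" "a \<in> carrier A" for x y a
  proof -
    from rep[OF that(1)] obtain u where u: "supp u \<subseteq> bar_gens A n"
      "x = rel.barcls n u" by blast
    have k: "supp (lin_ext (\<lambda>as. basis (butlast as @ [last as \<otimes> a]) :: _ \<Rightarrow>\<^sub>0 'k) u) \<subseteq> bar_gens A n"
      "supp (lin_ext (\<lambda>as. basis ((a \<otimes> hd as) # tl as) :: _ \<Rightarrow>\<^sub>0 'k) u) \<subseteq> bar_gens A n"
      by (rule lin_ext_keys[OF u(1)], simp add: rel.ract_gens rel.lact_gens that(3))+
    show "?f (ract ?M x a) y = ?f x (lact Y a y)"
      unfolding u(2) rel.rel_bar_ract_cls[OF that(3) u(1)]
      using u(1) that ract by (subst (1 2) cls)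
        (auto simp: k eval_form_lin_ext eval_form_simps lact_closed intro!: eval_form_cong)
    show "?f (lact ?M a x) y = ?f x (ract Y y a)"
      unfolding u(2) rel.rel_bar_lact_cls[OF that(3) u(1)]
      using u(1) that lact by (subst (1 2) cls)
        (auto simp: k eval_form_lin_ext eval_form_simps ract_closed intro!: eval_form_cong)
  qed
  from ch.bitensor_form[OF form_M form_Y act] obtain l where l: "linear_form (bitensor A ?M Y) l"
    "\<forall>x\<in>carrier ?M. \<forall>y\<in>carrier Y. l (ch.pure n x y) = ?f x y"
    by blast
  show ?thesis
  proof (intro exI conjI ballI)
    show "linear_form (C n) l" using l(1) by (simp add: hoch_chains_def)
    show "l (chain n as y) = h y as" if "as \<in> bar_gens A n" "y \<in> carrier Y" for as y
      using that l(2) rel.tensor_closed[OF that(1)] cls[of "basis as" y]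
      by (simp add: chain_def eval_form_simps del: rel_bar_sel)
  qed
qed

lemma hoch_diff_linear: "lin_map (C (Suc n)) (C n) (hoch_diff A S Y n)"
  and hoch_diff_pure: "x \<in> carrier (rel_bar A S (Suc n)) \<Longrightarrow> y \<in> carrier Y \<Longrightarrow>
    hoch_diff A S Y n (ch.pure (Suc n) x y) = ch.pure n (bar_diff A S n x) y"
proof -
  have "bitensor_product A (rel_bar A S (Suc n)) (restrict_bimodule id Y)"
    by (simp only: restrict_bimodule_id bitensor_product_chains)
  note * = this bitensor_product_chains[of n] rel.bar_diff_linear'[of n]
  have act: "bar_diff A S n (lact (rel_bar A S (Suc n)) a x) = lact (rel_bar A S n) (id a) (bar_diff A S n x)"
      "bar_diff A S n (ract (rel_bar A S (Suc n)) x a) = ract (rel_bar A S n) (bar_diff A S n x) (id a)"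
      "id a \<in> carrier A"
    if "a \<in> carrier A" "x \<in> carrier (rel_bar A S (Suc n))" for a x
    using rel.bar_diff_action[OF that] that(1) by simp_all
  show "lin_map (C (Suc n)) (C n) (hoch_diff A S Y n)"
    using bitensor_map_linear[OF * act(1,2)]
    by (simp add: restrict_bimodule_id[unfolded id_def] id_def hoch_diff_def hoch_chains_def)
  show "hoch_diff A S Y n (ch.pure (Suc n) x y) = ch.pure n (bar_diff A S n x) y"
    if "x \<in> carrier (rel_bar A S (Suc n))" "y \<in> carrier Y"
    using bitensor_map_pure[OF * act(1,2) _ that]
    by (simp add: restrict_bimodule_id[unfolded id_def] id_def hoch_diff_def)
qed

lemma hoch_diff_chain:
  "as \<in> bar_gens A (Suc n) \<Longrightarrow> y \<in> carrier Y \<Longrightarrow> hoch_diff A S Y n (chain (Suc n) as y) =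
    ch.pure n (rel.barcls n (rel.bar_boundary n as)) y"
  by (simp add: chain_def hoch_diff_pure rel.tensor_closed rel.bar_diff_tensor del: rel_bar_sel)

end

section \<open>Chains of degree at most two\<close>

lemma length_sum_1_cases:
  assumes "length xs + length ys = Suc 0"
  obtains p where "xs = []" "ys = [p]" | p where "xs = [p]" "ys = []"
  using assms by (cases xs; cases ys) auto

lemma length_sum_2_cases:
  assumes "length xs + length ys = Suc (Suc 0)"
  obtains p q where "xs = []" "ys = [p, q]" | p q where "xs = [p]" "ys = [q]"
    | p q where "xs = [p, q]" "ys = []"
  using assms by (cases xs; cases "tl xs"; cases ys; cases "tl ys") auto

text \<open>
  The shape that \<open>d \<circ> d = 0\<close> takes on a generator.
\<close>

lemma (in abelian_group) telescoping_differences: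
  assumes "p \<in> carrier G" "q \<in> carrier G" "r \<in> carrier G"
  shows "((p \<ominus> q) \<ominus> (p \<ominus> r)) \<oplus> (q \<ominus> r) = \<zero>"
proof -
  have "\<ominus> q \<oplus> (\<ominus> p \<oplus> r) = \<ominus> p \<oplus> (\<ominus> q \<oplus> r)" using assms by (simp add: a_lcomm)
  then have "(p \<ominus> q) \<ominus> (p \<ominus> r) = \<ominus> q \<oplus> r"
    using assms by (simp add: a_minus_def minus_add a_assoc r_neg2)
  moreover have "(\<ominus> q \<oplus> r) \<oplus> (q \<ominus> r) = \<ominus> q \<oplus> (q \<oplus> (r \<oplus> \<ominus> r))"
    using assms by (simp add: a_minus_def a_assoc a_lcomm)
  ultimately show ?thesis using assms by (simp add: r_neg l_neg)
qed

context relative_hochschild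
begin

abbreviation "chain0 y \<equiv> chain 0 [\<one>, \<one>] y"
abbreviation "chain1 a y \<equiv> chain (Suc 0) [\<one>, a, \<one>] y"
abbreviation "chain2 a b y \<equiv> chain (Suc (Suc 0)) [\<one>, a, b, \<one>] y"

lemma bar_gens_simps:
  "[\<one>, \<one>] \<in> bar_gens A 0"
  "a \<in> carrier A \<Longrightarrow> [\<one>, a, \<one>] \<in> bar_gens A (Suc 0)"
  "a \<in> carrier A \<Longrightarrow> b \<in> carrier A \<Longrightarrow> [\<one>, a, b, \<one>] \<in> bar_gens A (Suc (Suc 0))"
  by (simp_all add: bar_gens_def one_closed_A)

lemma chain_coeff_linear: "as \<in> bar_gens A n \<Longrightarrow> lin_map Y (C n) (chain n as)"
  by (rule lin_mapI, simp add: chain_closed)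
    (simp_all add: chain_def hoch_chains_def ch.pure_add_right ch.pure_smult_right rel.tensor_closed del: rel_bar_sel)

lemma chain1_linear:
  assumes "y \<in> carrier Y"
  shows "lin_map A C1 (\<lambda>a. chain1 a y)"
proof (rule lin_mapI)
  show "chain1 a y \<in> carrier C1" if "a \<in> carrier A" for a
    using that assms by (intro chain_closed bar_gens_simps)
  show "chain1 (a \<oplus> b) y = chain1 a y \<oplus>\<^bsub>C1\<^esub> chain1 b y"
    if "a \<in> carrier A" "b \<in> carrier A" for a b
    using rel.tensor_add[of "[\<one>]" "[\<one>]" a b "Suc 0"] that assms one_closed_A
    by (simp add: chain_def hoch_chains_def ch.pure_add_left rel.tensor_closed bar_gens_simps del: rel_bar_sel)
  show "chain1 (c \<odot> a) y = c \<odot>\<^bsub>C1\<^esub> chain1 a y" if "a \<in> carrier A" for a c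
    using rel.tensor_smult[of "[\<one>]" "[\<one>]" a "Suc 0" c] that assms one_closed_A
    by (simp add: chain_def hoch_chains_def ch.pure_smult_left rel.tensor_closed bar_gens_simps del: rel_bar_sel)
qed

lemma chain1_balanced:
  assumes "a \<in> carrier A" "s \<in> S" "y \<in> carrier Y"
  shows "chain1 (a \<otimes> s) y = chain1 a (lact Y s y)"
    and "chain1 (s \<otimes> a) y = chain1 a (ract Y y s)"
proof -
  have s: "s \<in> carrier A" using assms(2) base_subset by blast
  have "chain1 (a \<otimes> s) y = chain (Suc 0) [\<one>, a, s] y"
    using rel.tensor_bal[of "[\<one>]" "[]" a "\<one>" s "Suc 0"] assms s one_closed_A
    by (simp add: chain_def r_one_A)
  then show "chain1 (a \<otimes> s) y = chain1 a (lact Y s y)"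
    using chain_collapse[of "\<one>" s "[a]" "Suc 0" y] assms s one_closed_A by (simp add: ract_one)
  have "chain1 (s \<otimes> a) y = chain (Suc 0) [s, a, \<one>] y"
    using rel.tensor_bal[of "[]" "[\<one>]" "\<one>" a s "Suc 0"] assms s one_closed_A
    by (simp add: chain_def l_one_A)
  then show "chain1 (s \<otimes> a) y = chain1 a (ract Y y s)"
    using chain_collapse[of s "\<one>" "[a]" "Suc 0" y] assms s one_closed_A
    by (simp add: lact_one ract_closed)
qed

lemma pure_cls_add:
  "supp u \<subseteq> bar_gens A n \<Longrightarrow> supp v \<subseteq> bar_gens A n \<Longrightarrow> y \<in> carrier Y \<Longrightarrow>
    ch.pure n (rel.barcls n (u + v)) y =
    ch.pure n (rel.barcls n u) y \<oplus>\<^bsub>C n\<^esub> ch.pure n (rel.barcls n v) y"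
  using ch.pure_add_left[of "rel.barcls n u" n y "rel.barcls n v"]
  by (simp add: rel.bar.cls_add rel.bar.cls_closed hoch_chains_def)

lemma pure_cls_scale:
  "supp u \<subseteq> bar_gens A n \<Longrightarrow> y \<in> carrier Y \<Longrightarrow>
    ch.pure n (rel.barcls n (scale c u)) y =
    c \<odot>\<^bsub>C n\<^esub> ch.pure n (rel.barcls n u) y"
  using ch.pure_smult_left[of "rel.barcls n u" n y c]
  by (simp add: rel.bar.cls_scale rel.bar.cls_closed hoch_chains_def)

lemma m_closed_A: "a \<in> carrier A \<Longrightarrow> b \<in> carrier A \<Longrightarrow> a \<otimes> b \<in> carrier A"
  by (rule monoid.m_closed[OF ring.axioms(2)[OF rel.ring_A]])

text \<open>
  With outer entries moved into the coefficient, the differential is \<open>a \<otimes> y \<mapsto> y a - a y\<close>, and one degree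
  higher \<open>a \<otimes> b \<otimes> y \<mapsto> b \<otimes> y a - a b \<otimes> y + a \<otimes> b y\<close>. The vanishing of a form on the latter is the Leibniz rule.
\<close>

lemma diff_chain1:
  assumes "a \<in> carrier A" "y \<in> carrier Y"
  shows "hoch_diff A S Y 0 (chain1 a y) = chain0 (ract Y y a) \<ominus>\<^bsub>C 0\<^esub> chain0 (lact Y a y)"
proof -
  have g: "[a, \<one>] \<in> bar_gens A 0" "[\<one>, a] \<in> bar_gens A 0"
    using assms one_closed_A by (auto simp: bar_gens_def)
  have b: "rel.bar_boundary 0 [\<one>, a, \<one>] = basis [a, \<one>] + scale (- 1) (basis [\<one>, a])"
    using assms by (simp add: rel.bar_boundary_def l_one_A r_one_A scale_simps)
  have "hoch_diff A S Y 0 (chain1 a y) = chain 0 [a, \<one>] y \<oplus>\<^bsub>C 0\<^esub> (- 1) \<odot>\<^bsub>C 0\<^esub> chain 0 [\<one>, a] y"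
    using assms g
    by (simp add: hoch_diff_chain bar_gens_simps b pure_cls_add pure_cls_scale keys_subset)
      (simp add: chain_def)
  also have "chain 0 [a, \<one>] y = chain0 (ract Y y a)"
    using chain_collapse[of a "\<one>" "[]" 0 y] assms one_closed_A by (simp add: lact_one ract_closed)
  also have "chain 0 [\<one>, a] y = chain0 (lact Y a y)"
    using chain_collapse[of "\<one>" a "[]" 0 y] assms one_closed_A by (simp add: ract_one)
  finally show ?thesis
    using assms by (simp add: smult_minus_one[OF C_module] chain_closed bar_gens_simps lact_closed a_minus_def)
qed

lemma diff_chain2:
  assumes "a \<in> carrier A" "b \<in> carrier A" "y \<in> carrier Y"
  shows "hoch_diff A S Y (Suc 0) (chain2 a b y) =
    (chain1 b (ract Y y a) \<ominus>\<^bsub>C1\<^esub> chain1 (a \<otimes> b) y) \<oplus>\<^bsub>C1\<^esub> chain1 a (lact Y b y)"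
proof -
  have g: "[a, b, \<one>] \<in> bar_gens A (Suc 0)" "[\<one>, a \<otimes> b, \<one>] \<in> bar_gens A (Suc 0)"
      "[\<one>, a, b] \<in> bar_gens A (Suc 0)"
    using assms one_closed_A m_closed_A by (auto simp: bar_gens_def)
  have b: "rel.bar_boundary (Suc 0) [\<one>, a, b, \<one>] =
      (basis [a, b, \<one>] + scale (- 1) (basis [\<one>, a \<otimes> b, \<one>])) + basis [\<one>, a, b]"
    using assms by (simp add: rel.bar_boundary_def l_one_A r_one_A scale_simps)
  have "hoch_diff A S Y (Suc 0) (chain2 a b y) =
      (chain (Suc 0) [a, b, \<one>] y \<oplus>\<^bsub>C1\<^esub> (- 1) \<odot>\<^bsub>C1\<^esub> chain1 (a \<otimes> b) y) \<oplus>\<^bsub>C1\<^esub>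
        chain (Suc 0) [\<one>, a, b] y"
    using assms g
    by (simp add: hoch_diff_chain bar_gens_simps b pure_cls_add pure_cls_scale keys_subset)
      (simp add: chain_def)
  also have "chain (Suc 0) [a, b, \<one>] y = chain1 b (ract Y y a)"
    using chain_collapse[of a "\<one>" "[b]" "Suc 0" y] assms one_closed_A by (simp add: lact_one ract_closed)
  also have "chain (Suc 0) [\<one>, a, b] y = chain1 a (lact Y b y)"
    using chain_collapse[of "\<one>" b "[a]" "Suc 0" y] assms one_closed_A by (simp add: ract_one)
  finally show ?thesis
    using assms by (simp add: smult_minus_one[OF C_module] chain_closed g a_minus_def)
qed

lemma diff_diff:
  assumes "z \<in> carrier (C (Suc (Suc 0)))"
  shows "hoch_diff A S Y 0 (hoch_diff A S Y (Suc 0) z) = \<zero>\<^bsub>C 0\<^esub>"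
proof -
  interpret C0: Module.module ground "C 0" by (rule C_module)
  have d0: "lin_map C1 (C 0) (hoch_diff A S Y 0)" by (rule hoch_diff_linear)
  have lin: "lin_map (C (Suc (Suc 0))) (C 0) (\<lambda>z. hoch_diff A S Y 0 (hoch_diff A S Y (Suc 0) z))"
    by (rule lin_map_comp[OF hoch_diff_linear hoch_diff_linear])
  have zero: "lin_map (C (Suc (Suc 0))) (C 0) (\<lambda>z. \<zero>\<^bsub>C 0\<^esub>)"
    by (rule lin_mapI) (simp_all add: C0.smult_r_null)
  show ?thesis
  proof (rule chain_lin_map_eqI[OF C_module lin zero _ assms])
    fix as y assume as: "set as \<subseteq> carrier A" "length as = Suc (Suc 0)" and y: "y \<in> carrier Y"
    then obtain a b where ab: "as = [a, b]" "a \<in> carrier A" "b \<in> carrier A"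
      by (auto simp: length_Suc_conv)
    have c: "chain1 b (ract Y y a) \<in> carrier C1" "chain1 (a \<otimes> b) y \<in> carrier C1"
      "chain1 a (lact Y b y) \<in> carrier C1"
      using ab y by (simp_all add: chain_closed bar_gens_simps m_closed_A ract_closed lact_closed)
    interpret C1: Module.module ground "C1" by (rule C_module)
    let ?p = "chain0 (ract Y y (a \<otimes> b))" and ?q = "chain0 (lact Y b (ract Y y a))"
      and ?r = "chain0 (lact Y (a \<otimes> b) y)"
    have cl: "?p \<in> carrier (C 0)" "?q \<in> carrier (C 0)" "?r \<in> carrier (C 0)"
      using ab y by (simp_all add: chain_closed bar_gens_simps m_closed_A ract_closed lact_closed)
    have "hoch_diff A S Y 0 (hoch_diff A S Y (Suc 0) (chain2 a b y)) =
       ((?p \<ominus>\<^bsub>C 0\<^esub> ?q) \<ominus>\<^bsub>C 0\<^esub> (?p \<ominus>\<^bsub>C 0\<^esub> ?r)) \<oplus>\<^bsub>C 0\<^esub> (?q \<ominus>\<^bsub>C 0\<^esub> ?r)"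
      using ab y c
      by (simp add: diff_chain2 diff_chain1 lin_mapD[OF d0] lin_map_minus[OF C_module C_module d0]
          m_closed_A ract_closed lact_closed ract_mult lact_mult lact_ract)
    also have "\<dots> = \<zero>\<^bsub>C 0\<^esub>"
      using cl by (rule abelian_group.telescoping_differences[OF C0.abelian_group_axioms])
    finally show "hoch_diff A S Y 0 (hoch_diff A S Y (Suc 0) (chain (Suc (Suc 0)) (\<one> # as @ [\<one>]) y)) = \<zero>\<^bsub>C 0\<^esub>"
      by (simp add: ab)
  qed
qed

text \<open>
  Sending \<open>a\<^sub>0 \<otimes> a \<otimes> a\<^sub>1 \<otimes> y\<close> to \<open>r a (a\<^sub>1 y a\<^sub>0)\<close> makes the outer actions pass to the coefficient by
  construction, so only bilinearity and the balancing over \<open>S\<close> are left to require.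
\<close>

lemma chain1_form:
  fixes r :: "'a \<Rightarrow> 'y \<Rightarrow> 'k"
  assumes lin: "\<And>a. a \<in> carrier A \<Longrightarrow> linear_form Y (r a)" "\<And>y. y \<in> carrier Y \<Longrightarrow> linear_form A (\<lambda>a. r a y)"
    and bal: "\<And>a s y. a \<in> carrier A \<Longrightarrow> s \<in> S \<Longrightarrow> y \<in> carrier Y \<Longrightarrow> r (a \<otimes> s) y = r a (lact Y s y)"
      "\<And>a s y. a \<in> carrier A \<Longrightarrow> s \<in> S \<Longrightarrow> y \<in> carrier Y \<Longrightarrow> r (s \<otimes> a) y = r a (ract Y y s)"
  shows "\<exists>l. linear_form C1 l \<and> (\<forall>a\<in>carrier A. \<forall>y\<in>carrier Y. l (chain1 a y) = r a y)"
proof -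
  let ?h = "\<lambda>y as. r (as ! 1) (lact Y (as ! 2) (ract Y y (as ! 0)))"
  note lin' = lin[unfolded linear_form_def]
  note clos = lact_closed ract_closed m_closed_A
  have gens: "\<exists>p a q. as = [p, a, q] \<and> p \<in> carrier A \<and> a \<in> carrier A \<and> q \<in> carrier A"
    if "as \<in> bar_gens A (Suc 0)" for as
    using that by (auto simp: bar_gens_def length_Suc_conv)
  have rels: "eval_form (?h y) u = 0" if y: "y \<in> carrier Y" and u: "u \<in> bar_rels A S (Suc 0)" for y u
    using u
  proof (cases rule: rel.bar_rels_cases)
    case (add xs a b ys)
    from add(6) have "length xs + length ys = Suc (Suc 0)" by simp
    then show ?thesis
      by (cases rule: length_sum_2_cases)
        (use add(2-5) lin' y in \<open>simp_all add: add(1) eval_form_simps clos lact_add ract_add add_lact add_ract\<close>)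
  next
    case (smult xs c a ys)
    from smult(5) have "length xs + length ys = Suc (Suc 0)" by simp
    then show ?thesis
      by (cases rule: length_sum_2_cases)
        (use smult(2-4) lin' y in \<open>simp_all add: smult(1) eval_form_simps clos lact_smult ract_smult smult_lact smult_ract\<close>)
  next
    case (bal xs a s b ys)
    have s: "s \<in> carrier A" using bal(6) base_subset by blast
    from bal(7) show ?thesis
      by (cases rule: length_sum_1_cases)
        (use bal(2-5) \<open>s \<in> S\<close> s assms(3,4) y in \<open>simp_all add: bal(1) eval_form_simps clos lact_mult ract_mult lact_ract\<close>)
  qed
  have "\<exists>l. linear_form C1 l \<and> (\<forall>as\<in>bar_gens A (Suc 0). \<forall>y\<in>carrier Y. l (chain (Suc 0) as y) = ?h y as)"
  proof (rule chain_form[OF rels])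
    fix as assume "as \<in> bar_gens A (Suc 0)"
    from gens[OF this] obtain p a q where as: "as = [p, a, q]" "p \<in> carrier A" "a \<in> carrier A" "q \<in> carrier A" by blast
    show "linear_form Y (\<lambda>y. ?h y as)"
      using as lin' by (simp add: linear_form_def clos lact_add ract_add lact_smult ract_smult)
    show "?h y (butlast as @ [last as \<otimes> c]) = ?h (lact Y c y) as"
      "?h y ((c \<otimes> hd as) # tl as) = ?h (ract Y y c) as"
      if "c \<in> carrier A" "y \<in> carrier Y" for c y
      using as that by (simp_all add: clos lact_mult ract_mult lact_ract)
  qed
  then show ?thesis
    by (auto simp: bar_gens_simps lact_one ract_one one_closed_A)
qed

lemma chain0_form:
  fixes g :: "'y \<Rightarrow> 'k"
  assumes lin: "linear_form Y g"
    and bal: "\<And>s y. s \<in> S \<Longrightarrow> y \<in> carrier Y \<Longrightarrow> g (lact Y s y) = g (ract Y y s)"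
  shows "\<exists>l. linear_form (C 0) l \<and> (\<forall>y\<in>carrier Y. l (chain0 y) = g y)"
proof -
  let ?h = "\<lambda>y as. g (lact Y (as ! 1) (ract Y y (as ! 0)))"
  note lin' = lin[unfolded linear_form_def]
  note clos = lact_closed ract_closed m_closed_A
  have gens: "\<exists>p q. as = [p, q] \<and> p \<in> carrier A \<and> q \<in> carrier A" if "as \<in> bar_gens A 0" for as
    using that by (auto simp: bar_gens_def length_Suc_conv numeral_2_eq_2)
  have rels: "eval_form (?h y) u = 0" if y: "y \<in> carrier Y" and u: "u \<in> bar_rels A S 0" for y u
    using u
  proof (cases rule: rel.bar_rels_cases)
    case (add xs a b ys)
    from add(6) have "length xs + length ys = Suc 0" by simp
    then show ?thesis
      by (cases rule: length_sum_1_cases)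
        (use add(2-5) lin' y in \<open>simp_all add: add(1) eval_form_simps clos lact_add ract_add add_lact add_ract\<close>)
  next
    case (smult xs c a ys)
    from smult(5) have "length xs + length ys = Suc 0" by simp
    then show ?thesis
      by (cases rule: length_sum_1_cases)
        (use smult(2-4) lin' y in \<open>simp_all add: smult(1) eval_form_simps clos lact_smult ract_smult smult_lact smult_ract\<close>)
  next
    case (bal xs a s b ys)
    have s: "s \<in> carrier A" using bal(6) base_subset by blast
    from bal(7) have "xs = []" "ys = []" by auto
    then show ?thesis
      using bal(4,5) \<open>s \<in> S\<close> s assms(2)[of s "lact Y b (ract Y y a)"] y
      by (simp add: bal(1) eval_form_simps clos lact_mult ract_mult lact_ract)
  qed
  have "\<exists>l. linear_form (C 0) l \<and> (\<forall>as\<in>bar_gens A 0. \<forall>y\<in>carrier Y. l (chain 0 as y) = ?h y as)"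
  proof (rule chain_form[OF rels])
    fix as assume "as \<in> bar_gens A 0"
    from gens[OF this] obtain p q where as: "as = [p, q]" "p \<in> carrier A" "q \<in> carrier A" by blast
    show "linear_form Y (\<lambda>y. ?h y as)"
      using as lin' by (simp add: linear_form_def clos lact_add ract_add lact_smult ract_smult)
    show "?h y (butlast as @ [last as \<otimes> c]) = ?h (lact Y c y) as"
      "?h y ((c \<otimes> hd as) # tl as) = ?h (ract Y y c) as"
      if "c \<in> carrier A" "y \<in> carrier Y" for c y
      using as that by (simp_all add: clos lact_mult ract_mult lact_ract)
  qed
  then show ?thesis
    by (auto simp: bar_gens_simps lact_one ract_one one_closed_A)
qed

lemma chain1_form_eqI:
  assumes "linear_form C1 f" "linear_form C1 g"
    and "\<And>a y. a \<in> carrier A \<Longrightarrow> y \<in> carrier Y \<Longrightarrow> f (chain1 a y) = g (chain1 a y)"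
    and "z \<in> carrier C1"
  shows "f z = g z"
  by (rule chain_form_eqI[OF assms(1,2) _ assms(4)]) (use assms(3) in \<open>auto simp: length_Suc_conv\<close>)

lemma chain0_form_eqI:
  assumes "linear_form (C 0) f" "linear_form (C 0) g"
    and "\<And>y. y \<in> carrier Y \<Longrightarrow> f (chain0 y) = g (chain0 y)"
    and "z \<in> carrier (C 0)"
  shows "f z = g z"
  by (rule chain_form_eqI[OF assms(1,2) _ assms(4)]) (use assms(3) in auto)

lemma chain0_surj:
  assumes "z \<in> carrier (C 0)"
  shows "\<exists>y\<in>carrier Y. z = chain0 y"
proof -
  have "z \<in> chain0 ` carrier Y"
    by (rule chain_submodule[OF submodule_image[OF module_Y C_module chain_coeff_linear
          submodule_carrier[OF module_Y]] _ assms]) (auto simp: bar_gens_simps)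
  then show ?thesis by blast
qed

lemma leibniz_form_boundaries:
  assumes l: "linear_form C1 l" and leibniz: "\<And>a b y. a \<in> carrier A \<Longrightarrow> b \<in> carrier A \<Longrightarrow> y \<in> carrier Y \<Longrightarrow>
      l (chain1 (a \<otimes> b) y) = l (chain1 b (ract Y y a)) + l (chain1 a (lact Y b y))"
    and z: "z \<in> hoch_boundaries A S Y (Suc 0)"
  shows "l z = 0"
proof -
  interpret C1: Module.module ground "C1" by (rule C_module)
  obtain x where x: "x \<in> carrier (C (Suc (Suc 0)))" "z = hoch_diff A S Y (Suc 0) x"
    using z by (auto simp: hoch_boundaries_def)
  have form: "linear_form (C (Suc (Suc 0))) (\<lambda>x. l (hoch_diff A S Y (Suc 0) x))"
    by (rule linear_form_comp[OF hoch_diff_linear l])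
  have form0: "linear_form (C (Suc (Suc 0))) (\<lambda>x. 0)" by (simp add: linear_form_def)
  have "l (hoch_diff A S Y (Suc 0) x) = 0"
  proof (rule chain_form_eqI[OF form form0 _ x(1)])
    fix as y assume as: "set as \<subseteq> carrier A" "length as = Suc (Suc 0)" and y: "y \<in> carrier Y"
    then obtain a b where ab: "as = [a, b]" "a \<in> carrier A" "b \<in> carrier A"
      by (auto simp: length_Suc_conv)
    have c: "chain1 b (ract Y y a) \<in> carrier C1" "chain1 (a \<otimes> b) y \<in> carrier C1"
      "chain1 a (lact Y b y) \<in> carrier C1"
      using ab y by (simp_all add: chain_closed bar_gens_simps m_closed_A ract_closed lact_closed)
    then show "l (hoch_diff A S Y (Suc 0) (chain (Suc (Suc 0)) (\<one> # as @ [\<one>]) y)) = 0"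
      using ab y l leibniz[of a b y]
      by (simp add: diff_chain2 linear_form_minus[OF C_module l])
        (simp add: linear_form_def linear_form_minus[OF C_module l])
  qed
  then show ?thesis using x by simp
qed

lemma boundary_form_leibniz:
  assumes l: "linear_form C1 l" and B: "\<And>z. z \<in> hoch_boundaries A S Y (Suc 0) \<Longrightarrow> l z = 0"
    and ab: "a \<in> carrier A" "b \<in> carrier A" "y \<in> carrier Y"
  shows "l (chain1 (a \<otimes> b) y) = l (chain1 b (ract Y y a)) + l (chain1 a (lact Y b y))"
proof -
  interpret C1: Module.module ground "C1" by (rule C_module)
  have c: "chain1 b (ract Y y a) \<in> carrier C1" "chain1 (a \<otimes> b) y \<in> carrier C1"
    "chain1 a (lact Y b y) \<in> carrier C1"
    using ab by (simp_all add: chain_closed bar_gens_simps m_closed_A ract_closed lact_closed)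
  have "hoch_diff A S Y (Suc 0) (chain2 a b y) \<in> hoch_boundaries A S Y (Suc 0)"
    unfolding hoch_boundaries_def using ab by (intro imageI chain_closed bar_gens_simps)
  then have "l (hoch_diff A S Y (Suc 0) (chain2 a b y)) = 0" by (rule B)
  then show ?thesis
    using ab c l
    by (simp add: diff_chain2 linear_form_def linear_form_minus[OF C_module l]) (simp add: algebra_simps)
qed

end

section \<open>First homology and induced maps\<close>

declare hoch_cycles.simps(2) [simp del]

context relative_hochschild
begin

abbreviation "cycles1 \<equiv> hoch_cycles A S Y (Suc 0)"
abbreviation "boundaries1 \<equiv> hoch_boundaries A S Y (Suc 0)"

definition hclass :: "(('a list \<Rightarrow>\<^sub>0 'k) set \<times> 'y \<Rightarrow>\<^sub>0 'k) set \<Rightarrow> (('a list \<Rightarrow>\<^sub>0 'k) set \<times> 'y \<Rightarrow>\<^sub>0 'k) set set" where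
  "hclass z = boundaries1 +>\<^bsub>C1\<^esub> z"

lemma cycles1_iff: "z \<in> cycles1 \<longleftrightarrow> z \<in> carrier C1 \<and> hoch_diff A S Y 0 z = \<zero>\<^bsub>C 0\<^esub>"
  by (auto simp: hoch_cycles.simps(2) a_kernel_def')

lemma cycles1_submodule: "submodule cycles1 ground C1"
proof (rule k_submoduleI[OF C_module])
  interpret C0: Module.module ground "C 0" by (rule C_module)
  interpret C1: Module.module ground "C1" by (rule C_module)
  have d: "lin_map C1 (C 0) (hoch_diff A S Y 0)" by (rule hoch_diff_linear)
  show "\<zero>\<^bsub>C1\<^esub> \<in> cycles1"
    using lin_map_zero[OF C_module C_module d] C1.zero_closed by (simp add: cycles1_iff)
  show "x \<oplus>\<^bsub>C1\<^esub> y \<in> cycles1" if "x \<in> cycles1" "y \<in> cycles1" for x y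
    using that C1.a_closed by (simp add: cycles1_iff lin_mapD[OF d])
  show "c \<odot>\<^bsub>C1\<^esub> x \<in> cycles1" if "x \<in> cycles1" for c x
    using that C1.smult_closed C0.smult_r_null
    by (simp add: cycles1_iff lin_mapD[OF d])
qed (auto simp: cycles1_iff)

lemma boundaries1_submodule: "submodule boundaries1 ground C1"
  unfolding hoch_boundaries_def
  by (rule submodule_image[OF C_module C_module hoch_diff_linear submodule_carrier[OF C_module]])

lemma boundaries1_cycles1: "boundaries1 \<subseteq> cycles1"
  unfolding hoch_boundaries_def
  by (auto simp: cycles1_iff diff_diff lin_mapD(1)[OF hoch_diff_linear])

lemma cycles1_module: "Module.module ground (C1\<lparr>carrier := cycles1\<rparr>)"
  by (rule submodule.submodule_is_module[OF cycles1_submodule C_module])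

lemma quotient_space_homology: "quotient_space (C1\<lparr>carrier := cycles1\<rparr>) boundaries1"
proof (intro quotient_space.intro quotient_space_axioms.intro cycles1_module)
  show "submodule boundaries1 ground (C1\<lparr>carrier := cycles1\<rparr>)"
    using k_submoduleD[OF boundaries1_submodule] boundaries1_cycles1
    by (intro k_submoduleI cycles1_module) (simp_all)
qed

lemma coset_cycles: "boundaries1 +>\<^bsub>C1\<lparr>carrier := cycles1\<rparr>\<^esub> z = hclass z"
  by (simp add: hclass_def a_r_coset_def')

abbreviation "H1 \<equiv> rel_hochschild A S Y (Suc 0)"

lemma H1_module: "Module.module ground H1"
  unfolding rel_hochschild_def by (rule quotient_space.quot_space_module[OF quotient_space_homology])

lemma carrier_H1: "carrier H1 = hclass ` cycles1"
  using quotient_space.quot_space_sel(1)[OF quotient_space_homology]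
  by (simp add: rel_hochschild_def coset_cycles)

lemma hclass_add: "x \<in> cycles1 \<Longrightarrow> y \<in> cycles1 \<Longrightarrow> hclass (x \<oplus>\<^bsub>C1\<^esub> y) = hclass x \<oplus>\<^bsub>H1\<^esub> hclass y"
  using quotient_space.coset_add[OF quotient_space_homology, of x y]
  by (simp add: rel_hochschild_def coset_cycles)

lemma hclass_smult: "x \<in> cycles1 \<Longrightarrow> hclass (c \<odot>\<^bsub>C1\<^esub> x) = c \<odot>\<^bsub>H1\<^esub> hclass x"
  using quotient_space.coset_smult[OF quotient_space_homology, of x c]
  by (simp add: rel_hochschild_def coset_cycles)

lemma hclass_zero_iff: "x \<in> cycles1 \<Longrightarrow> hclass x = \<zero>\<^bsub>H1\<^esub> \<longleftrightarrow> x \<in> boundaries1"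
  using quotient_space.coset_eq_self_iff[OF quotient_space_homology, of x]
    quotient_space.quot_space_sel(2)[OF quotient_space_homology]
  by (simp add: rel_hochschild_def coset_cycles)

lemma hclass_eqI:
  assumes "x \<in> cycles1" "y \<in> cycles1" "x \<ominus>\<^bsub>C1\<^esub> y \<in> boundaries1"
  shows "hclass x = hclass y"
proof -
  interpret C1: Module.module ground "C1" by (rule C_module)
  interpret H: Module.module ground H1 by (rule H1_module)
  have cl: "x \<in> carrier C1" "y \<in> carrier C1"
    using assms by (auto simp: cycles1_iff)
  have m: "x \<ominus>\<^bsub>C1\<^esub> y \<in> cycles1" using assms(3) boundaries1_cycles1 by (rule rev_subsetD)
  have "x = (x \<ominus>\<^bsub>C1\<^esub> y) \<oplus>\<^bsub>C1\<^esub> y"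
    using cl by (simp add: a_minus_def C1.a_assoc C1.l_neg)
  then have "hclass x = hclass (x \<ominus>\<^bsub>C1\<^esub> y) \<oplus>\<^bsub>H1\<^esub> hclass y"
    using hclass_add[OF m assms(2)] by simp
  also have "hclass (x \<ominus>\<^bsub>C1\<^esub> y) = \<zero>\<^bsub>H1\<^esub>"
    using hclass_zero_iff[OF m] assms(3) by simp
  also have "\<zero>\<^bsub>H1\<^esub> \<oplus>\<^bsub>H1\<^esub> hclass y = hclass y"
    using assms(2) by (intro H.l_zero) (simp add: carrier_H1)
  finally show ?thesis .
qed

end

definition algebra_map ::
  "('k::field, 'a, 'm) module_scheme \<Rightarrow> ('k, 'b, 'n) module_scheme \<Rightarrow> ('a \<Rightarrow> 'b) \<Rightarrow> bool" where
  "algebra_map A A' \<phi> \<longleftrightarrow> \<phi> \<in> ring_hom A A' \<and> (\<forall>c. \<forall>x\<in>carrier A. \<phi> (c \<odot>\<^bsub>A\<^esub> x) = c \<odot>\<^bsub>A'\<^esub> \<phi> x)"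

lemma algebra_mapD:
  assumes "algebra_map A A' \<phi>"
  shows "x \<in> carrier A \<Longrightarrow> \<phi> x \<in> carrier A'"
    and "x \<in> carrier A \<Longrightarrow> y \<in> carrier A \<Longrightarrow> \<phi> (x \<oplus>\<^bsub>A\<^esub> y) = \<phi> x \<oplus>\<^bsub>A'\<^esub> \<phi> y"
    and "x \<in> carrier A \<Longrightarrow> y \<in> carrier A \<Longrightarrow> \<phi> (x \<otimes>\<^bsub>A\<^esub> y) = \<phi> x \<otimes>\<^bsub>A'\<^esub> \<phi> y"
    and "\<phi> \<one>\<^bsub>A\<^esub> = \<one>\<^bsub>A'\<^esub>"
    and "x \<in> carrier A \<Longrightarrow> \<phi> (c \<odot>\<^bsub>A\<^esub> x) = c \<odot>\<^bsub>A'\<^esub> \<phi> x"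
  using assms by (auto simp: algebra_map_def ring_hom_def)

locale relative_hochschild_map =
  src: relative_hochschild A "restrict_bimodule \<phi> Y" S + tgt: relative_hochschild A' Y S'
  for A :: "('k::field, 'a, 'm) module_scheme" and A' :: "('k, 'b, 'n) module_scheme"
    and \<phi> :: "'a \<Rightarrow> 'b" and Y :: "('k, 'y, 'b) bimodule" and S :: "'a set" and S' :: "'b set" +
  assumes alg: "algebra_map A A' \<phi>"
    and base: "s \<in> S \<Longrightarrow> \<phi> s \<in> S'"
begin

abbreviation "barmap n \<equiv> presented_map (bar_gens A' n) (bar_rels A' S' n) (\<lambda>as. basis (map \<phi> as))"
definition chainmap ::
  "nat \<Rightarrow> (('a list \<Rightarrow>\<^sub>0 'k) set \<times> 'y \<Rightarrow>\<^sub>0 'k) set \<Rightarrow> (('b list \<Rightarrow>\<^sub>0 'k) set \<times> 'y \<Rightarrow>\<^sub>0 'k) set" where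
  "chainmap n = bitensor_map A' (rel_bar A' S' n) Y (barmap n)"

abbreviation "chainmap1 \<equiv> chainmap (Suc 0)"

lemma map_gens: "as \<in> bar_gens A n \<Longrightarrow> map \<phi> as \<in> bar_gens A' n"
  using algebra_mapD(1)[OF alg] by (auto simp: bar_gens_def subset_iff)

lemma map_rels: "r \<in> bar_rels A S n \<Longrightarrow> lin_ext (\<lambda>as. basis (map \<phi> as)) r \<in> tgt.rel.span n"
proof -
  have cl: "\<phi> ` set xs \<subseteq> carrier A'" if "set xs \<subseteq> carrier A" for xs
    using that algebra_mapD(1)[OF alg] by auto
  assume "r \<in> bar_rels A S n"
  then show ?thesis
  proof (cases rule: src.rel.bar_rels_cases)
    case (add xs a b ys)
    then show ?thesis
      using tgt.rel.bar_rels_add[of "map \<phi> xs" "map \<phi> ys" "\<phi> a" "\<phi> b" n] cl[of xs] cl[of ys]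
      by (simp add: lin_ext_minus algebra_mapD[OF alg] tgt.rel.bar.relspan_rel)
  next
    case (smult xs c a ys)
    then show ?thesis
      using tgt.rel.bar_rels_smult[of "map \<phi> xs" "map \<phi> ys" "\<phi> a" n c] cl[of xs] cl[of ys]
      by (simp add: lin_ext_minus lin_ext_scale algebra_mapD[OF alg] tgt.rel.bar.relspan_rel)
  next
    case (bal xs a s b ys)
    have "s \<in> carrier A" using src.base_subset bal(6) by (rule subsetD)
    with bal show ?thesis
      using tgt.rel.bar_rels_bal[of "map \<phi> xs" "map \<phi> ys" "\<phi> a" "\<phi> b" "\<phi> s" n] cl[of xs] cl[of ys] base
      by (simp add: lin_ext_minus algebra_mapD[OF alg] tgt.rel.bar.relspan_rel)
  qed
qed

lemma barmap_cls: "supp x \<subseteq> bar_gens A n \<Longrightarrow>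
    barmap n (src.rel.barcls n x) =
    tgt.rel.barcls n (lin_ext (\<lambda>as. basis (map \<phi> as)) x)"
  by (rule src.rel.bar.presented_map_cls[OF tgt.rel.bar_presentation _ map_rels])
    (simp_all add: map_gens)

lemma barmap_tensor: "as \<in> bar_gens A n \<Longrightarrow> barmap n (src.rel.tensor n as) = tgt.rel.tensor n (map \<phi> as)"
  using barmap_cls[of "basis as" n] by simp

lemma barmap_linear: "lin_map (rel_bar A S n) (rel_bar A' S' n) (barmap n)"
proof (rule lin_map_transfer)
  show "lin_map (src.rel.bar_space n) (tgt.rel.bar_space n) (barmap n)"
    by (rule src.rel.bar.presented_map_linear[OF tgt.rel.bar_presentation _ map_rels])
      (simp_all add: map_gens)
qed simp_all

lemma barmap_action:
  assumes a: "a \<in> carrier A" and x: "x \<in> carrier (rel_bar A S n)"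
  shows "barmap n (lact (rel_bar A S n) a x) = lact (rel_bar A' S' n) (\<phi> a) (barmap n x)"
    and "barmap n (ract (rel_bar A S n) x a) = ract (rel_bar A' S' n) (barmap n x) (\<phi> a)"
proof -
  have a': "\<phi> a \<in> carrier A'" using a by (rule algebra_mapD(1)[OF alg])
  have hd_last: "\<phi> (a \<otimes>\<^bsub>A\<^esub> hd as) = \<phi> a \<otimes>\<^bsub>A'\<^esub> hd (map \<phi> as)"
      "\<phi> (last as \<otimes>\<^bsub>A\<^esub> a) = last (map \<phi> as) \<otimes>\<^bsub>A'\<^esub> \<phi> a"
    if "as \<in> bar_gens A n" for as
  proof -
    from that have "as \<noteq> []" "set as \<subseteq> carrier A" by (auto simp: bar_gens_def)
    then have "as \<noteq> []" "hd as \<in> carrier A" "last as \<in> carrier A"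
      using hd_in_set[of as] last_in_set[of as] by auto
    then show "\<phi> (a \<otimes>\<^bsub>A\<^esub> hd as) = \<phi> a \<otimes>\<^bsub>A'\<^esub> hd (map \<phi> as)"
      "\<phi> (last as \<otimes>\<^bsub>A\<^esub> a) = last (map \<phi> as) \<otimes>\<^bsub>A'\<^esub> \<phi> a"
      using a by (simp_all add: algebra_mapD(3)[OF alg] hd_map last_map)
  qed
  show "barmap n (lact (rel_bar A S n) a x) = lact (rel_bar A' S' n) (\<phi> a) (barmap n x)"
  proof (rule src.rel.rel_bar_eqI[OF tgt.rel.rel_bar_module _ _ _ x])
    show "lin_map (rel_bar A S n) (rel_bar A' S' n)
        (\<lambda>x. barmap n (lact (rel_bar A S n) a x))"
      by (intro lin_map_comp[OF src.rel.rel_bar_lact_linear[OF a] barmap_linear])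
    show "lin_map (rel_bar A S n) (rel_bar A' S' n)
        (\<lambda>x. lact (rel_bar A' S' n) (\<phi> a) (barmap n x))"
      by (intro lin_map_comp[OF barmap_linear tgt.rel.rel_bar_lact_linear[OF a']])
    fix as assume as: "as \<in> bar_gens A n"
    show "barmap n (lact (rel_bar A S n) a (src.rel.tensor n as)) =
        lact (rel_bar A' S' n) (\<phi> a) (barmap n (src.rel.tensor n as))"
      using hd_last[OF as]
      by (simp only: src.rel.lact_tensor[OF a as] barmap_tensor as src.rel.lact_gens[OF a as]
          tgt.rel.lact_tensor[OF a' map_gens[OF as]] list.map map_tl)
  qed
  show "barmap n (ract (rel_bar A S n) x a) = ract (rel_bar A' S' n) (barmap n x) (\<phi> a)"
  proof (rule src.rel.rel_bar_eqI[OF tgt.rel.rel_bar_module _ _ _ x])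
    show "lin_map (rel_bar A S n) (rel_bar A' S' n)
        (\<lambda>x. barmap n (ract (rel_bar A S n) x a))"
      by (intro lin_map_comp[OF src.rel.rel_bar_ract_linear[OF a] barmap_linear])
    show "lin_map (rel_bar A S n) (rel_bar A' S' n)
        (\<lambda>x. ract (rel_bar A' S' n) (barmap n x) (\<phi> a))"
      by (intro lin_map_comp[OF barmap_linear tgt.rel.rel_bar_ract_linear[OF a']])
    fix as assume as: "as \<in> bar_gens A n"
    show "barmap n (ract (rel_bar A S n) (src.rel.tensor n as) a) =
        ract (rel_bar A' S' n) (barmap n (src.rel.tensor n as)) (\<phi> a)"
      using hd_last[OF as]
      by (simp only: src.rel.ract_tensor[OF a as] barmap_tensor as src.rel.ract_gens[OF a as]
          tgt.rel.ract_tensor[OF a' map_gens[OF as]] list.map map_append map_butlast)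
  qed
qed

lemma chainmap_linear: "lin_map (src.C n) (tgt.C n) (chainmap n)"
  unfolding hoch_chains_def chainmap_def
  by (rule bitensor_map_linear[OF src.bitensor_product_chains tgt.bitensor_product_chains barmap_linear
        barmap_action algebra_mapD(1)[OF alg]])

lemma chainmap_pure:
  "x \<in> carrier (rel_bar A S n) \<Longrightarrow> y \<in> carrier Y \<Longrightarrow>
    chainmap n (src.ch.pure n x y) = tgt.ch.pure n (barmap n x) y"
  unfolding chainmap_def
  by (rule bitensor_map_pure[OF src.bitensor_product_chains tgt.bitensor_product_chains barmap_linear
        barmap_action algebra_mapD(1)[OF alg]])

lemma chainmap_chain:
  "as \<in> bar_gens A n \<Longrightarrow> y \<in> carrier Y \<Longrightarrow> chainmap n (src.chain n as y) = tgt.chain n (map \<phi> as) y"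
  by (simp add: src.chain_def tgt.chain_def chainmap_pure src.rel.tensor_closed barmap_tensor del: rel_bar_sel)

lemma chainmap_diff:
  assumes "z \<in> carrier (src.C (Suc n))"
  shows "chainmap n (hoch_diff A S (restrict_bimodule \<phi> Y) n z) = hoch_diff A' S' Y n (chainmap (Suc n) z)"
proof (rule src.chain_lin_map_eqI[OF tgt.C_module _ _ _ assms])
  show "lin_map (src.C (Suc n)) (tgt.C n) (\<lambda>z. chainmap n (hoch_diff A S (restrict_bimodule \<phi> Y) n z))"
    by (rule lin_map_comp[OF src.hoch_diff_linear chainmap_linear])
  show "lin_map (src.C (Suc n)) (tgt.C n) (\<lambda>z. hoch_diff A' S' Y n (chainmap (Suc n) z))"
    by (rule lin_map_comp[OF chainmap_linear tgt.hoch_diff_linear])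
  fix as y assume as: "set as \<subseteq> carrier A" "length as = Suc n" and y: "y \<in> carrier (restrict_bimodule \<phi> Y)"
  let ?as = "\<one>\<^bsub>A\<^esub> # as @ [\<one>\<^bsub>A\<^esub>]"
  have g: "?as \<in> bar_gens A (Suc n)" using as src.one_closed_A by (auto simp: bar_gens_def)
  have k: "supp (src.rel.bar_boundary n ?as) \<subseteq> bar_gens A n"
    by (rule src.rel.bar_boundary_keys[OF g])
  then have c: "src.rel.barcls n (src.rel.bar_boundary n ?as) \<in> carrier (rel_bar A S n)"
    by (simp add: src.rel.bar.cls_closed)
  have "bar_merge A' i (map \<phi> ?as) = map \<phi> (bar_merge A i ?as)" for i
    by (rule bar_merge_map[symmetric]) (use g algebra_mapD(3)[OF alg] in \<open>auto simp: bar_gens_def\<close>)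
  then have b: "lin_ext (\<lambda>as. basis (map \<phi> as)) (src.rel.bar_boundary n ?as) = tgt.rel.bar_boundary n (map \<phi> ?as)"
    by (simp only: src.rel.bar_boundary_def tgt.rel.bar_boundary_def lin_ext_sum lin_ext_scale lin_ext_basis)
  have y': "y \<in> carrier Y" using y by simp
  have "chainmap n (hoch_diff A S (restrict_bimodule \<phi> Y) n (src.chain (Suc n) ?as y)) =
      tgt.ch.pure n (tgt.rel.barcls n (tgt.rel.bar_boundary n (map \<phi> ?as))) y"
    by (simp only: src.hoch_diff_chain[OF g y] chainmap_pure[OF c y'] barmap_cls[OF k] b)
  also have "\<dots> = hoch_diff A' S' Y n (chainmap (Suc n) (src.chain (Suc n) ?as y))"
    by (simp only: chainmap_chain[OF g y'] tgt.hoch_diff_chain[OF map_gens[OF g] y'])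
  finally show "chainmap n (hoch_diff A S (restrict_bimodule \<phi> Y) n (src.chain (Suc n) ?as y)) =
      hoch_diff A' S' Y n (chainmap (Suc n) (src.chain (Suc n) ?as y))" .
qed

lemma chainmap_cycles: "z \<in> src.cycles1 \<Longrightarrow> chainmap1 z \<in> tgt.cycles1"
  using chainmap_diff[of z 0] lin_map_zero[OF src.C_module tgt.C_module chainmap_linear[of 0]]
  by (auto simp: src.cycles1_iff tgt.cycles1_iff lin_mapD(1)[OF chainmap_linear])

lemma chainmap_boundaries: "z \<in> src.boundaries1 \<Longrightarrow> chainmap1 z \<in> tgt.boundaries1"
  unfolding hoch_boundaries_def by (auto simp: chainmap_diff lin_mapD(1)[OF chainmap_linear])

lemma hoch_map_hclass:
  assumes z: "z \<in> src.cycles1"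
  shows "hoch_map \<phi> A' S' Y (Suc 0) (src.hclass z) = tgt.hclass (chainmap1 z)"
proof -
  have tgt: "quotient_space tgt.C1 tgt.boundaries1"
    by (intro quotient_space.intro quotient_space_axioms.intro tgt.C_module tgt.boundaries1_submodule)
  have "quot_map tgt.C1 tgt.boundaries1 (chainmap1)
      (src.boundaries1 +>\<^bsub>src.C1\<lparr>carrier := src.cycles1\<rparr>\<^esub> z) =
      tgt.boundaries1 +>\<^bsub>tgt.C1\<^esub> chainmap1 z"
    by (rule quotient_space.quot_map_coset[OF src.quotient_space_homology tgt])
      (use z lin_mapD[OF chainmap_linear] chainmap_boundaries in
        \<open>simp_all add: src.cycles1_iff \<close>)
  then show ?thesis
    by (simp only: hoch_map_def chainmap_def src.coset_cycles tgt.hclass_def)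
qed

lemma hoch_map_linear: "lin_map src.H1 tgt.H1 (hoch_map \<phi> A' S' Y (Suc 0))"
proof (rule lin_mapI)
  fix x assume "x \<in> carrier src.H1"
  then obtain u where u: "u \<in> src.cycles1" "x = src.hclass u" unfolding src.carrier_H1 by blast
  have uC: "u \<in> carrier src.C1" using u(1) by (simp add: src.cycles1_iff)
  show "hoch_map \<phi> A' S' Y (Suc 0) x \<in> carrier tgt.H1"
    unfolding u(2) hoch_map_hclass[OF u(1)] tgt.carrier_H1 by (intro imageI chainmap_cycles u)
  show "hoch_map \<phi> A' S' Y (Suc 0) (c \<odot>\<^bsub>src.H1\<^esub> x) = c \<odot>\<^bsub>tgt.H1\<^esub> hoch_map \<phi> A' S' Y (Suc 0) x" for c
    using u(1) uC k_submoduleD(4)[OF src.cycles1_submodule u(1), of c] chainmap_cycles[OF u(1)]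
    unfolding u(2)
    by (simp only: src.hclass_smult[symmetric] hoch_map_hclass lin_mapD(3)[OF chainmap_linear] tgt.hclass_smult)
  fix y assume "y \<in> carrier src.H1"
  then obtain v where v: "v \<in> src.cycles1" "y = src.hclass v" unfolding src.carrier_H1 by blast
  have vC: "v \<in> carrier src.C1" using v(1) by (simp add: src.cycles1_iff)
  show "hoch_map \<phi> A' S' Y (Suc 0) (x \<oplus>\<^bsub>src.H1\<^esub> y) =
      hoch_map \<phi> A' S' Y (Suc 0) x \<oplus>\<^bsub>tgt.H1\<^esub> hoch_map \<phi> A' S' Y (Suc 0) y"
    using u(1) uC v(1) vC k_submoduleD(3)[OF src.cycles1_submodule u(1) v(1)]
      chainmap_cycles[OF u(1)] chainmap_cycles[OF v(1)]
    unfolding u(2) v(2)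
    by (simp only: src.hclass_add[symmetric] hoch_map_hclass lin_mapD(2)[OF chainmap_linear] tgt.hclass_add)
qed

end

section \<open>Exactness for an extension along which derivations extend\<close>

lemma (in relative_hochschild) chain_separation:
  assumes "submodule W ground (C n)" "z \<in> carrier (C n)" "z \<notin> W"
  shows "\<exists>l. linear_form (C n) l \<and> (\<forall>w\<in>W. l w = 0) \<and> l z = 1"
  by (rule ch.bt.separating_form[of W n z]) (use assms in \<open>auto simp: hoch_chains_def bitensor_def\<close>)

text \<open>
  A derivation of \<open>A\<close> into the dual bimodule of \<open>Y\<close>, uncurried. The dual carries the actions
  \<open>(a x) y = x (y a)\<close> and \<open>(x a) y = x (a y)\<close>, so that the last condition is
  \<open>\<delta> (a b) = a \<delta> b + \<delta> a b\<close>.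
\<close>

definition derivation_form ::
  "('k::field, 'a, 'm) module_scheme \<Rightarrow> ('k, 'y, 'a, 'n) bimodule_scheme \<Rightarrow> ('a \<Rightarrow> 'y \<Rightarrow> 'k) \<Rightarrow> bool" where
  "derivation_form A Y \<delta> \<longleftrightarrow>
     (\<forall>a\<in>carrier A. linear_form Y (\<delta> a)) \<and> (\<forall>y\<in>carrier Y. linear_form A (\<lambda>a. \<delta> a y)) \<and>
     (\<forall>a\<in>carrier A. \<forall>b\<in>carrier A. \<forall>y\<in>carrier Y.
        \<delta> (a \<otimes>\<^bsub>A\<^esub> b) y = \<delta> b (ract Y y a) + \<delta> a (lact Y b y))"

lemma submodule_sum:
  assumes V: "Module.module ground V" and "submodule U ground V" "submodule W ground V"
  shows "submodule {u \<oplus>\<^bsub>V\<^esub> w | u w. u \<in> U \<and> w \<in> W} ground V"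
proof (rule k_submoduleI[OF V])
  interpret Module.module ground V by fact
  note U = k_submoduleD[OF assms(2)] and W = k_submoduleD[OF assms(3)]
  show "{u \<oplus>\<^bsub>V\<^esub> w | u w. u \<in> U \<and> w \<in> W} \<subseteq> carrier V" using U(1) W(1) by auto
  have "\<zero>\<^bsub>V\<^esub> = \<zero>\<^bsub>V\<^esub> \<oplus>\<^bsub>V\<^esub> \<zero>\<^bsub>V\<^esub>" by simp
  then show "\<zero>\<^bsub>V\<^esub> \<in> {u \<oplus>\<^bsub>V\<^esub> w | u w. u \<in> U \<and> w \<in> W}" using U(2) W(2) by blast
  fix c x assume "x \<in> {u \<oplus>\<^bsub>V\<^esub> w | u w. u \<in> U \<and> w \<in> W}"
  then obtain u w where uw: "x = u \<oplus>\<^bsub>V\<^esub> w" "u \<in> U" "w \<in> W" by blast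
  have cl: "u \<in> carrier V" "w \<in> carrier V" using uw U(1) W(1) by auto
  have "c \<odot>\<^bsub>V\<^esub> x = c \<odot>\<^bsub>V\<^esub> u \<oplus>\<^bsub>V\<^esub> c \<odot>\<^bsub>V\<^esub> w" using uw(1) cl smult_r_distr[of c u w] by simp
  then show "c \<odot>\<^bsub>V\<^esub> x \<in> {u \<oplus>\<^bsub>V\<^esub> w | u w. u \<in> U \<and> w \<in> W}"
    using U(4)[OF uw(2)] W(4)[OF uw(3)] by blast
  fix y assume "y \<in> {u \<oplus>\<^bsub>V\<^esub> w | u w. u \<in> U \<and> w \<in> W}"
  then obtain u' w' where uw': "y = u' \<oplus>\<^bsub>V\<^esub> w'" "u' \<in> U" "w' \<in> W" by blast
  have cl': "u' \<in> carrier V" "w' \<in> carrier V" using uw' U(1) W(1) by auto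
  have "x \<oplus>\<^bsub>V\<^esub> y = (u \<oplus>\<^bsub>V\<^esub> u') \<oplus>\<^bsub>V\<^esub> (w \<oplus>\<^bsub>V\<^esub> w')"
    using uw(1) uw'(1) cl cl' by (simp add: a_ac)
  then show "x \<oplus>\<^bsub>V\<^esub> y \<in> {u \<oplus>\<^bsub>V\<^esub> w | u w. u \<in> U \<and> w \<in> W}"
    using U(3)[OF uw(2) uw'(2)] W(3)[OF uw(3) uw'(3)] by blast
qed

lemma restrict_bimodule_bimodule:
  fixes Y :: "('k::field, 'y, 'b) bimodule"
  assumes A: "k_algebra A" and Y: "bimodule A' Y" and \<phi>: "algebra_map A A' \<phi>"
  shows "bimodule A (restrict_bimodule \<phi> Y)"
proof -
  interpret Y: bimodule A' Y by (rule Y)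
  have m: "Module.module ground Y" by (rule bimodule.axioms(2)[OF Y])
  show ?thesis
    by (intro bimodule.intro bimodule_axioms.intro A module_transfer[OF m])
      (simp_all add: algebra_mapD[OF \<phi>] Y.lact_closed Y.ract_closed Y.lact_add Y.ract_add Y.add_lact
        Y.add_ract Y.lact_mult Y.ract_mult Y.lact_one Y.ract_one Y.lact_ract Y.lact_smult Y.ract_smult
        Y.smult_lact Y.smult_ract)
qed

lemma scalars_subset: "k_algebra A \<Longrightarrow> scalars A \<subseteq> carrier A"
proof -
  assume "k_algebra A"
  then interpret k_algebra A .
  have "\<one>\<^bsub>A\<^esub> \<in> carrier A" by (rule monoid.one_closed[OF ring.axioms(2)[OF k_algebra.axioms(1)[OF k_algebra_axioms]]])
  then show ?thesis by (auto simp: scalars_def)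
qed

text \<open>
  A homomorphism \<open>\<phi> : B \<rightarrow> A\<close> gives three complexes with coefficients in \<open>Y\<close>: \<open>D\<close> for \<open>B\<close>, \<open>C\<close> for \<open>A\<close>, and \<open>E\<close>
  for \<open>A\<close> relative to the image of \<open>B\<close>, together with chain maps \<open>f : D \<rightarrow> C\<close> and \<open>g : C \<rightarrow> E\<close>.
\<close>

locale algebra_extension =
  fixes B :: "('k::field, 'b, 'l) module_scheme" and A :: "('k, 'a, 'm) module_scheme"
    and \<phi> :: "'b \<Rightarrow> 'a" and Y :: "('k, 'y, 'a) bimodule"
  assumes source_algebra: "k_algebra B" and coefficients: "bimodule A Y"
    and structure_map: "algebra_map B A \<phi>"
begin

interpretation Y: bimodule A Y by (rule coefficients)

lemma target_algebra: "k_algebra A"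
  by (rule bimodule.axioms(1)[OF coefficients])

lemma scalars_act:
  assumes "s \<in> scalars A" "y \<in> carrier Y"
  obtains c where "lact Y s y = c \<odot>\<^bsub>Y\<^esub> y" "ract Y y s = c \<odot>\<^bsub>Y\<^esub> y"
    "\<And>a. a \<in> carrier A \<Longrightarrow> a \<otimes>\<^bsub>A\<^esub> s = c \<odot>\<^bsub>A\<^esub> a" "\<And>a. a \<in> carrier A \<Longrightarrow> s \<otimes>\<^bsub>A\<^esub> a = c \<odot>\<^bsub>A\<^esub> a"
proof -
  have m: "Group.monoid A" by (rule ring.axioms(2)[OF k_algebra.axioms(1)[OF target_algebra]])
  have one: "\<one>\<^bsub>A\<^esub> \<in> carrier A" by (rule monoid.one_closed[OF m])
  from assms(1) obtain c where "s = c \<odot>\<^bsub>A\<^esub> \<one>\<^bsub>A\<^esub>" by (auto simp: scalars_def)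
  then show thesis
    using that[of c] assms(2) one
    by (simp add: Y.smult_lact Y.smult_ract Y.lact_one Y.ract_one Y.smult_mult_left Y.smult_mult_right
        monoid.l_one[OF m] monoid.r_one[OF m])
qed

sublocale D: relative_hochschild B "restrict_bimodule \<phi> Y" "scalars B"
  by (intro relative_hochschild.intro relative_hochschild_axioms.intro scalars_subset source_algebra
      restrict_bimodule_bimodule[OF source_algebra coefficients structure_map])

sublocale C: relative_hochschild A Y "scalars A"
  by (intro relative_hochschild.intro relative_hochschild_axioms.intro scalars_subset
      coefficients target_algebra)

sublocale E: relative_hochschild A Y "\<phi> ` carrier B"
  using algebra_mapD(1)[OF structure_map]
  by (intro relative_hochschild.intro relative_hochschild_axioms.intro coefficients) auto

sublocale f: relative_hochschild_map B A \<phi> Y "scalars B" "scalars A"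
proof (intro relative_hochschild_map.intro relative_hochschild_map_axioms.intro
    D.relative_hochschild_axioms C.relative_hochschild_axioms structure_map)
  show "\<phi> s \<in> scalars A" if "s \<in> scalars B" for s
    using that D.one_closed_A by (auto simp: scalars_def algebra_mapD[OF structure_map])
qed

lemma algebra_map_id: "algebra_map A A id"
  by (simp add: algebra_map_def ring_hom_def)

sublocale g: relative_hochschild_map A A id Y "scalars A" "\<phi> ` carrier B"
  rewrites "restrict_bimodule id Y = Y"
proof -
  show "relative_hochschild_map A A id Y (scalars A) (\<phi> ` carrier B)"
  proof (intro relative_hochschild_map.intro relative_hochschild_map_axioms.intro
      E.relative_hochschild_axioms algebra_map_id)
    show "relative_hochschild A (restrict_bimodule id Y) (scalars A)"
      unfolding restrict_bimodule_id by (rule C.relative_hochschild_axioms)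
    fix s assume "s \<in> scalars A"
    then obtain c where "s = c \<odot>\<^bsub>A\<^esub> \<one>\<^bsub>A\<^esub>" by (auto simp: scalars_def)
    then have "s = \<phi> (c \<odot>\<^bsub>B\<^esub> \<one>\<^bsub>B\<^esub>)"
      using D.one_closed_A by (simp add: algebra_mapD[OF structure_map])
    moreover have "c \<odot>\<^bsub>B\<^esub> \<one>\<^bsub>B\<^esub> \<in> carrier B"
      using scalars_subset[OF source_algebra] by (auto simp: scalars_def)
    ultimately show "id s \<in> \<phi> ` carrier B" by simp
  qed
qed (rule restrict_bimodule_id)

lemma g_surj:
  assumes "z \<in> carrier (E.C n)"
  shows "\<exists>u\<in>carrier (C.C n). z = g.chainmap n u"
proof -
  have "z \<in> g.chainmap n ` carrier (C.C n)"
  proof (rule E.chain_submodule[OF submodule_image[OF C.C_module E.C_module g.chainmap_linear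
        submodule_carrier[OF C.C_module]] _ assms])
    fix as y assume as: "set as \<subseteq> carrier A" "length as = n" and y: "y \<in> carrier Y"
    let ?as = "\<one>\<^bsub>A\<^esub> # as @ [\<one>\<^bsub>A\<^esub>]"
    have g: "?as \<in> bar_gens A n" using as C.one_closed_A by (auto simp: bar_gens_def)
    have "E.chain n ?as y = g.chainmap n (C.chain n ?as y)"
      using g.chainmap_chain[OF g y] by (simp only: list.map_id)
    then show "E.chain n ?as y \<in> g.chainmap n ` carrier (C.C n)"
      by (rule image_eqI[OF _ C.chain_closed[OF g y]])
  qed
  then show ?thesis by blast
qed

lemma f_chain0: "y \<in> carrier Y \<Longrightarrow> f.chainmap 0 (D.chain0 y) = C.chain0 y"
  and f_chain1: "b \<in> carrier B \<Longrightarrow> y \<in> carrier Y \<Longrightarrow> f.chainmap1 (D.chain1 b y) = C.chain1 (\<phi> b) y"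
  by (simp_all add: f.chainmap_chain D.bar_gens_simps algebra_mapD(4)[OF structure_map])

lemma g_chain0: "y \<in> carrier Y \<Longrightarrow> g.chainmap 0 (C.chain0 y) = E.chain0 y"
  and g_chain1: "a \<in> carrier A \<Longrightarrow> y \<in> carrier Y \<Longrightarrow> g.chainmap1 (C.chain1 a y) = E.chain1 a y"
  by (simp_all add: g.chainmap_chain C.bar_gens_simps)

lemma \<phi>_closed: "b \<in> carrier B \<Longrightarrow> \<phi> b \<in> carrier A"
  by (rule algebra_mapD(1)[OF structure_map])

abbreviation "dC \<equiv> hoch_diff A (scalars A) Y"
abbreviation "dD \<equiv> hoch_diff B (scalars B) (restrict_bimodule \<phi> Y)"

lemma f_chain1_in: "b \<in> carrier B \<Longrightarrow> y \<in> carrier Y \<Longrightarrow> C.chain1 (\<phi> b) y \<in> f.chainmap1 ` carrier D.C1"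
  by (rule image_eqI[where x = "D.chain1 b y"]) (simp_all add: f_chain1 D.chain_closed D.bar_gens_simps)

text \<open>
  A form on \<open>C\<^sub>0\<close> that vanishes on the boundaries of the image of \<open>D\<^sub>1\<close> takes the same value at \<open>s y\<close> and
  \<open>y s\<close> for \<open>s\<close> in the image of \<open>B\<close>, which is what it needs to factor through \<open>E\<^sub>0\<close>. So it vanishes on the kernel of
  \<open>g\<close>, and such forms separate.
\<close>

lemma kernel_degree0:
  assumes z: "z \<in> carrier (C.C 0)" "g.chainmap 0 z = \<zero>\<^bsub>E.C 0\<^esub>"
  shows "\<exists>w\<in>carrier D.C1. z = dC 0 (f.chainmap1 w)"
proof (rule ccontr)
  assume neg: "\<not> ?thesis"
  let ?W = "dC 0 ` f.chainmap1 ` carrier D.C1"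
  have W: "submodule ?W ground (C.C 0)"
    by (rule submodule_image[OF C.C_module C.C_module C.hoch_diff_linear
          submodule_image[OF D.C_module C.C_module f.chainmap_linear submodule_carrier[OF D.C_module]]])
  have zW: "z \<notin> ?W" using neg by auto
  obtain l where l: "linear_form (C.C 0) l" "\<forall>w\<in>?W. l w = 0" "l z = 1"
    using C.chain_separation[OF W z(1) zW] by (elim exE conjE) (rule that)
  have "l (C.chain0 (lact Y s y)) = l (C.chain0 (ract Y y s))" if s: "s \<in> \<phi> ` carrier B" and y: "y \<in> carrier Y" for s y
  proof -
    obtain b where b: "b \<in> carrier B" "s = \<phi> b" using s by blast
    have "dC 0 (C.chain1 s y) \<in> ?W" unfolding b(2) by (intro imageI f_chain1_in b(1) y)
    then have "l (dC 0 (C.chain1 s y)) = 0" by (rule bspec[OF l(2)])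
    then show ?thesis
      using y b \<phi>_closed
      by (simp add: C.diff_chain1 linear_form_minus[OF C.C_module l(1)] C.chain_closed C.bar_gens_simps
          Y.lact_closed Y.ract_closed)
  qed
  moreover have "linear_form Y (\<lambda>y. l (C.chain0 y))"
    by (rule linear_form_comp[OF C.chain_coeff_linear[OF C.bar_gens_simps(1)] l(1)])
  ultimately have "\<exists>l'. linear_form (E.C 0) l' \<and> (\<forall>y\<in>carrier Y. l' (E.chain0 y) = l (C.chain0 y))"
    by (intro E.chain0_form)
  then obtain l' where l': "linear_form (E.C 0) l'" "\<forall>y\<in>carrier Y. l' (E.chain0 y) = l (C.chain0 y)" by blast
  have "l' (g.chainmap 0 z) = l z"
    by (rule C.chain0_form_eqI[OF linear_form_comp[OF g.chainmap_linear l'(1)] l(1) _ z(1)])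
      (simp add: g_chain0 l'(2))
  then show False using z(2) l(3) linear_form_zero[OF E.C_module l'(1)] by simp
qed

text \<open>
  The argument is the same one degree higher. A form that vanishes on the boundaries satisfies the Leibniz
  rule. If it also vanishes on the image of \<open>D\<^sub>1\<close>, then the Leibniz rule for products with an element of \<open>B\<close> loses
  one term and becomes the balancing over \<open>B\<close>, so the form factors through \<open>E\<^sub>1\<close>.
\<close>

lemma kernel_degree1:
  assumes z: "z \<in> carrier C.C1" "g.chainmap1 z = \<zero>\<^bsub>E.C1\<^esub>"
  shows "\<exists>w\<in>carrier D.C1. \<exists>v\<in>C.boundaries1. z = f.chainmap1 w \<oplus>\<^bsub>C.C1\<^esub> v"
proof (rule ccontr)
  assume neg: "\<not> ?thesis"
  let ?U = "f.chainmap1 ` carrier D.C1"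
  let ?W = "{u \<oplus>\<^bsub>C.C1\<^esub> v | u v. u \<in> ?U \<and> v \<in> C.boundaries1}"
  have U: "submodule ?U ground C.C1"
    by (rule submodule_image[OF D.C_module C.C_module f.chainmap_linear submodule_carrier[OF D.C_module]])
  have W: "submodule ?W ground C.C1"
    by (rule submodule_sum[OF C.C_module U C.boundaries1_submodule])
  interpret C1: Module.module ground "C.C1" by (rule C.C_module)
  have UW: "u \<in> ?W" if "u \<in> ?U" for u
  proof -
    have "u \<in> carrier C.C1" using that k_submoduleD(1)[OF U] by blast
    then have "u = u \<oplus>\<^bsub>C.C1\<^esub> \<zero>\<^bsub>C.C1\<^esub>" by (simp add: C1.r_zero)
    then show ?thesis using that k_submoduleD(2)[OF C.boundaries1_submodule] by blast
  qed
  have BW: "u \<in> ?W" if "u \<in> C.boundaries1" for u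
  proof -
    have "u \<in> carrier C.C1" using that k_submoduleD(1)[OF C.boundaries1_submodule] by blast
    then have "u = \<zero>\<^bsub>C.C1\<^esub> \<oplus>\<^bsub>C.C1\<^esub> u" by (simp add: C1.l_zero)
    then show ?thesis using that k_submoduleD(2)[OF U] by blast
  qed
  have zW: "z \<notin> ?W"
  proof
    assume "z \<in> ?W"
    then obtain u v where "z = u \<oplus>\<^bsub>C.C1\<^esub> v" "u \<in> ?U" "v \<in> C.boundaries1" by blast
    then show False using neg by blast
  qed
  obtain l where l: "linear_form C.C1 l" "\<forall>w\<in>?W. l w = 0" "l z = 1"
    using C.chain_separation[OF W z(1) zW] by (elim exE conjE) (rule that)
  have leib: "l (C.chain1 (a \<otimes>\<^bsub>A\<^esub> b) y) = l (C.chain1 b (ract Y y a)) + l (C.chain1 a (lact Y b y))"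
    if "a \<in> carrier A" "b \<in> carrier A" "y \<in> carrier Y" for a b y
    by (rule C.boundary_form_leibniz[OF l(1) bspec[OF l(2) BW] that])
  have base: "l (C.chain1 s y) = 0" if "s \<in> \<phi> ` carrier B" "y \<in> carrier Y" for s y
    using that f_chain1_in by (intro bspec[OF l(2)] UW) blast
  have "\<exists>l'. linear_form E.C1 l' \<and>
      (\<forall>a\<in>carrier A. \<forall>y\<in>carrier Y. l' (E.chain1 a y) = l (C.chain1 a y))"
  proof (rule E.chain1_form)
    show "linear_form Y (\<lambda>y. l (C.chain1 a y))" if "a \<in> carrier A" for a
      by (rule linear_form_comp[OF C.chain_coeff_linear[OF C.bar_gens_simps(2)[OF that]] l(1)])
    show "linear_form A (\<lambda>a. l (C.chain1 a y))" if "y \<in> carrier Y" for y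
      by (rule linear_form_comp[OF C.chain1_linear[OF that] l(1)])
    fix a s y assume *: "a \<in> carrier A" "s \<in> \<phi> ` carrier B" "y \<in> carrier Y"
    then have s: "s \<in> carrier A" using \<phi>_closed by blast
    show "l (C.chain1 (a \<otimes>\<^bsub>A\<^esub> s) y) = l (C.chain1 a (lact Y s y))"
      using leib[OF *(1) s *(3)] base[OF *(2), of "ract Y y a"] * by (simp add: Y.ract_closed)
    show "l (C.chain1 (s \<otimes>\<^bsub>A\<^esub> a) y) = l (C.chain1 a (ract Y y s))"
      using leib[OF s *(1,3)] base[OF *(2), of "lact Y a y"] * by (simp add: Y.lact_closed)
  qed
  then obtain l' where l': "linear_form E.C1 l'"
    "\<forall>a\<in>carrier A. \<forall>y\<in>carrier Y. l' (E.chain1 a y) = l (C.chain1 a y)" by blast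
  have "l' (g.chainmap1 z) = l z"
    by (rule C.chain1_form_eqI[OF linear_form_comp[OF g.chainmap_linear l'(1)] l(1) _ z(1)])
      (simp add: g_chain1 l'(2))
  then show False using z(2) l(3) linear_form_zero[OF E.C_module l'(1)] by simp
qed

text \<open>
  In \<open>E\<close> the boundary of \<open>1 \<otimes> b \<otimes> y\<close> is \<open>1 \<otimes> b y\<close>, and balancing over \<open>B\<close> turns this into \<open>b \<otimes> y\<close>.
\<close>

lemma base_chains_bound:
  assumes u: "u \<in> carrier D.C1"
  shows "g.chainmap1 (f.chainmap1 u) \<in> E.boundaries1"
proof -
  note gf = lin_map_comp[OF f.chainmap_linear[of "Suc 0"] g.chainmap_linear[of "Suc 0"]]
  let ?W = "{u \<in> carrier D.C1. g.chainmap1 (f.chainmap1 u) \<in> E.boundaries1}"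
  interpret D1: Module.module ground "D.C1" by (rule D.C_module)
  interpret E1: Module.module ground "E.C1" by (rule E.C_module)
  have W: "submodule ?W ground D.C1"
    using lin_mapD[OF gf] lin_map_zero[OF D.C_module E.C_module gf] k_submoduleD[OF E.boundaries1_submodule]
    by (intro k_submoduleI[OF D.C_module]) auto
  have "u \<in> ?W"
  proof (rule D.chain_submodule[OF W _ u])
    fix as y assume "set as \<subseteq> carrier B" "length as = Suc 0" and y: "y \<in> carrier (restrict_bimodule \<phi> Y)"
    then obtain b where b: "as = [b]" "b \<in> carrier B" by (auto simp: length_Suc_conv)
    have y': "y \<in> carrier Y" using y by simp
    note c = \<phi>_closed[OF b(2)]
    have "hoch_diff A (\<phi> ` carrier B) Y (Suc 0) (E.chain2 \<one>\<^bsub>A\<^esub> (\<phi> b) y) =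
      (E.chain1 (\<phi> b) y \<ominus>\<^bsub>E.C1\<^esub> E.chain1 (\<phi> b) y) \<oplus>\<^bsub>E.C1\<^esub> E.chain1 \<one>\<^bsub>A\<^esub> (lact Y (\<phi> b) y)"
      using E.diff_chain2[OF E.one_closed_A c y'] c y' by (simp add: E.l_one_A Y.ract_one)
    also have "E.chain1 \<one>\<^bsub>A\<^esub> (lact Y (\<phi> b) y) = E.chain1 (\<phi> b) y"
      using E.chain1_balanced(1)[OF E.one_closed_A _ y', of "\<phi> b"] b(2) c by (simp add: E.l_one_A)
    also have "(E.chain1 (\<phi> b) y \<ominus>\<^bsub>E.C1\<^esub> E.chain1 (\<phi> b) y) \<oplus>\<^bsub>E.C1\<^esub> E.chain1 (\<phi> b) y = E.chain1 (\<phi> b) y"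
      using E.chain_closed[OF E.bar_gens_simps(2)[OF c] y'] by (simp add: a_minus_def E1.r_neg E1.l_zero)
    finally have "E.chain1 (\<phi> b) y \<in> E.boundaries1"
      unfolding hoch_boundaries_def
      using E.chain_closed[OF E.bar_gens_simps(3)[OF E.one_closed_A c] y'] by (rule image_eqI[OF sym])
    then have "g.chainmap1 (f.chainmap1 (D.chain1 b y)) \<in> E.boundaries1"
      using b(2) y' c by (simp add: f_chain1 g_chain1)
    then show "D.chain (Suc 0) (\<one>\<^bsub>B\<^esub> # as @ [\<one>\<^bsub>B\<^esub>]) y \<in> ?W"
      using D.chain_closed[OF D.bar_gens_simps(2)[OF b(2)] y] b(1) by simp
  qed
  then show ?thesis by simp
qed

text \<open>
  Both \<open>D\<^sub>0\<close> and \<open>C\<^sub>0\<close> are copies of \<open>Y\<close>. In terms of forms: balancing over the scalars is no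
  condition on a form on \<open>Y\<close>, so each form on \<open>D\<^sub>0\<close> comes from one on \<open>C\<^sub>0\<close>.
\<close>

lemma f_inj_degree0:
  assumes z: "z \<in> carrier (D.C 0)" "f.chainmap 0 z = \<zero>\<^bsub>C.C 0\<^esub>"
  shows "z = \<zero>\<^bsub>D.C 0\<^esub>"
proof (rule ccontr)
  assume "z \<noteq> \<zero>\<^bsub>D.C 0\<^esub>"
  interpret D0: Module.module ground "D.C 0" by (rule D.C_module)
  have W: "submodule {\<zero>\<^bsub>D.C 0\<^esub>} ground (D.C 0)"
    by (rule k_submoduleI[OF D.C_module]) (auto simp: D0.smult_r_null)
  obtain l where l: "linear_form (D.C 0) l" "l z = 1"
    using D.chain_separation[OF W z(1)] \<open>z \<noteq> \<zero>\<^bsub>D.C 0\<^esub>\<close> by blast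
  obtain y where y: "y \<in> carrier Y" "z = D.chain0 y" using D.chain0_surj[OF z(1)] by auto
  have "linear_form (restrict_bimodule \<phi> Y) (\<lambda>y. l (D.chain0 y))"
    by (rule linear_form_comp[OF D.chain_coeff_linear[OF D.bar_gens_simps(1)] l(1)])
  then have "linear_form Y (\<lambda>y. l (D.chain0 y))" by (rule linear_form_transfer) simp_all
  moreover have "l (D.chain0 (lact Y s y)) = l (D.chain0 (ract Y y s))" if "s \<in> scalars A" "y \<in> carrier Y" for s y
    using scalars_act[OF that] by metis
  ultimately have "\<exists>l'. linear_form (C.C 0) l' \<and> (\<forall>y\<in>carrier Y. l' (C.chain0 y) = l (D.chain0 y))"
    by (intro C.chain0_form)
  then obtain l' where l': "linear_form (C.C 0) l'" "\<forall>y\<in>carrier Y. l' (C.chain0 y) = l (D.chain0 y)" by blast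
  have "l' (f.chainmap 0 z) = l z" using y l'(2) by (simp add: f_chain0)
  then show False using z(2) l(2) linear_form_zero[OF C.C_module l'(1)] by simp
qed

end

context algebra_extension
begin


text \<open>
  Let a cycle \<open>w\<close> of \<open>D\<close> become a boundary in \<open>C\<close>. If \<open>w\<close> were not a boundary, a form \<open>l\<close> on \<open>D\<^sub>1\<close> would kill the
  boundaries but not \<open>w\<close>. It is a derivation, and the hypothesis extends it, up to an inner derivation, to
  a form \<open>\<rho>\<close> on \<open>C\<^sub>1\<close> that kills the boundaries. The inner derivation is a form \<open>\<xi>\<close> on \<open>D\<^sub>0\<close>
  composed with the differential, and therefore does not see the cycle \<open>w\<close>. So \<open>l\<close> takes at \<open>w\<close> the value
  of \<open>\<rho>\<close> at a boundary, which is zero.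
\<close>

lemma boundary_reflection:
  assumes extend: "\<And>\<delta>. derivation_form B (restrict_bimodule \<phi> Y) \<delta> \<Longrightarrow>
      \<exists>r x. derivation_form A Y r \<and> linear_form Y x \<and>
        (\<forall>b\<in>carrier B. \<forall>y\<in>carrier Y. r (\<phi> b) y = \<delta> b y + x (ract Y y (\<phi> b)) - x (lact Y (\<phi> b) y))"
    and w: "w \<in> D.cycles1" "f.chainmap1 w \<in> C.boundaries1"
  shows "w \<in> D.boundaries1"
proof (rule ccontr)
  assume neg: "w \<notin> D.boundaries1"
  have wC: "w \<in> carrier D.C1" and dw: "dD 0 w = \<zero>\<^bsub>D.C 0\<^esub>"
    using w(1) by (simp_all add: D.cycles1_iff)
  obtain l where l: "linear_form D.C1 l" "\<forall>z\<in>D.boundaries1. l z = 0" "l w = 1"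
    using D.chain_separation[OF D.boundaries1_submodule wC neg] by (elim exE conjE) (rule that)
  have "derivation_form B (restrict_bimodule \<phi> Y) (\<lambda>b y. l (D.chain1 b y))"
    unfolding derivation_form_def
  proof (intro conjI ballI)
    show "linear_form (restrict_bimodule \<phi> Y) (\<lambda>y. l (D.chain1 b y))" if "b \<in> carrier B" for b
      by (rule linear_form_comp[OF D.chain_coeff_linear[OF D.bar_gens_simps(2)[OF that]] l(1)])
    show "linear_form B (\<lambda>b. l (D.chain1 b y))" if "y \<in> carrier (restrict_bimodule \<phi> Y)" for y
      by (rule linear_form_comp[OF D.chain1_linear[OF that] l(1)])
    show "l (D.chain1 (a \<otimes>\<^bsub>B\<^esub> b) y) =
        l (D.chain1 b (ract (restrict_bimodule \<phi> Y) y a)) + l (D.chain1 a (lact (restrict_bimodule \<phi> Y) b y))"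
      if "a \<in> carrier B" "b \<in> carrier B" "y \<in> carrier (restrict_bimodule \<phi> Y)" for a b y
      by (rule D.boundary_form_leibniz[OF l(1) bspec[OF l(2)] that])
  qed
  from extend[OF this] obtain r x where r: "derivation_form A Y r" and x: "linear_form Y x"
    and rx: "\<forall>b\<in>carrier B. \<forall>y\<in>carrier Y.
      r (\<phi> b) y = l (D.chain1 b y) + x (ract Y y (\<phi> b)) - x (lact Y (\<phi> b) y)"
    by (elim exE conjE) (rule that)
  have "\<exists>\<rho>. linear_form C.C1 \<rho> \<and> (\<forall>a\<in>carrier A. \<forall>y\<in>carrier Y. \<rho> (C.chain1 a y) = r a y)"
  proof (rule C.chain1_form)
    show lr: "linear_form Y (r a)" if "a \<in> carrier A" for a using r that by (simp add: derivation_form_def)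
    show ll: "linear_form A (\<lambda>a. r a y)" if "y \<in> carrier Y" for y using r that by (simp add: derivation_form_def)
    fix a s y assume *: "a \<in> carrier A" "s \<in> scalars A" "y \<in> carrier Y"
    obtain c where c: "lact Y s y = c \<odot>\<^bsub>Y\<^esub> y" "ract Y y s = c \<odot>\<^bsub>Y\<^esub> y"
      "\<And>a. a \<in> carrier A \<Longrightarrow> a \<otimes>\<^bsub>A\<^esub> s = c \<odot>\<^bsub>A\<^esub> a" "\<And>a. a \<in> carrier A \<Longrightarrow> s \<otimes>\<^bsub>A\<^esub> a = c \<odot>\<^bsub>A\<^esub> a"
      by (rule scalars_act[OF *(2,3)]) blast
    show "r (a \<otimes>\<^bsub>A\<^esub> s) y = r a (lact Y s y)" "r (s \<otimes>\<^bsub>A\<^esub> a) y = r a (ract Y y s)"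
      using lr[OF *(1)] ll[OF *(3)] * by (simp_all add: c linear_form_def)
  qed
  then obtain \<rho> where \<rho>: "linear_form C.C1 \<rho>" "\<forall>a\<in>carrier A. \<forall>y\<in>carrier Y. \<rho> (C.chain1 a y) = r a y"
    by blast
  have "\<exists>\<xi>. linear_form (D.C 0) \<xi> \<and> (\<forall>y\<in>carrier (restrict_bimodule \<phi> Y). \<xi> (D.chain0 y) = x y)"
  proof (rule D.chain0_form)
    show "linear_form (restrict_bimodule \<phi> Y) x" using x by (rule linear_form_transfer) simp_all
    fix s y assume s: "s \<in> scalars B" and y: "y \<in> carrier (restrict_bimodule \<phi> Y)"
    have "\<phi> s \<in> scalars A" "y \<in> carrier Y" using f.base[OF s] y by simp_all
    from scalars_act[OF this] have "lact Y (\<phi> s) y = ract Y y (\<phi> s)" by metis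
    then show "x (lact (restrict_bimodule \<phi> Y) s y) = x (ract (restrict_bimodule \<phi> Y) y s)" by simp
  qed
  then obtain \<xi> where \<xi>: "linear_form (D.C 0) \<xi>" "\<forall>y\<in>carrier Y. \<xi> (D.chain0 y) = x y" by auto
  \<comment> \<open>The identity holds on generators, where the second summand is the inner derivation.\<close>
  have "\<rho> (f.chainmap1 w) = l w + \<xi> (dD 0 w)"
  proof (rule D.chain1_form_eqI[OF linear_form_comp[OF f.chainmap_linear \<rho>(1)] _ _ wC])
    show "linear_form D.C1 (\<lambda>w. l w + \<xi> (dD 0 w))"
      using l(1) linear_form_comp[OF D.hoch_diff_linear \<xi>(1)] by (simp add: linear_form_def algebra_simps)
    fix b y assume b: "b \<in> carrier B" and "y \<in> carrier (restrict_bimodule \<phi> Y)"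
    then have y: "y \<in> carrier Y" by simp
    have cl: "D.chain0 (ract Y y (\<phi> b)) \<in> carrier (D.C 0)" "D.chain0 (lact Y (\<phi> b) y) \<in> carrier (D.C 0)"
      using b y by (simp_all add: D.chain_closed D.bar_gens_simps C.lact_closed C.ract_closed \<phi>_closed)
    have "\<xi> (dD 0 (D.chain1 b y)) = x (ract Y y (\<phi> b)) - x (lact Y (\<phi> b) y)"
      using b y cl \<xi>(2)
      by (simp add: D.diff_chain1 linear_form_minus[OF D.C_module \<xi>(1)] C.lact_closed C.ract_closed \<phi>_closed)
    then show "\<rho> (f.chainmap1 (D.chain1 b y)) = l (D.chain1 b y) + \<xi> (dD 0 (D.chain1 b y))"
      using b y \<rho>(2) rx by (simp add: f_chain1 \<phi>_closed)
  qed
  moreover have "\<rho> (f.chainmap1 w) = 0"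
  proof (rule C.leibniz_form_boundaries[OF \<rho>(1) _ w(2)])
    fix a b y assume *: "a \<in> carrier A" "b \<in> carrier A" "y \<in> carrier Y"
    then have "r (a \<otimes>\<^bsub>A\<^esub> b) y = r b (ract Y y a) + r a (lact Y b y)"
      using r by (simp add: derivation_form_def)
    then show "\<rho> (C.chain1 (a \<otimes>\<^bsub>A\<^esub> b) y) = \<rho> (C.chain1 b (ract Y y a)) + \<rho> (C.chain1 a (lact Y b y))"
      using \<rho>(2) * by (simp add: C.lact_closed C.ract_closed C.m_closed_A)
  qed
  ultimately show False using l(3) dw linear_form_zero[OF D.C_module \<xi>(1)] by simp
qed

theorem homology_short_exact:
  assumes extend: "\<And>\<delta>. derivation_form B (restrict_bimodule \<phi> Y) \<delta> \<Longrightarrow>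
      \<exists>r x. derivation_form A Y r \<and> linear_form Y x \<and>
        (\<forall>b\<in>carrier B. \<forall>y\<in>carrier Y. r (\<phi> b) y = \<delta> b y + x (ract Y y (\<phi> b)) - x (lact Y (\<phi> b) y))"
  shows "short_exact D.H1 C.H1 E.H1 (hoch_map \<phi> A (scalars A) Y (Suc 0))
    (hoch_map id A (\<phi> ` carrier B) Y (Suc 0))"
proof -
  let ?f = "hoch_map \<phi> A (scalars A) Y (Suc 0)" and ?g = "hoch_map id A (\<phi> ` carrier B) Y (Suc 0)"
  note fl = f.chainmap_linear[of "Suc 0"] and gl = g.chainmap_linear[of "Suc 0"]
  note simps = D.cycles1_iff C.cycles1_iff E.cycles1_iff
  interpret C1: Module.module ground "C.C1" by (rule C.C_module)
  interpret HD: Module.module ground D.H1 by (rule D.H1_module)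
  have inj: "inj_on ?f (carrier D.H1)"
  proof (rule inj_onI)
    fix u v assume u: "u \<in> carrier D.H1" and v: "v \<in> carrier D.H1" and eq: "?f u = ?f v"
    interpret HC: Module.module ground C.H1 by (rule C.H1_module)
    have uv: "u \<ominus>\<^bsub>D.H1\<^esub> v \<in> carrier D.H1" using u v by (rule HD.minus_closed)
    then obtain w where w: "w \<in> D.cycles1" "u \<ominus>\<^bsub>D.H1\<^esub> v = D.hclass w" unfolding D.carrier_H1 by blast
    have "?f (u \<ominus>\<^bsub>D.H1\<^esub> v) = ?f u \<ominus>\<^bsub>C.H1\<^esub> ?f v"
      by (rule lin_map_minus[OF D.H1_module C.H1_module f.hoch_map_linear u v])
    also have "\<dots> = \<zero>\<^bsub>C.H1\<^esub>"
      unfolding eq using lin_mapD(1)[OF f.hoch_map_linear v] by (simp add: a_minus_def HC.r_neg)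
    finally have "C.hclass (f.chainmap1 w) = \<zero>\<^bsub>C.H1\<^esub>"
      using f.hoch_map_hclass[OF w(1)] w(2) by simp
    then have fw: "f.chainmap1 w \<in> C.boundaries1"
      using C.hclass_zero_iff[OF f.chainmap_cycles[OF w(1)]] by simp
    have "w \<in> D.boundaries1" by (rule boundary_reflection[OF _ w(1) fw]) (rule extend)
    then have "u \<ominus>\<^bsub>D.H1\<^esub> v = \<zero>\<^bsub>D.H1\<^esub>" using D.hclass_zero_iff[OF w(1)] w(2) by simp
    then have "v = (u \<ominus>\<^bsub>D.H1\<^esub> v) \<oplus>\<^bsub>D.H1\<^esub> v" using v by (simp add: HD.l_zero)
    also have "\<dots> = u" using u v by (simp add: a_minus_def HD.a_assoc HD.l_neg)
    finally show "u = v" by simp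
  qed
  have gf: "?g x = \<zero>\<^bsub>E.H1\<^esub>" if "x \<in> ?f ` carrier D.H1" for x
  proof -
    from that obtain w where w: "w \<in> D.cycles1" "x = ?f (D.hclass w)" unfolding D.carrier_H1 by blast
    have fw: "f.chainmap1 w \<in> C.cycles1" by (rule f.chainmap_cycles[OF w(1)])
    have "?g x = E.hclass (g.chainmap1 (f.chainmap1 w))"
      unfolding w(2) f.hoch_map_hclass[OF w(1)] by (rule g.hoch_map_hclass[OF fw])
    also have "\<dots> = \<zero>\<^bsub>E.H1\<^esub>"
      using base_chains_bound[of w] w(1) E.hclass_zero_iff[OF g.chainmap_cycles[OF fw]]
      by (simp add: simps)
    finally show ?thesis .
  qed
  have ker: "x \<in> ?f ` carrier D.H1" if x: "x \<in> carrier C.H1" "?g x = \<zero>\<^bsub>E.H1\<^esub>" for x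
  proof -
    obtain z where z: "z \<in> C.cycles1" "x = C.hclass z" using x(1) unfolding C.carrier_H1 by blast
    have zC: "z \<in> carrier C.C1" using z(1) by (simp add: simps)
    have "g.chainmap1 z \<in> E.boundaries1"
      using x(2) E.hclass_zero_iff[OF g.chainmap_cycles[OF z(1)]] g.hoch_map_hclass[OF z(1)] z(2) by simp
    then obtain c' where c': "c' \<in> carrier (E.C (Suc (Suc 0)))"
      "g.chainmap1 z = hoch_diff A (\<phi> ` carrier B) Y (Suc 0) c'"
      unfolding hoch_boundaries_def by blast
    obtain c where c: "c \<in> carrier (C.C (Suc (Suc 0)))" "c' = g.chainmap (Suc (Suc 0)) c"
      using g_surj[OF c'(1)] by blast
    have dc: "dC (Suc 0) c \<in> carrier C.C1" by (rule lin_mapD(1)[OF C.hoch_diff_linear c(1)])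
    have dcB: "dC (Suc 0) c \<in> C.boundaries1" unfolding hoch_boundaries_def using c(1) by (rule imageI)
    have g0: "g.chainmap1 (z \<ominus>\<^bsub>C.C1\<^esub> dC (Suc 0) c) = \<zero>\<^bsub>E.C1\<^esub>"
    proof -
      interpret E1: Module.module ground "E.C1" by (rule E.C_module)
      have "g.chainmap1 (z \<ominus>\<^bsub>C.C1\<^esub> dC (Suc 0) c) =
          g.chainmap1 z \<ominus>\<^bsub>E.C1\<^esub> g.chainmap1 (dC (Suc 0) c)"
        by (rule lin_map_minus[OF C.C_module E.C_module gl zC dc])
      also have "g.chainmap1 (dC (Suc 0) c) = g.chainmap1 z"
        using g.chainmap_diff[OF c(1)] c'(2) c(2) by simp
      also have "g.chainmap1 z \<ominus>\<^bsub>E.C1\<^esub> g.chainmap1 z = \<zero>\<^bsub>E.C1\<^esub>"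
        using lin_mapD(1)[OF gl zC] by (simp add: a_minus_def E1.r_neg)
      finally show ?thesis .
    qed
    \<comment> \<open>The cycle \<open>z\<close> is a chain of \<open>B\<close> up to boundaries. This chain is again a cycle, since its boundary
      vanishes in \<open>C\<^sub>0\<close>, where no information about \<open>D\<^sub>0\<close> is lost.\<close>
    obtain w v where w: "w \<in> carrier D.C1" and v: "v \<in> C.boundaries1"
      and e: "z \<ominus>\<^bsub>C.C1\<^esub> dC (Suc 0) c = f.chainmap1 w \<oplus>\<^bsub>C.C1\<^esub> v"
      using kernel_degree1[OF C1.minus_closed[OF zC dc] g0] by blast
    have vC: "v \<in> carrier C.C1" using v k_submoduleD(1)[OF C.boundaries1_submodule] by blast
    have fwC: "f.chainmap1 w \<in> carrier C.C1" by (rule lin_mapD(1)[OF fl w])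
    let ?v = "v \<oplus>\<^bsub>C.C1\<^esub> dC (Suc 0) c"
    have vB: "?v \<in> C.boundaries1" by (rule k_submoduleD(3)[OF C.boundaries1_submodule v dcB])
    have z': "z = f.chainmap1 w \<oplus>\<^bsub>C.C1\<^esub> ?v"
    proof -
      have "z = (z \<ominus>\<^bsub>C.C1\<^esub> dC (Suc 0) c) \<oplus>\<^bsub>C.C1\<^esub> dC (Suc 0) c"
        using zC dc by (simp add: a_minus_def C1.a_assoc C1.l_neg)
      then show ?thesis unfolding e using fwC vC dc by (simp add: C1.a_assoc)
    qed
    have fwB: "z \<ominus>\<^bsub>C.C1\<^esub> f.chainmap1 w = ?v"
      unfolding z' using fwC C1.a_closed[OF vC dc] C1.a_comm[OF fwC C1.a_closed[OF vC dc]]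
      by (simp add: a_minus_def C1.a_assoc C1.r_neg)
    have "dC 0 (f.chainmap1 w) = \<zero>\<^bsub>C.C 0\<^esub>"
    proof -
      interpret C0: Module.module ground "C.C 0" by (rule C.C_module)
      have "dC 0 ?v = \<zero>\<^bsub>C.C 0\<^esub>" "dC 0 z = \<zero>\<^bsub>C.C 0\<^esub>"
        using subsetD[OF C.boundaries1_cycles1 vB] z(1) by (simp_all add: simps)
      then have "dC 0 (f.chainmap1 w) \<oplus>\<^bsub>C.C 0\<^esub> \<zero>\<^bsub>C.C 0\<^esub> = \<zero>\<^bsub>C.C 0\<^esub>"
        using lin_mapD(2)[OF C.hoch_diff_linear fwC C1.a_closed[OF vC dc]] z' by simp
      then show ?thesis using lin_mapD(1)[OF C.hoch_diff_linear fwC] by (simp add: C0.r_zero)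
    qed
    then have "f.chainmap 0 (dD 0 w) = \<zero>\<^bsub>C.C 0\<^esub>" using f.chainmap_diff[OF w] by simp
    then have "dD 0 w = \<zero>\<^bsub>D.C 0\<^esub>" by (rule f_inj_degree0[OF lin_mapD(1)[OF D.hoch_diff_linear w]])
    then have wZ: "w \<in> D.cycles1" using w by (simp add: simps)
    have "x = ?f (D.hclass w)"
      unfolding z(2) f.hoch_map_hclass[OF wZ]
      by (rule C.hclass_eqI[OF z(1) f.chainmap_cycles[OF wZ]]) (simp only: fwB vB)
    then show ?thesis unfolding D.carrier_H1 using wZ by blast
  qed
  have surj: "x \<in> ?g ` carrier C.H1" if x: "x \<in> carrier E.H1" for x
  proof -
    obtain z' where z': "z' \<in> E.cycles1" "x = E.hclass z'" using x unfolding E.carrier_H1 by blast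
    have zE: "z' \<in> carrier E.C1" "hoch_diff A (\<phi> ` carrier B) Y 0 z' = \<zero>\<^bsub>E.C 0\<^esub>"
      using z'(1) by (simp_all add: simps)
    obtain z where z: "z \<in> carrier C.C1" "z' = g.chainmap1 z" using g_surj[OF zE(1)] by blast
    \<comment> \<open>A lift \<open>z\<close> of the relative cycle need not be a cycle, but its boundary is that of a chain of \<open>B\<close>, and
      subtracting this chain changes the relative class only by a boundary.\<close>
    have "g.chainmap 0 (dC 0 z) = \<zero>\<^bsub>E.C 0\<^esub>" using g.chainmap_diff[OF z(1)] zE(2) z(2) by simp
    then obtain w where w: "w \<in> carrier D.C1" "dC 0 z = dC 0 (f.chainmap1 w)"
      using kernel_degree0[OF lin_mapD(1)[OF C.hoch_diff_linear z(1)]] by blast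
    have fwC: "f.chainmap1 w \<in> carrier C.C1" by (rule lin_mapD(1)[OF fl w(1)])
    let ?u = "z \<ominus>\<^bsub>C.C1\<^esub> f.chainmap1 w"
    have u: "?u \<in> C.cycles1"
    proof -
      interpret C0: Module.module ground "C.C 0" by (rule C.C_module)
      have "dC 0 ?u = dC 0 z \<ominus>\<^bsub>C.C 0\<^esub> dC 0 (f.chainmap1 w)"
        by (rule lin_map_minus[OF C.C_module C.C_module C.hoch_diff_linear z(1) fwC])
      also have "\<dots> = \<zero>\<^bsub>C.C 0\<^esub>"
        unfolding w(2)[symmetric] using lin_mapD(1)[OF C.hoch_diff_linear z(1)] by (simp add: a_minus_def C0.r_neg)
      finally show ?thesis using C1.minus_closed[OF z(1) fwC] by (simp add: simps)
    qed
    have "z' \<ominus>\<^bsub>E.C1\<^esub> g.chainmap1 ?u = g.chainmap1 (f.chainmap1 w)"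
    proof -
      interpret E1: Module.module ground "E.C1" by (rule E.C_module)
      have gz: "g.chainmap1 z \<in> carrier E.C1"
        and gfw: "g.chainmap1 (f.chainmap1 w) \<in> carrier E.C1"
        by (rule lin_mapD(1)[OF gl z(1)], rule lin_mapD(1)[OF gl fwC])
      show ?thesis
        unfolding z(2) lin_map_minus[OF C.C_module E.C_module gl z(1) fwC]
        using gz gfw by (simp add: a_minus_def E1.minus_add E1.minus_minus E1.r_neg2)
    qed
    then have "z' \<ominus>\<^bsub>E.C1\<^esub> g.chainmap1 ?u \<in> E.boundaries1"
      using base_chains_bound[OF w(1)] by simp
    then have "x = ?g (C.hclass ?u)"
      unfolding z'(2) g.hoch_map_hclass[OF u] by (rule E.hclass_eqI[OF z'(1) g.chainmap_cycles[OF u]])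
    then show ?thesis unfolding C.carrier_H1 using u by blast
  qed
  show ?thesis
    unfolding short_exact_def
  proof (intro conjI D.H1_module C.H1_module E.H1_module f.hoch_map_linear g.hoch_map_linear inj)
    show "?f ` carrier D.H1 = a_kernel C.H1 E.H1 ?g"
    proof (rule Set.set_eqI)
      fix x
      show "x \<in> ?f ` carrier D.H1 \<longleftrightarrow> x \<in> a_kernel C.H1 E.H1 ?g"
        using gf[of x] ker[of x] lin_mapD(1)[OF f.hoch_map_linear] unfolding a_kernel_def' by blast
    qed
    show "?g ` carrier C.H1 = carrier E.H1"
    proof (rule Set.set_eqI)
      fix x
      show "x \<in> ?g ` carrier C.H1 \<longleftrightarrow> x \<in> carrier E.H1"
        using surj[of x] lin_mapD(1)[OF g.hoch_map_linear] by blast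
    qed
  qed
qed

end

section \<open>Derivations of path algebras\<close>

lemma derivation_form_add:
  assumes "bimodule A Y" "derivation_form A Y d" "derivation_form A Y d'"
  shows "derivation_form A Y (\<lambda>a y. d a y + d' a y)"
proof -
  interpret bimodule A Y by fact
  show ?thesis
    using assms(2,3) by (auto simp: derivation_form_def linear_form_def algebra_simps)
qed

text \<open>This is the inner derivation \<open>a \<mapsto> a x - x a\<close> of the dual bimodule.\<close>

lemma derivation_form_inner:
  fixes Y :: "('k::field, 'y, 'a, 'n) bimodule_scheme"
  assumes Y: "bimodule A Y" and x: "linear_form Y x"
  shows "derivation_form A Y (\<lambda>a y. x (ract Y y a) - x (lact Y a y))"
proof -
  interpret bimodule A Y by fact
  have "Group.monoid A" by (rule ring.axioms(2)[OF k_algebra.axioms(1)[OF bimodule.axioms(1)[OF Y]]])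
  then show ?thesis
    using x unfolding derivation_form_def linear_form_def
    by (auto simp: lact_add ract_add add_lact add_ract lact_smult ract_smult smult_lact smult_ract
        lact_mult ract_mult lact_ract lact_closed ract_closed algebra_simps monoid.m_closed)
qed

context fin_digraph
begin

abbreviation "vertex v \<equiv> basis (v, [], v)"
abbreviation "arrow a \<equiv> basis (tail G a, [a], head G a)"

lemma vertex_path: "v \<in> verts G \<Longrightarrow> (v, [], v) \<in> paths G"
  by (simp add: paths_def awalk_Nil_iff)

lemma path_Cons_iff: "(u, a # p, v) \<in> paths G \<longleftrightarrow> a \<in> arcs G \<and> u = tail G a \<and> (head G a, p, v) \<in> paths G"
  by (simp add: paths_def awalk_Cons_iff)

lemma path_Nil_iff: "(u, [], v) \<in> paths G \<longleftrightarrow> u = v \<and> u \<in> verts G"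
  by (simp add: paths_def awalk_Nil_iff)

lemma arrow_path: "a \<in> arcs G \<Longrightarrow> (tail G a, [a], head G a) \<in> paths G"
  by (simp add: path_Cons_iff path_Nil_iff)

lemma path_mult: "basis \<beta> \<otimes>\<^bsub>path_algebra G\<^esub> basis \<alpha> = path_prod \<beta> \<alpha>"
  by simp

end

text \<open>
  A derivation \<open>d\<close> that vanishes at the vertices satisfies \<open>d (p a) = d p a + p d a\<close> for an arrow
  \<open>a\<close> followed by a path \<open>p\<close>. Read in the dual of \<open>Y\<close>, this is the following recursion, in which \<open>D\<close>
  gives the values at the arrows.
\<close>

primrec path_derivation ::
  "('v, 'e) pre_digraph \<Rightarrow> ('k::field, 'y, ('v, 'e) path \<Rightarrow>\<^sub>0 'k, 'n) bimodule_scheme \<Rightarrow> ('e \<Rightarrow> 'y \<Rightarrow> 'k) \<Rightarrow>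
    'v \<Rightarrow> 'e list \<Rightarrow> 'y \<Rightarrow> 'k" where
  "path_derivation G Y D v [] y = 0"
| "path_derivation G Y D v (a # p) y =
     path_derivation G Y D v p (lact Y (basis (tail G a, [a], head G a)) y) +
     D a (ract Y y (basis (head G a, p, v)))"

definition derivation_on_paths ::
  "('v, 'e) pre_digraph \<Rightarrow> ('k::field, 'y, ('v, 'e) path \<Rightarrow>\<^sub>0 'k, 'n) bimodule_scheme \<Rightarrow> ('e \<Rightarrow> 'y \<Rightarrow> 'k) \<Rightarrow>
    (('v, 'e) path \<Rightarrow>\<^sub>0 'k) \<Rightarrow> 'y \<Rightarrow> 'k" where
  "derivation_on_paths G Y D z y = eval_form (\<lambda>(u, p, v). path_derivation G Y D v p y) z"

text \<open>
  An arrow is a multiple of its source vertex, on which the derivation is to vanish; the second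
  assumption on the prescribed values is what remains of this.
\<close>

locale path_bimodule = fin_digraph G + Y: bimodule "path_algebra G" Y
  for G :: "('v, 'e) pre_digraph" and Y :: "('k::field, 'y, ('v, 'e) path \<Rightarrow>\<^sub>0 'k, 'n) bimodule_scheme" +
  fixes D :: "'e \<Rightarrow> 'y \<Rightarrow> 'k"
  assumes arrow_form: "a \<in> arcs G \<Longrightarrow> linear_form Y (D a)"
    and arrow_source: "a \<in> arcs G \<Longrightarrow> y \<in> carrier Y \<Longrightarrow> D a (lact Y (vertex (tail G a)) y) = D a y"
begin

abbreviation "\<Delta> \<equiv> path_derivation G Y D"

lemma path_lact: "\<alpha> \<in> paths G \<Longrightarrow> y \<in> carrier Y \<Longrightarrow> lact Y (basis \<alpha>) y \<in> carrier Y"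
  and path_ract: "\<alpha> \<in> paths G \<Longrightarrow> y \<in> carrier Y \<Longrightarrow> ract Y y (basis \<alpha>) \<in> carrier Y"
  by (rule Y.lact_closed, simp, assumption, rule Y.ract_closed, simp)

lemma path_lact_lact:
  "\<alpha> \<in> paths G \<Longrightarrow> \<beta> \<in> paths G \<Longrightarrow> y \<in> carrier Y \<Longrightarrow>
    lact Y (basis \<beta>) (lact Y (basis \<alpha>) y) = lact Y (path_prod \<beta> \<alpha>) y"
  using Y.lact_mult[of "basis \<beta>" "basis \<alpha>" y] by simp

lemma path_ract_ract:
  "\<alpha> \<in> paths G \<Longrightarrow> \<beta> \<in> paths G \<Longrightarrow> y \<in> carrier Y \<Longrightarrow>
    ract Y (ract Y y (basis \<beta>)) (basis \<alpha>) = ract Y y (path_prod \<beta> \<alpha>)"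
  using Y.ract_mult[of "basis \<beta>" "basis \<alpha>" y] by simp

lemma path_lact_ract:
  "\<alpha> \<in> paths G \<Longrightarrow> \<beta> \<in> paths G \<Longrightarrow> y \<in> carrier Y \<Longrightarrow>
    ract Y (lact Y (basis \<alpha>) y) (basis \<beta>) = lact Y (basis \<alpha>) (ract Y y (basis \<beta>))"
  using Y.lact_ract[of "basis \<alpha>" "basis \<beta>" y] by simp

lemma module_Y: "Module.module ground Y"
  by (rule bimodule.axioms(2)[OF Y.bimodule_axioms])

lemma zero_act: "y \<in> carrier Y \<Longrightarrow> lact Y 0 y = \<zero>\<^bsub>Y\<^esub>" "y \<in> carrier Y \<Longrightarrow> ract Y y 0 = \<zero>\<^bsub>Y\<^esub>"
proof -
  interpret M: Module.module ground Y by (rule module_Y)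
  assume y: "y \<in> carrier Y"
  have "lact Y (scale 0 0) y = 0 \<odot>\<^bsub>Y\<^esub> lact Y 0 y"
    using Y.smult_lact[of 0 y 0] y by simp
  then show "lact Y 0 y = \<zero>\<^bsub>Y\<^esub>"
    using module.smult_l_null[OF module_Y, of "lact Y 0 y"] Y.lact_closed[of 0 y] y by (simp add: scale_simps)
  have "ract Y y (scale 0 0) = 0 \<odot>\<^bsub>Y\<^esub> ract Y y 0"
    using Y.smult_ract[of 0 y 0] y by simp
  then show "ract Y y 0 = \<zero>\<^bsub>Y\<^esub>"
    using module.smult_l_null[OF module_Y, of "ract Y y 0"] Y.ract_closed[of 0 y] y by (simp add: scale_simps)
qed

lemma derivation_linear: "(u, p, v) \<in> paths G \<Longrightarrow> linear_form Y (\<Delta> v p)"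
proof (induction p arbitrary: u)
  case Nil
  then show ?case by (simp add: linear_form_def)
next
  case (Cons a p)
  then have a: "a \<in> arcs G" and p: "(head G a, p, v) \<in> paths G" by (auto simp: path_Cons_iff)
  have "lin_map Y Y (lact Y (arrow a))" "lin_map Y Y (\<lambda>y. ract Y y (basis (head G a, p, v)))"
    using arrow_path[OF a] p
    by (auto intro!: lin_mapI simp: path_lact path_ract Y.lact_add Y.ract_add Y.lact_smult Y.ract_smult)
  from linear_form_comp[OF this(1) Cons.IH[OF p]] linear_form_comp[OF this(2) arrow_form[OF a]]
  show ?case by (simp add: linear_form_def algebra_simps)
qed

lemma derivation_source:
  assumes "(u, p, v) \<in> paths G" "y \<in> carrier Y"
  shows "\<Delta> v p (lact Y (vertex u) y) = \<Delta> v p y"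
proof (cases p)
  case (Cons a q)
  with assms have a: "a \<in> arcs G" and u: "u = tail G a" and q: "(head G a, q, v) \<in> paths G"
    by (auto simp: path_Cons_iff)
  have ver: "(u, [], u) \<in> paths G" using a u by (simp add: vertex_path)
  have "lact Y (arrow a) (lact Y (vertex u) y) = lact Y (arrow a) y"
    using path_lact_lact[OF ver arrow_path[OF a] assms(2)] u by simp
  moreover have "D a (ract Y (lact Y (vertex u) y) (basis (head G a, q, v))) = D a (ract Y y (basis (head G a, q, v)))"
    using path_lact_ract[OF ver q assms(2)] arrow_source[OF a path_ract[OF q assms(2)]] u by simp
  ultimately show ?thesis by (simp add: Cons)
qed simp

lemma derivation_target:
  "(u, p, v) \<in> paths G \<Longrightarrow> y \<in> carrier Y \<Longrightarrow> \<Delta> v p (ract Y y (vertex v)) = \<Delta> v p y"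
proof (induction p arbitrary: u y)
  case (Cons a p)
  then have a: "a \<in> arcs G" and p: "(head G a, p, v) \<in> paths G" by (auto simp: path_Cons_iff)
  have ver: "(v, [], v) \<in> paths G" using path_ends_in_verts[OF p] by (simp add: vertex_path)
  show ?case
    using Cons.IH[OF p path_lact[OF arrow_path[OF a] Cons.prems(2)]]
      path_lact_ract[OF arrow_path[OF a] ver Cons.prems(2)] path_ract_ract[OF p ver Cons.prems(2)]
    by simp
qed simp

lemma derivation_append:
  "(u, p, v) \<in> paths G \<Longrightarrow> (v, q, w) \<in> paths G \<Longrightarrow> y \<in> carrier Y \<Longrightarrow>
    \<Delta> w (p @ q) y = \<Delta> v p (ract Y y (basis (v, q, w))) + \<Delta> w q (lact Y (basis (u, p, v)) y)"
proof (induction p arbitrary: u y)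
  case Nil
  then show ?case using derivation_source[of v q w y] by (simp add: path_Nil_iff)
next
  case (Cons a p)
  then have a: "a \<in> arcs G" and u: "u = tail G a" and p: "(head G a, p, v) \<in> paths G" by (auto simp: path_Cons_iff)
  note y = Cons.prems(3) and q = Cons.prems(2)
  have "\<Delta> w (p @ q) (lact Y (arrow a) y) =
      \<Delta> v p (ract Y (lact Y (arrow a) y) (basis (v, q, w))) +
      \<Delta> w q (lact Y (basis (head G a, p, v)) (lact Y (arrow a) y))"
    by (rule Cons.IH[OF p q path_lact[OF arrow_path[OF a] y]])
  then show ?case
    using path_lact_ract[OF arrow_path[OF a] q y] path_lact_lact[OF arrow_path[OF a] p y]
      path_ract_ract[OF p q y] u
    by simp
qed

lemma derivation_product:
  assumes \<alpha>: "(u, p, v) \<in> paths G" and \<beta>: "(u', q, w) \<in> paths G" and y: "y \<in> carrier Y"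
  shows "derivation_on_paths G Y D (path_prod (u', q, w) (u, p, v)) y =
    \<Delta> v p (ract Y y (basis (u', q, w))) + \<Delta> w q (lact Y (basis (u, p, v)) y)"
proof (cases "v = u'")
  case True
  then show ?thesis using derivation_append[OF \<alpha> _ y, of q w] \<beta>
    by (simp add: derivation_on_paths_def eval_form_simps)
next
  case False
  interpret M: Module.module ground Y by (rule module_Y)
  have ver: "(v, [], v) \<in> paths G" "(u', [], u') \<in> paths G"
    using path_ends_in_verts[OF \<alpha>] path_ends_in_verts[OF \<beta>] by (simp_all add: vertex_path)
  have "\<Delta> v p (ract Y y (basis (u', q, w))) = \<Delta> v p (ract Y y (path_prod (u', q, w) (v, [], v)))"
    using derivation_target[OF \<alpha> path_ract[OF \<beta> y]] path_ract_ract[OF ver(1) \<beta> y] by simp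
  also have "\<dots> = 0"
    using False y linear_form_zero[OF module_Y derivation_linear[OF \<alpha>]] by (simp add: zero_act)
  finally have 1: "\<Delta> v p (ract Y y (basis (u', q, w))) = 0" .
  have "\<Delta> w q (lact Y (basis (u, p, v)) y) = \<Delta> w q (lact Y (path_prod (u', [], u') (u, p, v)) y)"
    using derivation_source[OF \<beta> path_lact[OF \<alpha> y]] path_lact_lact[OF \<alpha> ver(2) y] by simp
  also have "\<dots> = 0"
    using False y linear_form_zero[OF module_Y derivation_linear[OF \<beta>]] by (simp add: zero_act)
  finally show ?thesis using 1 False by (simp add: derivation_on_paths_def eval_form_simps)
qed

lemma derivation_on_paths_linear:
  assumes "supp z \<subseteq> paths G"
  shows "linear_form Y (derivation_on_paths G Y D z)"
proof -
  have "linear_form Y (\<lambda>y. case \<alpha> of (u, p, v) \<Rightarrow> \<Delta> v p y)" if "\<alpha> \<in> supp z" for \<alpha>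
    using that assms derivation_linear by (cases \<alpha>) auto
  then show ?thesis
    unfolding linear_form_def derivation_on_paths_def eval_form_fadd[symmetric] eval_form_fscale[symmetric]
    by (auto intro!: eval_form_cong)
qed

text \<open>
  Both sides of the Leibniz rule are bilinear, so it is enough to multiply two paths. If they compose, the
  rule is \<open>derivation_append\<close>. If not, the product is zero, and each summand vanishes because inserting
  the end vertex of one path annihilates the other.
\<close>

lemma derivation_form_paths: "derivation_form (path_algebra G) Y (derivation_on_paths G Y D)"
  unfolding derivation_form_def
proof (intro conjI ballI)
  let ?d = "derivation_on_paths G Y D"
  have d_simps: "?d (z + z') y = ?d z y + ?d z' y" "?d (scale c z) y = c * ?d z y" "?d 0 y = 0" for z z' y c
    by (simp_all add: derivation_on_paths_def eval_form_simps)
  show "linear_form Y (?d z)" if "z \<in> carrier (path_algebra G)" for z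
    using that by (intro derivation_on_paths_linear) simp
  show "linear_form (path_algebra G) (\<lambda>z. ?d z y)" if "y \<in> carrier Y" for y
    by (simp add: linear_form_def d_simps)
  interpret K: k_algebra "path_algebra G :: ('k, ('v, 'e) path \<Rightarrow>\<^sub>0 'k) module" by (rule path_algebra_k_algebra)
  have lin: "?d z (y \<oplus>\<^bsub>Y\<^esub> y') = ?d z y + ?d z y'" "?d z (c \<odot>\<^bsub>Y\<^esub> y) = c * ?d z y" "?d z \<zero>\<^bsub>Y\<^esub> = 0"
    if "supp z \<subseteq> paths G" "y \<in> carrier Y" "y' \<in> carrier Y" for z y y' c
    using derivation_on_paths_linear[OF that(1)] that(2,3) linear_form_zero[OF module_Y]
    by (auto simp: linear_form_def)
  let ?m = "\<lambda>z z'. z \<otimes>\<^bsub>path_algebra G\<^esub> z' :: ('v, 'e) path \<Rightarrow>\<^sub>0 'k"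
  have m_simps: "?m (x + z) w = ?m x w + ?m z w" "?m w (x + z) = ?m w x + ?m w z"
      "?m (scale c x) w = scale c (?m x w)" "?m w (scale c x) = scale c (?m w x)" "?m 0 w = 0" "?m w 0 = 0" for x z w c
    by (simp_all add: lin_ext_add lin_ext_fadd lin_ext_scale lin_ext_fscale lin_ext_f0)
  have act: "lact Y (z + z') y = lact Y z y \<oplus>\<^bsub>Y\<^esub> lact Y z' y" "ract Y y (z + z') = ract Y y z \<oplus>\<^bsub>Y\<^esub> ract Y y z'"
      "lact Y (scale c z) y = c \<odot>\<^bsub>Y\<^esub> lact Y z y" "ract Y y (scale c z) = c \<odot>\<^bsub>Y\<^esub> ract Y y z"
      "lact Y z y \<in> carrier Y" "ract Y y z \<in> carrier Y"
    if "supp z \<subseteq> paths G" "supp z' \<subseteq> paths G" "y \<in> carrier Y" for z z' y c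
    using that Y.add_lact[of z z' y] Y.add_ract[of z z' y] Y.smult_lact[of z y c] Y.smult_ract[of z y c]
      Y.lact_closed[of z y] Y.ract_closed[of z y] by simp_all
  show "?d (z \<otimes>\<^bsub>path_algebra G\<^esub> z') y = ?d z' (ract Y y z) + ?d z (lact Y z' y)"
    if "z \<in> carrier (path_algebra G)" "z' \<in> carrier (path_algebra G)" "y \<in> carrier Y" for z z' y
  proof -
    note y = that(3)
    have z: "supp z \<subseteq> paths G" and z': "supp z' \<subseteq> paths G" using that by simp_all
    have gen_basis: "?d (?m (basis \<beta>) z') y = ?d z' (ract Y y (basis \<beta>)) + ?d (basis \<beta>) (lact Y z' y)"
      if \<beta>: "\<beta> \<in> paths G" for \<beta>
      using z'
    proof (induction z' rule: free_induct)
      case zero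
      show ?case unfolding m_simps d_simps using \<beta> y by (simp add: zero_act lin)
    next
      case (gen \<alpha>)
      obtain u p v where "\<alpha> = (u, p, v)" by (cases \<alpha>)
      moreover obtain u' q w where "\<beta> = (u', q, w)" by (cases \<beta>)
      ultimately show ?case
        unfolding path_mult using derivation_product[of u p v u' q w y] gen \<beta> y
        by (simp add: derivation_on_paths_def eval_form_simps)
    next
      case (add a b)
      then show ?case
        unfolding m_simps d_simps using \<beta> y by (simp add: act lin d_simps del: path_algebra_sel)
    next
      case (scale c a)
      then show ?case
        unfolding m_simps d_simps using \<beta> y by (simp add: act lin d_simps algebra_simps del: path_algebra_sel)
    qed
    from z show ?thesis
    proof (induction z rule: free_induct)
      case zero
      show ?case unfolding m_simps d_simps using z' y by (simp add: zero_act lin)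
    next
      case (gen \<beta>)
      then show ?case by (rule \<open>\<And>\<beta>. \<beta> \<in> paths G \<Longrightarrow> _\<close>)
    next
      case (add a b)
      then show ?case
        unfolding m_simps d_simps using z' y by (simp add: act lin d_simps del: path_algebra_sel)
    next
      case (scale c a)
      then show ?case
        unfolding m_simps d_simps using z' y by (simp add: act lin d_simps algebra_simps del: path_algebra_sel)
    qed
  qed
qed

end

section \<open>Adding arrows to a bound quiver algebra\<close>

lemma
  assumes A: "k_algebra A" and I: "ideal I A"
  shows quotient_space_ideal: "quotient_space A I"
    and quotient_algebra: "k_algebra (quot_space A I)"
    and quotient_algebra_map: "algebra_map A (quot_space A I) (\<lambda>x. I +>\<^bsub>A\<^esub> x)"
proof -
  interpret k_algebra A by fact
  interpret I: ideal I A by fact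
  have mon: "Group.monoid A" by (rule ring.axioms(2)[OF k_algebra.axioms(1)[OF A]])
  have one: "\<one>\<^bsub>A\<^esub> \<in> carrier A" by (rule monoid.one_closed[OF mon])
  have mc: "x \<otimes>\<^bsub>A\<^esub> y \<in> carrier A" if "x \<in> carrier A" "y \<in> carrier A" for x y
    by (rule monoid.m_closed[OF mon that])
  have mod: "Module.module ground A" by (rule k_algebra.axioms(2)[OF A])
  show Q: "quotient_space A I"
  proof (intro quotient_space.intro quotient_space_axioms.intro mod k_submoduleI)
    show "I \<subseteq> carrier A" by (rule I.a_subset)
    show "\<zero>\<^bsub>A\<^esub> \<in> I" by (rule I.zero_closed)
    show "x \<oplus>\<^bsub>A\<^esub> y \<in> I" if "x \<in> I" "y \<in> I" for x y using that by (rule I.a_closed)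
    show "c \<odot>\<^bsub>A\<^esub> x \<in> I" if x: "x \<in> I" for c x
    proof -
      have xA: "x \<in> carrier A" using x I.a_subset by blast
      have "(c \<odot>\<^bsub>A\<^esub> \<one>\<^bsub>A\<^esub>) \<otimes>\<^bsub>A\<^esub> x \<in> I" using one by (intro I.I_l_closed x smult_closed) simp_all
      then show ?thesis using xA one by (simp add: smult_mult_left monoid.l_one[OF mon])
    qed
  qed
  interpret Q: quotient_space A I by (rule Q)
  let ?Q = "quot_space A I" and ?c = "\<lambda>x. I +>\<^bsub>A\<^esub> x"
  have qmod: "Module.module ground ?Q" by (rule Q.quot_space_module)
  have ring: "ring ?Q" by (rule ring_transfer[OF I.quotient_is_ring]) (simp_all add: quot_space_def)
  have hom: "?c \<in> ring_hom A ?Q"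
    using I.rcos_ring_hom by (simp add: ring_hom_def quot_space_def)
  note mult = ring_hom_mult[OF hom] and smult = Q.coset_smult
  show "algebra_map A ?Q ?c" using hom smult by (simp add: algebra_map_def)
  have sc: "c \<odot>\<^bsub>A\<^esub> x \<in> carrier A" if "x \<in> carrier A" for c x
    using that by (intro smult_closed) simp_all
  show "k_algebra ?Q"
  proof (intro k_algebra.intro k_algebra_axioms.intro ring qmod)
    fix X Z c assume "X \<in> carrier ?Q" "Z \<in> carrier ?Q"
    then obtain x z where *: "x \<in> carrier A" "X = ?c x" "z \<in> carrier A" "Z = ?c z"
      unfolding Q.quot_space_sel(1) by blast
    show "(c \<odot>\<^bsub>?Q\<^esub> X) \<otimes>\<^bsub>?Q\<^esub> Z = c \<odot>\<^bsub>?Q\<^esub> (X \<otimes>\<^bsub>?Q\<^esub> Z)" "X \<otimes>\<^bsub>?Q\<^esub> (c \<odot>\<^bsub>?Q\<^esub> Z) = c \<odot>\<^bsub>?Q\<^esub> (X \<otimes>\<^bsub>?Q\<^esub> Z)"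
      using *(1,3) unfolding *(2,4)
      by (simp_all only: smult mult[symmetric] sc mc smult_mult_left smult_mult_right)
  qed
qed

locale new_arrow_quiver = Q: fin_digraph Q
  for Q :: "('v, 'e) pre_digraph" +
  fixes F :: "'f set" and s t :: "'f \<Rightarrow> 'v"
  assumes new_arrows: "new_arrows Q F s t"
begin

sublocale QF: fin_digraph "add_arrows Q F s t"
  by (rule add_arrows_fin_digraph[OF Q.fin_digraph_axioms new_arrows])

lemma add_arrows_sel:
  "verts (add_arrows Q F s t) = verts Q" "arcs (add_arrows Q F s t) = Inl ` arcs Q \<union> Inr ` F"
  "tail (add_arrows Q F s t) (Inl e) = tail Q e" "head (add_arrows Q F s t) (Inl e) = head Q e"
  "tail (add_arrows Q F s t) (Inr f) = s f" "head (add_arrows Q F s t) (Inr f) = t f"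
  by (simp_all add: add_arrows_def)

lemma path_inclusion_path: "(u, p, v) \<in> paths Q \<Longrightarrow> (u, map Inl p, v) \<in> paths (add_arrows Q F s t)"
  by (induction p arbitrary: u)
    (simp_all add: Q.path_Cons_iff QF.path_Cons_iff Q.path_Nil_iff QF.path_Nil_iff add_arrows_sel)

lemma path_inclusion_algebra_map:
  "algebra_map (path_algebra Q :: ('k::field, _) module) (path_algebra (add_arrows Q F s t)) path_inclusion"
proof -
  let ?i = "\<lambda>(u, p, v). basis (u, map Inl p, v) :: ('v, 'e + 'f) path \<Rightarrow>\<^sub>0 'k"
  have prod: "lin_ext ?i (path_prod \<beta> \<alpha>) = lin_ext (\<lambda>\<beta>'. lin_ext (path_prod \<beta>') (?i \<alpha>)) (?i \<beta>)" for \<alpha> \<beta> :: "('v, 'e) path"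
    by (cases \<alpha>; cases \<beta>) simp
  have mult: "path_inclusion (x \<otimes>\<^bsub>path_algebra Q\<^esub> y) =
      path_inclusion x \<otimes>\<^bsub>path_algebra (add_arrows Q F s t)\<^esub> (path_inclusion y :: _ \<Rightarrow>\<^sub>0 'k)" for x y
  proof -
    have "lin_ext (\<lambda>b. lin_ext (\<lambda>\<alpha>. lin_ext ?i (path_prod b \<alpha>)) y) x =
      lin_ext (\<lambda>b. lin_ext (\<lambda>\<beta>. lin_ext (\<lambda>\<alpha>. lin_ext (path_prod \<beta>) (?i \<alpha>)) y) (?i b)) x"
    proof (rule lin_ext_cong)
      fix b :: "('v, 'e) path"
      obtain u p v where b: "b = (u, p, v)" by (cases b)
      show "lin_ext (\<lambda>\<alpha>. lin_ext ?i (path_prod b \<alpha>)) y =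
          lin_ext (\<lambda>\<beta>. lin_ext (\<lambda>\<alpha>. lin_ext (path_prod \<beta>) (?i \<alpha>)) y) (?i b)"
        by (simp only: prod) (simp add: b)
    qed
    then show ?thesis by (simp add: path_inclusion_def lin_ext_comp)
  qed
  show ?thesis
    unfolding algebra_map_def ring_hom_def
  proof (intro conjI CollectI funcsetI ballI allI)
    show "path_inclusion x \<in> carrier (path_algebra (add_arrows Q F s t))"
      if "x \<in> carrier (path_algebra Q)" for x :: "_ \<Rightarrow>\<^sub>0 'k"
      using that unfolding path_inclusion_def path_algebra_sel mem_Collect_eq
      by (rule lin_ext_keys) (auto simp: path_inclusion_path)
    show "path_inclusion \<one>\<^bsub>path_algebra Q\<^esub> = (\<one>\<^bsub>path_algebra (add_arrows Q F s t)\<^esub> :: _ \<Rightarrow>\<^sub>0 'k)"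
      by (simp add: path_inclusion_def lin_ext_sum add_arrows_sel)
  qed (use mult in \<open>simp_all add: path_inclusion_def lin_ext_add lin_ext_scale\<close>)
qed

end

locale bound_quiver_extension = new_arrow_quiver Q F s t
  for Q :: "('v, 'e) pre_digraph" and F :: "'f set" and s t :: "'f \<Rightarrow> 'v" +
  fixes I :: "(('v, 'e) path \<Rightarrow>\<^sub>0 'k::field) set"
  assumes I: "ideal I (path_algebra Q)"
begin

abbreviation "PQ \<equiv> path_algebra Q :: ('k, ('v, 'e) path \<Rightarrow>\<^sub>0 'k) module"
abbreviation "PF \<equiv> path_algebra (add_arrows Q F s t) :: ('k, ('v, 'e + 'f) path \<Rightarrow>\<^sub>0 'k) module"
abbreviation "J \<equiv> extended_ideal Q I F s t"

lemma PQ_algebra: "k_algebra PQ" and PF_algebra: "k_algebra PF"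
  by (rule Q.path_algebra_k_algebra, rule QF.path_algebra_k_algebra)

lemma inclusion_subset: "path_inclusion ` I \<subseteq> carrier PF"
  using algebra_mapD(1)[OF path_inclusion_algebra_map] additive_subgroup.a_subset[OF ideal.axioms(1)[OF I]]
  by blast

lemma extended_ideal_ideal: "ideal J PF"
  unfolding extended_ideal_def
  by (rule ring.genideal_ideal[OF k_algebra.axioms(1)[OF PF_algebra] inclusion_subset])

lemma inclusion_extended_ideal: "x \<in> I \<Longrightarrow> path_inclusion x \<in> J"
  using ring.genideal_self[OF k_algebra.axioms(1)[OF PF_algebra] inclusion_subset]
  unfolding extended_ideal_def by blast

lemma canonical_map_coset:
  assumes "x \<in> carrier PQ"
  shows "canonical_map Q I F s t (I +>\<^bsub>PQ\<^esub> x) = J +>\<^bsub>PF\<^esub> path_inclusion x"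
  unfolding canonical_map_def
  by (rule quotient_space.quot_map_coset[OF quotient_space_ideal[OF PQ_algebra I]
        quotient_space_ideal[OF PF_algebra extended_ideal_ideal] _ _ _ assms])
    (rule algebra_mapD[OF path_inclusion_algebra_map] inclusion_extended_ideal; assumption)+

lemma bound_algebra_k_algebra: "k_algebra (bound_algebra Q I)"
  unfolding bound_algebra_def by (rule quotient_algebra[OF PQ_algebra I])

lemma carrier_bound_algebra: "carrier (bound_algebra Q I) = (\<lambda>x. I +>\<^bsub>PQ\<^esub> x) ` carrier PQ"
  unfolding bound_algebra_def by (rule quotient_space.quot_space_sel(1)[OF quotient_space_ideal[OF PQ_algebra I]])

lemma class_map_Q: "algebra_map PQ (bound_algebra Q I) (\<lambda>x. I +>\<^bsub>PQ\<^esub> x)"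
  unfolding bound_algebra_def by (rule quotient_algebra_map[OF PQ_algebra I])

lemma class_map_F: "algebra_map PF (extended_algebra Q I F s t) (\<lambda>x. J +>\<^bsub>PF\<^esub> x)"
  unfolding extended_algebra_def bound_algebra_def
  by (rule quotient_algebra_map[OF PF_algebra extended_ideal_ideal])

lemma canonical_map_algebra_map:
  "algebra_map (bound_algebra Q I) (extended_algebra Q I F s t) (canonical_map Q I F s t)"
proof -
  note q = algebra_mapD[OF class_map_Q] and f = algebra_mapD[OF class_map_F]
    and i = algebra_mapD[OF path_inclusion_algebra_map] and c = canonical_map_coset
  interpret PQ: k_algebra PQ by (rule PQ_algebra)
  have mon: "Group.monoid PQ" by (rule ring.axioms(2)[OF k_algebra.axioms(1)[OF PQ_algebra]])
  have cl: "x \<oplus>\<^bsub>PQ\<^esub> y \<in> carrier PQ" "x \<otimes>\<^bsub>PQ\<^esub> y \<in> carrier PQ" "a \<odot>\<^bsub>PQ\<^esub> x \<in> carrier PQ"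
    if "x \<in> carrier PQ" "y \<in> carrier PQ" for x y a
    using that abelian_monoid.a_closed[OF abelian_group.axioms(1)[OF Q.path_algebra_abelian_group]]
      monoid.m_closed[OF mon] module.smult_closed[OF k_algebra.axioms(2)[OF PQ_algebra], of a x]
    by (simp_all del: path_algebra_sel)
  have one: "\<one>\<^bsub>PQ\<^esub> \<in> carrier PQ" by (rule monoid.one_closed[OF mon])
  show ?thesis
    unfolding algebra_map_def
  proof (intro conjI ring_hom_memI ballI allI)
    fix X assume "X \<in> carrier (bound_algebra Q I)"
    then obtain x where x: "x \<in> carrier PQ" "X = I +>\<^bsub>PQ\<^esub> x" unfolding carrier_bound_algebra by blast
    show "canonical_map Q I F s t X \<in> carrier (extended_algebra Q I F s t)"
      unfolding x(2) c[OF x(1)] by (rule f(1)[OF i(1)[OF x(1)]])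
    show "canonical_map Q I F s t (a \<odot>\<^bsub>bound_algebra Q I\<^esub> X) =
        a \<odot>\<^bsub>extended_algebra Q I F s t\<^esub> canonical_map Q I F s t X" for a
      using x(1) cl(3)[OF x(1) x(1)] unfolding x(2) by (simp only: q(5)[symmetric] c i(5) f(5) i(1))
    fix Z assume "Z \<in> carrier (bound_algebra Q I)"
    then obtain z where z: "z \<in> carrier PQ" "Z = I +>\<^bsub>PQ\<^esub> z" unfolding carrier_bound_algebra by blast
    show "canonical_map Q I F s t (X \<otimes>\<^bsub>bound_algebra Q I\<^esub> Z) =
        canonical_map Q I F s t X \<otimes>\<^bsub>extended_algebra Q I F s t\<^esub> canonical_map Q I F s t Z"
      using x(1) z(1) cl(2)[OF x(1) z(1)] unfolding x(2) z(2) by (simp only: q(3)[symmetric] c i(3) f(3) i(1))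
    show "canonical_map Q I F s t (X \<oplus>\<^bsub>bound_algebra Q I\<^esub> Z) =
        canonical_map Q I F s t X \<oplus>\<^bsub>extended_algebra Q I F s t\<^esub> canonical_map Q I F s t Z"
      using x(1) z(1) cl(1)[OF x(1) z(1)] unfolding x(2) z(2) by (simp only: q(2)[symmetric] c i(2) f(2) i(1))
  next
    show "canonical_map Q I F s t \<one>\<^bsub>bound_algebra Q I\<^esub> = \<one>\<^bsub>extended_algebra Q I F s t\<^esub>"
      using one by (simp only: q(4)[symmetric] c i(4) f(4))
  qed
qed

end

section \<open>Extension of derivations to the larger algebra\<close>

text \<open>
  The elements of the ideal at which the derivation vanishes form an ideal themselves, because by the Leibniz rule the
  derivation of a product involves the ideal acting on \<open>Y\<close> or a value that is already zero.
\<close>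

lemma derivation_kills_ideal:
  assumes A: "k_algebra A" and X: "X \<subseteq> carrier A" and Y: "bimodule A Y" and d: "derivation_form A Y d"
    and act: "\<And>z y. z \<in> genideal A X \<Longrightarrow> y \<in> carrier Y \<Longrightarrow> lact Y z y = \<zero>\<^bsub>Y\<^esub> \<and> ract Y y z = \<zero>\<^bsub>Y\<^esub>"
    and gen: "\<And>z y. z \<in> X \<Longrightarrow> y \<in> carrier Y \<Longrightarrow> d z y = 0"
    and z: "z \<in> genideal A X" "y \<in> carrier Y"
  shows "d z y = 0"
proof -
  interpret Y: bimodule A Y by (rule Y)
  have ring: "ring A" by (rule k_algebra.axioms(1)[OF A])
  interpret J: ideal "genideal A X" A by (rule ring.genideal_ideal[OF ring X])
  have form: "linear_form Y (d a)" if "a \<in> carrier A" for a using d that by (simp add: derivation_form_def)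
  have lin: "linear_form A (\<lambda>a. d a y)" if "y \<in> carrier Y" for y using d that by (simp add: derivation_form_def)
  have leib: "d (a \<otimes>\<^bsub>A\<^esub> b) y = d b (ract Y y a) + d a (lact Y b y)"
    if "a \<in> carrier A" "b \<in> carrier A" "y \<in> carrier Y" for a b y
    using d that by (simp add: derivation_form_def)
  have zero: "d a \<zero>\<^bsub>Y\<^esub> = 0" if "a \<in> carrier A" for a
    by (rule linear_form_zero[OF bimodule.axioms(2)[OF Y] form[OF that]])
  have zero': "d \<zero>\<^bsub>A\<^esub> y = 0" if "y \<in> carrier Y" for y
    using linear_form_zero[OF k_algebra.axioms(2)[OF A] lin[OF that]] by simp
  let ?K = "{z \<in> genideal A X. \<forall>y\<in>carrier Y. d z y = 0}"
  have JA: "z \<in> carrier A" if "z \<in> genideal A X" for z using that J.a_subset by blast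
  have K: "ideal ?K A"
  proof (rule idealI[OF ring])
    show "subgroup ?K (add_monoid A)"
    proof (rule group.subgroupI)
      show "Group.group (add_monoid A)"
        by (rule comm_group.axioms(2)[OF abelian_group.a_comm_group[OF ring.is_abelian_group[OF ring]]])
      show "?K \<subseteq> carrier (add_monoid A)" using JA by auto
      show "?K \<noteq> {}" using J.zero_closed zero' by blast
      fix a assume a: "a \<in> ?K"
      have "linear_form A (\<lambda>a. d a y) \<Longrightarrow> d (\<ominus>\<^bsub>A\<^esub> a) y = 0" if y: "y \<in> carrier Y" for y
      proof -
        have "d (\<zero>\<^bsub>A\<^esub> \<ominus>\<^bsub>A\<^esub> a) y = d \<zero>\<^bsub>A\<^esub> y - d a y"
          using a JA J.zero_closed by (intro linear_form_minus[OF k_algebra.axioms(2)[OF A] lin[OF y]]) auto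
        moreover have "\<zero>\<^bsub>A\<^esub> \<ominus>\<^bsub>A\<^esub> a = \<ominus>\<^bsub>A\<^esub> a"
          using a JA abelian_monoid.l_zero[OF abelian_group.axioms(1)[OF ring.is_abelian_group[OF ring]]]
            abelian_group.a_inv_closed[OF ring.is_abelian_group[OF ring], of a] by (auto simp: a_minus_def)
        ultimately show ?thesis using a y zero'[OF y] by simp
      qed
      then show "inv\<^bsub>add_monoid A\<^esub> a \<in> ?K"
        using a J.a_inv_closed[of a] lin by (auto simp flip: a_inv_def)
      fix b assume "b \<in> ?K"
      then show "a \<otimes>\<^bsub>add_monoid A\<^esub> b \<in> ?K"
        using a J.a_closed[of a b] lin JA by (auto simp: linear_form_def)
    qed
    fix a x assume a: "a \<in> ?K" and x: "x \<in> carrier A"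
    show "x \<otimes>\<^bsub>A\<^esub> a \<in> ?K"
      using a x J.I_l_closed[of a x] JA by (auto simp: leib act zero Y.ract_closed)
    show "a \<otimes>\<^bsub>A\<^esub> x \<in> ?K"
      using a x J.I_r_closed[of a x] JA by (auto simp: leib act zero Y.lact_closed)
  qed
  have "X \<subseteq> ?K" using gen ring.genideal_self[OF ring X] by blast
  then have "genideal A X \<subseteq> ?K" by (rule ring.genideal_minimal[OF ring K])
  then show ?thesis using z by blast
qed

lemma derivation_descends:
  assumes A: "k_algebra A" and I: "ideal I A" and Y: "bimodule (quot_space A I) Y"
    and d: "derivation_form A (restrict_bimodule (\<lambda>z. I +>\<^bsub>A\<^esub> z) Y) d"
    and kill: "\<And>z y. z \<in> I \<Longrightarrow> y \<in> carrier Y \<Longrightarrow> d z y = 0"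
  shows "\<exists>r. derivation_form (quot_space A I) Y r \<and>
    (\<forall>z\<in>carrier A. \<forall>y\<in>carrier Y. r (I +>\<^bsub>A\<^esub> z) y = d z y)"
proof -
  let ?c = "\<lambda>z. I +>\<^bsub>A\<^esub> z" and ?r = "\<lambda>X. d (SOME z. z \<in> X)"
  interpret Q: quotient_space A I by (rule quotient_space_ideal[OF A I])
  note c = algebra_mapD[OF quotient_algebra_map[OF A I]]
  have ring: "ring A" by (rule k_algebra.axioms(1)[OF A])
  have cl: "x \<oplus>\<^bsub>A\<^esub> y \<in> carrier A" "x \<otimes>\<^bsub>A\<^esub> y \<in> carrier A" "a \<odot>\<^bsub>A\<^esub> x \<in> carrier A"
    if "x \<in> carrier A" "y \<in> carrier A" for x y a
    using abelian_monoid.a_closed[OF abelian_group.axioms(1)[OF ring.is_abelian_group[OF ring]] that]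
      monoid.m_closed[OF ring.axioms(2)[OF ring] that]
      module.smult_closed[OF k_algebra.axioms(2)[OF A], of a x] that by simp_all
  have lin: "linear_form A (\<lambda>a. d a y)" if "y \<in> carrier Y" for y using d that by (simp add: derivation_form_def)
  have r: "?r (?c z) y = d z y" if z: "z \<in> carrier A" and y: "y \<in> carrier Y" for z y
  proof -
    have "(SOME z'. z' \<in> ?c z) \<in> ?c z" using Q.a_rcos_self[OF z] by (rule someI)
    then obtain i where i: "i \<in> I" "(SOME z'. z' \<in> ?c z) = i \<oplus>\<^bsub>A\<^esub> z" by (auto simp: a_r_coset_def')
    have "i \<in> carrier A" using i(1) Q.a_subset by blast
    then have "d (i \<oplus>\<^bsub>A\<^esub> z) y = d i y + d z y" using lin[OF y] z by (simp add: linear_form_def)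
    then show ?thesis using i kill y by simp
  qed
  have rep: "\<exists>x\<in>carrier A. X = ?c x" if "X \<in> carrier (quot_space A I)" for X
    using that unfolding Q.quot_space_sel(1) by blast
  interpret Y: bimodule "quot_space A I" Y by (rule Y)
  have "derivation_form (quot_space A I) Y ?r"
    unfolding derivation_form_def
  proof (intro conjI ballI)
    fix X assume "X \<in> carrier (quot_space A I)"
    then obtain x where x: "x \<in> carrier A" "X = ?c x" using rep by blast
    have M: "Module.module ground Y" by (rule bimodule.axioms(2)[OF Y])
    have "linear_form (restrict_bimodule ?c Y) (d x)" using d x(1) by (simp add: derivation_form_def)
    then show "linear_form Y (?r X)"
      unfolding linear_form_def x(2)
      using r[OF x(1)] abelian_monoid.a_closed[OF abelian_group.axioms(1)[OF module.axioms(2)[OF M]]]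
        module.smult_closed[OF M] by simp
    fix Z y assume "Z \<in> carrier (quot_space A I)" and y: "y \<in> carrier Y"
    then obtain z where z: "z \<in> carrier A" "Z = ?c z" using rep by blast
    have "d (x \<otimes>\<^bsub>A\<^esub> z) y = d z (ract Y y (?c x)) + d x (lact Y (?c z) y)"
      using d x(1) z(1) y by (simp add: derivation_form_def)
    then show "?r (X \<otimes>\<^bsub>quot_space A I\<^esub> Z) y = ?r Z (ract Y y X) + ?r X (lact Y Z y)"
      using r cl(2)[OF x(1) z(1)] x(1) z(1) y Y.ract_closed[OF c(1)[OF x(1)] y] Y.lact_closed[OF c(1)[OF z(1)] y]
      unfolding x(2) z(2) by (simp only: c(3)[symmetric])
  next
    fix y assume y: "y \<in> carrier Y"
    show "linear_form (quot_space A I) (\<lambda>X. ?r X y)"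
      unfolding linear_form_def
    proof (intro conjI ballI allI)
      fix X a assume "X \<in> carrier (quot_space A I)"
      then obtain x where x: "x \<in> carrier A" "X = ?c x" using rep by blast
      show "?r (a \<odot>\<^bsub>quot_space A I\<^esub> X) y = a * ?r X y"
        unfolding x(2) c(5)[OF x(1), symmetric] r[OF x(1) y] r[OF cl(3)[OF x(1) x(1)] y]
        using lin[OF y] x(1) by (simp add: linear_form_def)
      fix Z assume "Z \<in> carrier (quot_space A I)"
      then obtain z where z: "z \<in> carrier A" "Z = ?c z" using rep by blast
      show "?r (X \<oplus>\<^bsub>quot_space A I\<^esub> Z) y = ?r X y + ?r Z y"
        unfolding x(2) z(2) c(2)[OF x(1) z(1), symmetric] r[OF x(1) y] r[OF z(1) y] r[OF cl(1)[OF x(1) z(1)] y]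
        using lin[OF y] x(1) z(1) by (simp add: linear_form_def)
    qed
  qed
  then show ?thesis using r by blast
qed

lemma linear_form_path_one:
  fixes L :: "(('v, 'e) path \<Rightarrow>\<^sub>0 'k::field) \<Rightarrow> 'k"
  assumes "linear_form (path_algebra G) L" "finite V" "V \<subseteq> verts G" "fin_digraph G"
  shows "L (\<Sum>v\<in>V. basis (v, [], v)) = (\<Sum>v\<in>V. L (basis (v, [], v)))"
proof -
  interpret fin_digraph G by fact
  have "L 0 = 0"
    using linear_form_zero[OF k_algebra.axioms(2)[OF path_algebra_k_algebra] assms(1)] by simp
  moreover have "supp (\<Sum>v\<in>V. basis (v, [], v) :: _ \<Rightarrow>\<^sub>0 'k) \<subseteq> paths G \<and>
      L (\<Sum>v\<in>V. basis (v, [], v)) = (\<Sum>v\<in>V. L (basis (v, [], v)))"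
    using assms(2,3)
  proof (induction V)
    case (insert v V)
    then show ?case
      using assms(1) by (simp add: linear_form_def vertex_path keys_add_subset)
  qed (simp add: \<open>L 0 = 0\<close>)
  ultimately show ?thesis by simp
qed

context bound_quiver_extension
begin

abbreviation "Bd \<equiv> bound_algebra Q I"
abbreviation "Bx \<equiv> extended_algebra Q I F s t"
abbreviation "\<iota> \<equiv> canonical_map Q I F s t"
abbreviation "vx v \<equiv> basis (v, [], v)"

text \<open>
  The extension is built on the path algebra \<open>PF\<close> of the larger quiver, from the pullback \<open>\<delta>0\<close> of the given
  derivation to the path algebra \<open>PQ\<close>.
\<close>

lemma derivation_extends:
  fixes Y :: "('k, 'y, (('v, 'e + 'f) path \<Rightarrow>\<^sub>0 'k) set) bimodule"
  assumes Y: "bimodule Bx Y" and \<delta>: "derivation_form Bd (restrict_bimodule \<iota> Y) \<delta>"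
  shows "\<exists>r x. derivation_form Bx Y r \<and> linear_form Y x \<and>
    (\<forall>b\<in>carrier Bd. \<forall>y\<in>carrier Y. r (\<iota> b) y = \<delta> b y + x (ract Y y (\<iota> b)) - x (lact Y (\<iota> b) y))"
proof -
  let ?cF = "\<lambda>z. J +>\<^bsub>PF\<^esub> z" and ?cQ = "\<lambda>z. I +>\<^bsub>PQ\<^esub> z"
  let ?i = "path_inclusion :: (_ \<Rightarrow>\<^sub>0 'k) \<Rightarrow> _"
  let ?YF = "restrict_bimodule ?cF Y"
  let ?YQ = "restrict_bimodule ?i ?YF"
  have YF: "bimodule PF ?YF" by (rule restrict_bimodule_bimodule[OF PF_algebra Y class_map_F])
  have YQ: "bimodule PQ ?YQ" by (rule restrict_bimodule_bimodule[OF PQ_algebra YF path_inclusion_algebra_map])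
  have modY: "Module.module ground Y" by (rule bimodule.axioms(2)[OF Y])
  interpret YF: bimodule PF ?YF by (rule YF)
  interpret Z: path_bimodule "add_arrows Q F s t" ?YF "\<lambda>_ _. 0"
    by (intro path_bimodule.intro path_bimodule_axioms.intro QF.fin_digraph_axioms YF)
      (simp_all add: linear_form_def)
  note cQ = algebra_mapD[OF class_map_Q] and i = algebra_mapD[OF path_inclusion_algebra_map]
  define \<delta>0 where "\<delta>0 a y = \<delta> (?cQ a) y" for a y
  have \<delta>0: "derivation_form PQ ?YQ \<delta>0"
    unfolding derivation_form_def
  proof (intro conjI ballI)
    fix a assume a: "a \<in> carrier PQ"
    have "linear_form (restrict_bimodule \<iota> Y) (\<delta> (?cQ a))" using \<delta> cQ(1)[OF a] by (simp add: derivation_form_def)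
    then show "linear_form ?YQ (\<delta>0 a)" unfolding \<delta>0_def by (rule linear_form_transfer) simp_all
    fix b y assume b: "b \<in> carrier PQ" and "y \<in> carrier ?YQ"
    then have y: "y \<in> carrier Y" by simp
    have "\<delta> (?cQ a \<otimes>\<^bsub>Bd\<^esub> ?cQ b) y = \<delta> (?cQ b) (ract Y y (\<iota> (?cQ a))) + \<delta> (?cQ a) (lact Y (\<iota> (?cQ b)) y)"
      using \<delta> cQ(1)[OF a] cQ(1)[OF b] y by (simp add: derivation_form_def)
    then show "\<delta>0 (a \<otimes>\<^bsub>PQ\<^esub> b) y = \<delta>0 b (ract ?YQ y a) + \<delta>0 a (lact ?YQ b y)"
      unfolding \<delta>0_def cQ(3)[OF a b] canonical_map_coset[OF a] canonical_map_coset[OF b] by simp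
  next
    fix y assume "y \<in> carrier ?YQ"
    then have form: "linear_form Bd (\<lambda>X. \<delta> X y)" using \<delta> by (simp add: derivation_form_def)
    have lin: "lin_map PQ Bd ?cQ" by (rule lin_mapI) (rule cQ; assumption)+
    show "linear_form PQ (\<lambda>a. \<delta>0 a y)"
      unfolding \<delta>0_def by (rule linear_form_comp[OF lin form])
  qed
  have \<delta>0_form: "linear_form Y (\<delta>0 a)" if "a \<in> carrier PQ" for a
  proof -
    have "linear_form ?YQ (\<delta>0 a)" using \<delta>0 that unfolding derivation_form_def by blast
    then show ?thesis by (rule linear_form_transfer) simp_all
  qed
  have \<delta>0_leib: "\<delta>0 (a \<otimes>\<^bsub>PQ\<^esub> b) y = \<delta>0 b (ract ?YF y (?i a)) + \<delta>0 a (lact ?YF (?i b) y)"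
    if "a \<in> carrier PQ" "b \<in> carrier PQ" "y \<in> carrier Y" for a b y
    using \<delta>0 that unfolding derivation_form_def by simp
  have \<delta>0_zero: "\<delta>0 a \<zero>\<^bsub>Y\<^esub> = 0" if "a \<in> carrier PQ" for a
    by (rule linear_form_zero[OF modY \<delta>0_form[OF that]])
  have ivx: "?i (vx v) = vx v" for v by (simp add: path_inclusion_def)
  have vQ: "vx v \<in> carrier PQ" if "v \<in> verts Q" for v using that by (simp add: Q.vertex_path)
  have vF: "(v, [], v) \<in> paths (add_arrows Q F s t)" if "v \<in> verts Q" for v
    using that by (simp add: QF.vertex_path add_arrows_sel)
  have vl: "lact ?YF (vx v) y \<in> carrier Y"
    if "v \<in> verts Q" "y \<in> carrier Y" for v y
    using Z.path_lact[OF vF[OF that(1)], of y] that(2) by simp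
  have vmQ: "vx w \<otimes>\<^bsub>PQ\<^esub> vx v = (if v = w then vx w else 0)" for v w by simp
  \<comment> \<open>The element \<open>\<Sum> \<delta>(v) v\<close> of the dual bimodule, summed over the vertices \<open>v\<close>. For a vertex \<open>w\<close> one finds
    \<open>w x - x w = \<delta>(w) w - \<delta>(w) - \<delta>(w) w = - \<delta>(w)\<close>, as \<open>w \<delta>(v) = \<delta>(w v) - \<delta>(w) v\<close> and the vertices are
    orthogonal with sum \<open>1\<close>. So adding this inner derivation makes \<open>\<delta>\<close> vanish on the vertices.\<close>
  define x where "x y = (\<Sum>v\<in>verts Q. \<delta>0 (vx v) (lact ?YF (vx v) y))" for y
  have x: "linear_form Y x"
  proof -
    have "linear_form Y (\<lambda>y. \<delta>0 (vx v) (lact ?YF (vx v) y))" if v: "v \<in> verts Q" for v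
    proof -
      have "lin_map Y Y (lact ?YF (vx v))"
        using vl[OF v] YF.lact_add[of "vx v"] YF.lact_smult[of "vx v"] vF[OF v] by (intro lin_mapI) simp_all
      then show ?thesis by (rule linear_form_comp[OF _ \<delta>0_form[OF vQ[OF v]]])
    qed
    then show ?thesis unfolding linear_form_def x_def
      by (simp add: sum.distrib sum_distrib_left)
  qed
  define \<delta>1 where "\<delta>1 a y = \<delta>0 a y + (x (ract ?YQ y a) - x (lact ?YQ a y))" for a y
  have xQ: "linear_form ?YQ x" using x by (rule linear_form_transfer) simp_all
  have \<delta>1: "derivation_form PQ ?YQ \<delta>1"
    unfolding \<delta>1_def by (rule derivation_form_add[OF YQ \<delta>0 derivation_form_inner[OF YQ xQ]])
  have \<delta>1_vertex: "\<delta>1 (vx w) y = 0" if w: "w \<in> verts Q" and y: "y \<in> carrier Y" for w y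
  proof -
    have c1: "\<delta>0 (vx v) (lact ?YF (vx v) (ract ?YF y (vx w))) =
        (if v = w then \<delta>0 (vx w) (lact ?YF (vx w) y) else 0) - \<delta>0 (vx w) (lact ?YF (vx v) y)"
      if v: "v \<in> verts Q" for v
    proof -
      have e1: "\<delta>0 (vx w \<otimes>\<^bsub>PQ\<^esub> vx v) (lact ?YF (vx v) y) =
          \<delta>0 (vx v) (ract ?YF (lact ?YF (vx v) y) (vx w)) + \<delta>0 (vx w) (lact ?YF (vx v) (lact ?YF (vx v) y))"
        using \<delta>0_leib[OF vQ[OF w] vQ[OF v] vl[OF v y]] by (simp only: ivx)
      have e2: "ract ?YF (lact ?YF (vx v) y) (vx w) = lact ?YF (vx v) (ract ?YF y (vx w))"
        using Z.path_lact_ract[OF vF[OF v] vF[OF w], of y] y by simp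
      have e3: "lact ?YF (vx v) (lact ?YF (vx v) y) = lact ?YF (vx v) y"
        using Z.path_lact_lact[OF vF[OF v] vF[OF v], of y] y by simp
      have e4: "\<delta>0 (vx w \<otimes>\<^bsub>PQ\<^esub> vx v) (lact ?YF (vx v) y) =
          (if v = w then \<delta>0 (vx w) (lact ?YF (vx w) y) else 0)"
      proof -
        have "\<delta>0 0 (lact ?YF (vx v) y) = 0"
          using \<delta>0 linear_form_zero[OF k_algebra.axioms(2)[OF PQ_algebra], of "\<lambda>a. \<delta>0 a (lact ?YF (vx v) y)"] vl[OF v y]
          by (simp add: derivation_form_def)
        then show ?thesis unfolding vmQ by simp
      qed
      show ?thesis using e1 unfolding e2 e3 e4 by (simp only: add_diff_cancel_right')
    qed
    have one: "(\<Sum>v\<in>verts Q. \<delta>0 (vx w) (lact ?YF (vx v) y)) = \<delta>0 (vx w) y"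
    proof -
      have "lin_map PF Y (\<lambda>z. lact ?YF z y)"
        using YF.lact_closed[of _ y] YF.add_lact[of _ _ y] YF.smult_lact[of _ y] y by (intro lin_mapI) simp_all
      then have "linear_form PF (\<lambda>z. \<delta>0 (vx w) (lact ?YF z y))"
        by (rule linear_form_comp[OF _ \<delta>0_form[OF vQ[OF w]]])
      from linear_form_path_one[OF this _ _ QF.fin_digraph_axioms, of "verts Q"]
      have "(\<Sum>v\<in>verts Q. \<delta>0 (vx w) (lact ?YF (vx v) y)) = \<delta>0 (vx w) (lact ?YF (\<Sum>v\<in>verts Q. vx v) y)"
        by (simp add: add_arrows_sel)
      also have "lact ?YF (\<Sum>v\<in>verts Q. vx v) y = y"
        using YF.lact_one[of y] y by (simp add: add_arrows_sel)
      finally show ?thesis .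
    qed
    have "x (ract ?YF y (vx w)) = \<delta>0 (vx w) (lact ?YF (vx w) y) - \<delta>0 (vx w) y"
    proof -
      have "x (ract ?YF y (vx w)) = (\<Sum>v\<in>verts Q.
          (if v = w then \<delta>0 (vx w) (lact ?YF (vx w) y) else 0) - \<delta>0 (vx w) (lact ?YF (vx v) y))"
        unfolding x_def by (rule sum.cong[OF refl c1])
      also have "\<dots> = \<delta>0 (vx w) (lact ?YF (vx w) y) - \<delta>0 (vx w) y"
        unfolding sum_subtractf one using w by simp
      finally show ?thesis .
    qed
    moreover have "x (lact ?YF (vx w) y) = \<delta>0 (vx w) (lact ?YF (vx w) y)"
    proof -
      have "\<delta>0 (vx v) (lact ?YF (vx v) (lact ?YF (vx w) y)) = (if v = w then \<delta>0 (vx w) (lact ?YF (vx w) y) else 0)"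
        if v: "v \<in> verts Q" for v
        using Z.path_lact_lact[OF vF[OF w] vF[OF v], of y] y Z.zero_act(1)[of y] \<delta>0_zero[OF vQ[OF v]] by auto
      then have "x (lact ?YF (vx w) y) = (\<Sum>v\<in>verts Q. if v = w then \<delta>0 (vx w) (lact ?YF (vx w) y) else 0)"
        unfolding x_def by (rule sum.cong[OF refl])
      then show ?thesis using w by simp
    qed
    ultimately show ?thesis unfolding \<delta>1_def by (simp add: ivx)
  qed
  have \<delta>1_leib: "\<delta>1 (a \<otimes>\<^bsub>PQ\<^esub> b) y = \<delta>1 b (ract ?YF y (?i a)) + \<delta>1 a (lact ?YF (?i b) y)"
    if "a \<in> carrier PQ" "b \<in> carrier PQ" "y \<in> carrier Y" for a b y
    using \<delta>1 that unfolding derivation_form_def by simp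
  define D :: "'e + 'f \<Rightarrow> 'y \<Rightarrow> 'k" where "D = case_sum (\<lambda>e. \<delta>1 (Q.arrow e)) (\<lambda>_ _. 0)"
  interpret R: path_bimodule "add_arrows Q F s t" ?YF D
  proof (intro path_bimodule.intro path_bimodule_axioms.intro QF.fin_digraph_axioms YF)
    fix a assume a: "a \<in> arcs (add_arrows Q F s t)"
    show "linear_form ?YF (D a)"
    proof (cases a)
      case (Inl e)
      with a have "Q.arrow e \<in> carrier PQ" by (auto simp: add_arrows_sel Q.arrow_path)
      then have "linear_form ?YQ (\<delta>1 (Q.arrow e))" using \<delta>1 by (simp add: derivation_form_def)
      then show ?thesis unfolding D_def Inl sum.case by (rule linear_form_transfer) simp_all
    qed (simp add: D_def linear_form_def)
    fix y assume "y \<in> carrier ?YF"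
    then have y: "y \<in> carrier Y" by simp
    show "D a (lact ?YF (vx (tail (add_arrows Q F s t) a)) y) = D a y"
    proof (cases a)
      case (Inl e)
      with a have e: "e \<in> arcs Q" by (auto simp: add_arrows_sel)
      have eQ: "Q.arrow e \<in> carrier PQ" using e by (simp add: Q.arrow_path)
      have tv: "tail Q e \<in> verts Q" using e by simp
      have "ract ?YF y (?i (Q.arrow e)) \<in> carrier Y"
        using YF.ract_closed[OF i(1)[OF eQ], of y] y by simp
      then have "\<delta>1 (vx (tail Q e)) (ract ?YF y (?i (Q.arrow e))) = 0" by (rule \<delta>1_vertex[OF tv])
      then have "\<delta>1 (Q.arrow e \<otimes>\<^bsub>PQ\<^esub> vx (tail Q e)) y = \<delta>1 (Q.arrow e) (lact ?YF (vx (tail Q e)) y)"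
        using \<delta>1_leib[OF eQ vQ[OF tv] y] by (simp only: ivx add_0)
      moreover have "Q.arrow e \<otimes>\<^bsub>PQ\<^esub> vx (tail Q e) = Q.arrow e" by simp
      ultimately show ?thesis unfolding D_def Inl sum.case add_arrows_sel by simp
    qed (simp add: D_def)
  qed
  let ?d = "derivation_on_paths (add_arrows Q F s t) ?YF D"
  have d_inclusion: "?d (?i b) y = \<delta>1 b y" if b: "b \<in> carrier PQ" and y: "y \<in> carrier Y" for b y
  proof -
    have path: "R.\<Delta> v (map Inl p) y = \<delta>1 (basis (u, p, v)) y" if "(u, p, v) \<in> paths Q" "y \<in> carrier Y" for u p v y
      using that
    proof (induction p arbitrary: u y)
      case Nil
      then show ?case using \<delta>1_vertex[of v y] by (auto simp: Q.path_Nil_iff)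
    next
      case (Cons e p)
      then have e: "e \<in> arcs Q" and u: "u = tail Q e" and p: "(head Q e, p, v) \<in> paths Q"
        by (auto simp: Q.path_Cons_iff)
      have eF: "(tail Q e, [Inl e], head Q e) \<in> paths (add_arrows Q F s t)"
        using path_inclusion_path[OF Q.arrow_path[OF e]] by simp
      have ie: "?i (Q.arrow e) = basis (tail Q e, [Inl e], head Q e)"
        and ip: "?i (basis (head Q e, p, v)) = basis (head Q e, map Inl p, v)"
        by (simp_all add: path_inclusion_def)
      have eQ: "Q.arrow e \<in> carrier PQ" and pQ: "basis (head Q e, p, v) \<in> carrier PQ"
        using e p by (simp_all add: Q.arrow_path)
      have ly: "lact ?YF (basis (tail Q e, [Inl e], head Q e)) y \<in> carrier Y"
        using R.path_lact[OF eF, of y] Cons.prems(2) by simp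
      have "basis (u, e # p, v) = basis (head Q e, p, v) \<otimes>\<^bsub>PQ\<^esub> Q.arrow e" using u by simp
      then have "\<delta>1 (basis (u, e # p, v)) y =
          \<delta>1 (Q.arrow e) (ract ?YF y (basis (head Q e, map Inl p, v))) +
          \<delta>1 (basis (head Q e, p, v)) (lact ?YF (basis (tail Q e, [Inl e], head Q e)) y)"
        using \<delta>1_leib[OF pQ eQ Cons.prems(2)] by (simp only: ie ip)
      also have "\<dots> = R.\<Delta> v (map Inl (e # p)) y"
        unfolding Cons.IH[OF p ly, symmetric] list.map path_derivation.simps add_arrows_sel
        by (simp add: D_def)
      finally show ?case by simp
    qed
    have "supp b \<subseteq> paths Q" using b by simp
    then show ?thesis
    proof (induction b rule: free_induct)
      case zero
      have "\<delta>1 0 y = 0"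
        using linear_form_zero[OF k_algebra.axioms(2)[OF PQ_algebra], of "\<lambda>a. \<delta>1 a y"] \<delta>1 y
        by (simp add: derivation_form_def)
      then show ?case by (simp add: path_inclusion_def derivation_on_paths_def eval_form_simps)
    next
      case (gen \<alpha>)
      then show ?case using path[OF _ y] by (cases \<alpha>) (simp add: path_inclusion_def derivation_on_paths_def eval_form_simps)
    next
      case (add a b)
      have "linear_form PQ (\<lambda>a. \<delta>1 a y)" using \<delta>1 y by (simp add: derivation_form_def)
      then have "\<delta>1 (a + b) y = \<delta>1 a y + \<delta>1 b y" using add by (simp add: linear_form_def)
      then show ?case using add by (simp add: path_inclusion_def derivation_on_paths_def eval_form_simps lin_ext_add)
    next
      case (scale c a)
      have "linear_form PQ (\<lambda>a. \<delta>1 a y)" using \<delta>1 y by (simp add: derivation_form_def)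
      then have "\<delta>1 (scale c a) y = c * \<delta>1 a y" using scale by (simp add: linear_form_def)
      then show ?case using scale by (simp add: path_inclusion_def derivation_on_paths_def eval_form_simps lin_ext_scale)
    qed
  qed
  have JF: "ideal J PF" by (rule extended_ideal_ideal)
  have cF0: "?cF z = \<zero>\<^bsub>Bx\<^esub>" if "z \<in> J" for z
    using that quotient_space.coset_eq_self_iff[OF quotient_space_ideal[OF PF_algebra JF], of z]
      quotient_space.quot_space_sel(2)[OF quotient_space_ideal[OF PF_algebra JF]]
      additive_subgroup.a_subset[OF ideal.axioms(1)[OF JF]]
    by (auto simp: extended_algebra_def bound_algebra_def)
  have cF00: "?cF 0 = \<zero>\<^bsub>Bx\<^esub>"
    using cF0 additive_subgroup.zero_closed[OF ideal.axioms(1)[OF JF]] by simp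
  have act0: "lact ?YF z y = \<zero>\<^bsub>?YF\<^esub> \<and> ract ?YF y z = \<zero>\<^bsub>?YF\<^esub>" if "z \<in> J" "y \<in> carrier ?YF" for z y
  proof -
    have "lact ?YF z y = lact ?YF 0 y" "ract ?YF y z = ract ?YF y 0"
      using cF0[OF that(1)] cF00 by simp_all
    then show ?thesis using Z.zero_act[OF that(2)] by simp
  qed
  have gen: "?d z y = 0" if "z \<in> ?i ` I" "y \<in> carrier ?YF" for z y
  proof -
    from that(1) obtain a where a: "a \<in> I" "z = ?i a" by blast
    have y: "y \<in> carrier Y" using that(2) by simp
    have aQ: "a \<in> carrier PQ" using a(1) additive_subgroup.a_subset[OF ideal.axioms(1)[OF I]] by blast
    have "?cQ a = \<zero>\<^bsub>Bd\<^esub>"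
      using a(1) aQ quotient_space.coset_eq_self_iff[OF quotient_space_ideal[OF PQ_algebra I], of a]
        quotient_space.quot_space_sel(2)[OF quotient_space_ideal[OF PQ_algebra I]]
      by (simp add: bound_algebra_def)
    then have "\<delta>0 a y = 0"
      using linear_form_zero[OF k_algebra.axioms(2)[OF bound_algebra_k_algebra], of "\<lambda>X. \<delta> X y"] \<delta> y
      by (simp add: \<delta>0_def derivation_form_def)
    moreover have "lact ?YQ a y = \<zero>\<^bsub>Y\<^esub>" "ract ?YQ y a = \<zero>\<^bsub>Y\<^esub>"
      using act0[OF inclusion_extended_ideal[OF a(1)] that(2)] by simp_all
    ultimately have "\<delta>1 a y = 0" using linear_form_zero[OF modY x] by (simp only: \<delta>1_def diff_self add_0)
    then show ?thesis unfolding a(2) d_inclusion[OF aQ y] .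
  qed
  have kill: "?d z y = 0" if "z \<in> J" "y \<in> carrier Y" for z y
    by (rule derivation_kills_ideal[OF PF_algebra inclusion_subset YF R.derivation_form_paths])
      (use act0 gen that in \<open>auto simp only: extended_ideal_def restrict_bimodule_sel\<close>)
  have "\<exists>r. derivation_form Bx Y r \<and> (\<forall>z\<in>carrier PF. \<forall>y\<in>carrier Y. r (?cF z) y = ?d z y)"
    using derivation_descends[OF PF_algebra JF, of Y ?d] Y R.derivation_form_paths kill
    by (simp only: extended_algebra_def bound_algebra_def)
  then obtain r where r: "derivation_form Bx Y r" "\<forall>z\<in>carrier PF. \<forall>y\<in>carrier Y. r (?cF z) y = ?d z y"
    by blast
  have "r (\<iota> b) y = \<delta> b y + x (ract Y y (\<iota> b)) - x (lact Y (\<iota> b) y)"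
    if b: "b \<in> carrier Bd" and y: "y \<in> carrier Y" for b y
  proof -
    from b obtain a where a: "a \<in> carrier PQ" "b = ?cQ a" unfolding carrier_bound_algebra by blast
    have "r (\<iota> b) y = \<delta>1 a y"
      unfolding a(2) canonical_map_coset[OF a(1)] using r(2) i(1)[OF a(1)] y d_inclusion[OF a(1) y] by simp
    then show ?thesis unfolding \<delta>1_def \<delta>0_def a(2) canonical_map_coset[OF a(1)] by simp
  qed
  then show ?thesis using r(1) x by blast
qed

end

theorem theorem5p1:
  fixes Q :: "('v, 'e) pre_digraph"
    and I :: "(('v, 'e) path \<Rightarrow>\<^sub>0 'k::field) set"
    and F :: "'f set"
    and s t :: "'f \<Rightarrow> 'v"
    and Y :: "('k, 'y, (('v, 'e + 'f) path \<Rightarrow>\<^sub>0 'k) set) bimodule"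
  defines "B \<equiv> bound_algebra Q I"
    and "BF \<equiv> extended_algebra Q I F s t"
    and "\<phi> \<equiv> canonical_map Q I F s t"
  assumes "fin_digraph Q"
    and "admissible Q I"
    and "new_arrows Q F s t"
    and "\<nexists>\<gamma>. relative_cycle Q I F s t \<gamma>"
    and "bimodule BF Y"
    and "finite_dimensional Y"
  shows "short_exact
    (hochschild B (restrict_bimodule \<phi> Y) 1)
    (hochschild BF Y 1)
    (rel_hochschild BF (\<phi> ` carrier B) Y 1)
    (hoch_map \<phi> BF (scalars BF) Y 1)
    (hoch_map id BF (\<phi> ` carrier B) Y 1)"
proof -
  have "ideal I (path_algebra Q)" using assms(5) by (simp add: admissible_def)
  then interpret bound_quiver_extension Q F s t I
    using assms(4,6)
    by (intro bound_quiver_extension.intro bound_quiver_extension_axioms.intro new_arrow_quiver.intro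
        new_arrow_quiver_axioms.intro)
  interpret algebra_extension Bd Bx \<iota> Y
    using assms(8) bound_algebra_k_algebra canonical_map_algebra_map
    unfolding BF_def by (intro algebra_extension.intro)
  show ?thesis
    unfolding hochschild_def B_def BF_def \<phi>_def One_nat_def
    by (rule homology_short_exact[OF derivation_extends[OF coefficients]])
qed

end
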